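(* Let $f$ be a function transcendental and meromorphic in the plane with $T(r,f) = O((\log r)^2)$ as $r\to\infty$, and set $$g(z) = \Delta f(z) = f(z+1)-f(z), \qquad G(z) = \frac{\Delta f(z)}{f(z)} = \frac{f(z+1)-f(z)}{f(z)}.$$ Then at least one of $g$ and $G$ has infinitely many zeros.
   Context: $T(r,f)$ denotes the Nevanlinna characteristic of a meromorphic function $f$. *)

theory Defs
  imports "HOL-Complex_Analysis.Complex_Analysis" "HOL-Library.Landau_Symbols"
          "HOL-Computational_Algebra.Polynomial"
begin

text \<open>A meromorphic function on the plane is represented by f :: complex \<Rightarrow> complex with
  f meromorphic_on UNIV; its values at the (isolated) singular points are irrelevant.\<close>

definition lnplus :: "real \<Rightarrow> real" where
  "lnplus x = (if x \<le> 1 then 0 else ln x)"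

definition pole_mult :: "(complex \<Rightarrow> complex) \<Rightarrow> complex \<Rightarrow> nat" where
  "pole_mult f z = (if is_pole f z then nat (- zorder f z) else 0)"

definition pole_count :: "(complex \<Rightarrow> complex) \<Rightarrow> real \<Rightarrow> real" where
  "pole_count f t = real (\<Sum>z\<in>{z\<in>cball 0 t. is_pole f z}. pole_mult f z)"

definition proximity :: "(complex \<Rightarrow> complex) \<Rightarrow> real \<Rightarrow> real" where
  "proximity f r = (1 / (2 * pi)) *
     integral {0..2*pi} (\<lambda>\<theta>. lnplus (norm (f (of_real r * exp (\<i> * of_real \<theta>)))))"

definition counting :: "(complex \<Rightarrow> complex) \<Rightarrow> real \<Rightarrow> real" where
  "counting f r = integral {0..r} (\<lambda>t. (pole_count f t - pole_count f 0) / t)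
                  + pole_count f 0 * ln r"

definition nevanlinna_T :: "(complex \<Rightarrow> complex) \<Rightarrow> real \<Rightarrow> real" where
  "nevanlinna_T f r = proximity f r + counting f r"

definition transcendental_mero :: "(complex \<Rightarrow> complex) \<Rightarrow> bool" where
  "transcendental_mero f \<longleftrightarrow> f meromorphic_on UNIV \<and>
     \<not> (\<exists>p q :: complex poly. q \<noteq> 0 \<and> (\<forall>\<^sub>\<approx>z\<in>UNIV. f z = poly p z / poly q z))"

text \<open>Zeros of a meromorphic function h: points where (the meromorphic extension of) h
  takes the value 0, i.e. where h tends to 0.\<close>
definition mero_zeros :: "(complex \<Rightarrow> complex) \<Rightarrow> complex set" where
  "mero_zeros h = {z. (h \<longlongrightarrow> 0) (at z)}"

end

theory Submission
  imports Defs "HOL-Real_Asymp.Real_Asymp"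
begin

text \<open>
  Suppose that \<open>g\<close> and \<open>G\<close> have finitely many zeros, and write \<open>N(h,r)\<close> for the number of zeros minus the
  number of poles of \<open>h\<close> in \<open>\<bar>z\<bar> < r\<close>. Since \<open>T(r,f) = O((log r)\<^sup>2)\<close>, the zeros and poles of \<open>f'\<close> are so
  sparse that there are arbitrarily large \<open>r\<close> for which an annulus of fixed modulus around \<open>\<bar>z\<bar> = r\<close> is
  free of them and \<open>z f''/f'\<close> differs from \<open>M = N(f',r)\<close> by a bounded amount there. On such circles
  \<open>g \<sim> f'\<close>, so \<open>N(g,r) = M\<close>.

  If \<open>f\<close> has infinitely many poles, cancellation of poles in \<open>g\<close> would create zeros of \<open>G\<close>, so \<open>g\<close> has,
  besides at least as many poles as \<open>f\<close>, an additional pole for every maximal run \<open>b, b+1, \<dots>, b+k\<close> of poles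
  of \<open>f\<close>. There are infinitely many runs, hence \<open>M + n(r,f) \<rightarrow> -\<infinity>\<close>. But if \<open>M\<close> is very negative, integrating
  \<open>f'\<close> shows that \<open>(M+1)(f - \<alpha>) \<sim> z f'\<close> on the circle for some constant \<open>\<alpha>\<close>, hence
  \<open>M + 1 = N(f - \<alpha>,r) \<ge> -n(r,f)\<close>, a contradiction.

  If \<open>f\<close> has finitely many poles, then \<open>M = N(g,r)\<close> is bounded above, so \<open>f'\<close> has finitely many zeros and
  poles; the growth bound then makes \<open>f'\<close>, and hence \<open>f\<close>, rational.
\<close>

section \<open>Zeros and poles of meromorphic functions\<close>

text \<open>The exponent 2 makes the annuli possible: a pole of modulus at most \<open>r\<close>
  adds at least \<open>log r\<close> to the integrated counting function at \<open>r^2\<close>, so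
  there are only \<open>O(log r)\<close> of them. In the coordinate \<open>log |z|\<close> the zeros
  and poles of \<open>f'\<close> then have bounded average density, and the constants of the annuli
  do not depend on \<open>r\<close>.

  Since \<open>f'\<close> has to be controlled, the characteristic is traded at once for
  factorizations \<open>f = V / P\<close> in discs, with \<open>log |V| = O((log R)^2)\<close> and
  \<open>deg P = O(log R)\<close>. This form survives the quotient rule.

  The model behind the contradiction is \<open>f' = z^M\<close> with
  \<open>f = z^(M+1)/(M+1) + \<alpha>\<close>. The true \<open>f'\<close> may deviate from a power
  by a factor \<open>exp (K pi)\<close> around the circle, and the constant of integration can be
  isolated once \<open>f'\<close> decays outwards fast enough to swamp that factor. Hence
  \<open>M\<close> has to be very negative, which is what infinitely many runs of poles
  provide.\<close>

text \<open>By the identity principle a meromorphic function that is not identically zero satisfies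
  the second clause at every point (\<open>nontriv_meroI\<close>). The local form is the side
  condition under which \<open>zorder\<close> is additive.\<close>

definition nontriv_mero :: "(complex \<Rightarrow> complex) \<Rightarrow> bool" where
  "nontriv_mero f \<longleftrightarrow> f meromorphic_on UNIV \<and> (\<forall>z. \<forall>\<^sub>F w in at z. f w \<noteq> 0)"

lemma nontriv_mero_meromorphic: "nontriv_mero f \<Longrightarrow> f meromorphic_on A"
  unfolding nontriv_mero_def using meromorphic_on_subset by blast

lemma nontriv_mero_ev: "nontriv_mero f \<Longrightarrow> \<forall>\<^sub>F w in at z. f w \<noteq> 0"
  by (simp add: nontriv_mero_def)

lemma nontriv_mero_freq: "nontriv_mero f \<Longrightarrow> \<exists>\<^sub>F w in at z. f w \<noteq> 0"
  by (simp add: nontriv_mero_def eventually_frequently)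

lemma nontriv_meroI:
  assumes "f meromorphic_on UNIV" "\<not> (\<forall>\<^sub>\<approx>z\<in>UNIV. f z = 0)"
  shows "nontriv_mero f"
  using meromorphic_imp_constant_or_avoid[OF assms(1), of 0] assms
  by (auto simp: nontriv_mero_def eventually_cosparse_open_eq)

lemma nontriv_mero_mult:
  assumes "nontriv_mero f" "nontriv_mero g"
  shows "nontriv_mero (\<lambda>z. f z * g z)"
  unfolding nontriv_mero_def
proof safe
  show "(\<lambda>z. f z * g z) meromorphic_on UNIV"
    by (intro meromorphic_intros nontriv_mero_meromorphic assms)
  show "\<forall>\<^sub>F w in at z. f w * g w \<noteq> 0" for z
    using nontriv_mero_ev[OF assms(1), of z] nontriv_mero_ev[OF assms(2), of z]
    by eventually_elim auto
qed

lemma nontriv_mero_inverse: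
  assumes "nontriv_mero f"
  shows "nontriv_mero (\<lambda>z. inverse (f z))"
  using assms unfolding nontriv_mero_def by (auto intro: meromorphic_intros)

lemma nontriv_mero_divide:
  assumes "nontriv_mero f" "nontriv_mero g"
  shows "nontriv_mero (\<lambda>z. f z / g z)"
  using nontriv_mero_mult[OF assms(1) nontriv_mero_inverse[OF assms(2)]]
  by (simp add: field_simps)

lemma nontriv_mero_powi:
  assumes "nontriv_mero f"
  shows "nontriv_mero (\<lambda>z. f z powi n)"
  unfolding nontriv_mero_def
proof safe
  show "(\<lambda>z. f z powi n) meromorphic_on UNIV"
    by (intro meromorphic_intros nontriv_mero_meromorphic assms)
  show "\<forall>\<^sub>F w in at z. f w powi n \<noteq> 0" for z
    using nontriv_mero_ev[OF assms(1), of z] by eventually_elim auto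
qed

lemma nontriv_mero_const: "c \<noteq> 0 \<Longrightarrow> nontriv_mero (\<lambda>_. c)"
  by (auto simp: nontriv_mero_def)

lemma nontriv_mero_linear: "nontriv_mero (\<lambda>w. w - c)"
  unfolding nontriv_mero_def
proof safe
  show "(\<lambda>w. w - c) meromorphic_on UNIV" by (intro meromorphic_intros)
  show "\<forall>\<^sub>F w in at z. w - c \<noteq> 0" for z
    using eventually_neq_at_within[of c z UNIV] by simp
qed

lemma nontriv_mero_prod:
  assumes "\<And>x. x \<in> A \<Longrightarrow> nontriv_mero (h x)"
  shows "nontriv_mero (\<lambda>z. \<Prod>x\<in>A. h x z)"
  using assms
  by (induction A rule: infinite_finite_induct) (auto intro: nontriv_mero_const nontriv_mero_mult)

lemma nontriv_mero_shift:
  assumes "nontriv_mero f"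
  shows "nontriv_mero (\<lambda>z. f (z + c))"
  unfolding nontriv_mero_def
proof safe
  show "(\<lambda>z. f (z + c)) meromorphic_on UNIV"
    by (rule meromorphic_on_compose[of f UNIV])
       (auto intro!: analytic_intros nontriv_mero_meromorphic assms)
  show "\<forall>\<^sub>F w in at z. f (w + c) \<noteq> 0" for z
    using nontriv_mero_ev[OF assms, of "z + c"]
    by (simp add: at_to_0'[of z] at_to_0'[of "c+z"] eventually_filtermap add_ac)
qed

lemma nontriv_mero_remove_sings:
  assumes "nontriv_mero f"
  shows "nontriv_mero (remove_sings f)"
  unfolding nontriv_mero_def
proof safe
  show "remove_sings f meromorphic_on UNIV"
    by (intro meromorphic_intros nontriv_mero_meromorphic assms)
  show "\<forall>\<^sub>F w in at z. remove_sings f w \<noteq> 0" for z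
  proof -
    have "f meromorphic_on {z}" by (rule nontriv_mero_meromorphic[OF assms])
    then have "isolated_singularity_at f z" by (simp add: meromorphic_at_iff)
    from eventually_remove_sings_eq_at[OF this] nontriv_mero_ev[OF assms, of z]
    show ?thesis by eventually_elim auto
  qed
qed

lemma nontriv_mero_isolated:
  assumes "nontriv_mero f"
  shows "isolated_singularity_at f z" "not_essential f z"
  using nontriv_mero_meromorphic[OF assms, of "{z}"] by (auto simp: meromorphic_at_iff)

lemma nontriv_zorder_mult:
  assumes "nontriv_mero f" "nontriv_mero g"
  shows "zorder (\<lambda>z. f z * g z) z = zorder f z + zorder g z"
  by (intro zorder_mult nontriv_mero_meromorphic nontriv_mero_freq assms)

lemma nontriv_zorder_divide:
  assumes "nontriv_mero f" "nontriv_mero g"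
  shows "zorder (\<lambda>z. f z / g z) z = zorder f z - zorder g z"
  by (intro zorder_divide nontriv_mero_meromorphic nontriv_mero_freq assms)

lemma zorder_linear_powi: "zorder (\<lambda>w. (w - c) powi n) z = (if z = c then n else 0)"
proof (cases "z = c")
  case True
  have "zorder (\<lambda>w. (w - c) powi n) c = n"
    by (rule zorder_eqI[where S = UNIV and g = "\<lambda>_. 1"]) auto
  with True show ?thesis by simp
next
  case False
  then show ?thesis
    by (auto intro!: zorder_eq_0I analytic_intros)
qed

lemma nontriv_mero_prod_linear: "nontriv_mero (\<lambda>w. \<Prod>b\<in>B. (w - b) ^ m b)"
proof -
  have "nontriv_mero (\<lambda>w. \<Prod>b\<in>B. (w - b) powi int (m b))"
    by (intro nontriv_mero_prod nontriv_mero_powi nontriv_mero_linear)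
  then show ?thesis by simp
qed

lemma zorder_prod_linear_powi:
  assumes "finite Z"
  shows "zorder (\<lambda>w. \<Prod>c\<in>Z. (w - c) powi n c) z = (if z \<in> Z then n z else 0)"
proof -
  have "zorder (\<lambda>w. \<Prod>c\<in>Z. (w - c) powi n c) z = (\<Sum>c\<in>Z. zorder (\<lambda>w. (w - c) powi n c) z)"
  proof (rule zorder_prod)
    show "\<forall>\<^sub>F w in at z. (\<Prod>c\<in>Z. (w - c) powi n c) \<noteq> 0"
      by (intro nontriv_mero_ev nontriv_mero_prod nontriv_mero_powi nontriv_mero_linear)
  qed (intro meromorphic_intros)
  also have "\<dots> = (if z \<in> Z then n z else 0)"
    by (simp only: zorder_linear_powi eq_commute[of z] sum.delta[OF assms])
  finally show ?thesis .
qed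

text \<open>Connects \<open>mero_zeros\<close>, which is defined by limits, with orders.\<close>

lemma nontriv_zorder_pos_iff:
  assumes "nontriv_mero f"
  shows "zorder f z > 0 \<longleftrightarrow> (f \<longlongrightarrow> 0) (at z)"
proof
  assume "zorder f z > 0"
  then have "isolated_zero f z"
    by (intro zorder_pos_imp_isolated_zero nontriv_mero_meromorphic nontriv_mero_ev assms)
  then show "(f \<longlongrightarrow> 0) (at z)" by (simp add: isolated_zero_def)
next
  assume "(f \<longlongrightarrow> 0) (at z)"
  then have "isolated_zero f z" using nontriv_mero_ev[OF assms] by (simp add: isolated_zero_def)
  then show "zorder f z > 0"
    by (intro zorder_isolated_zero_pos' nontriv_mero_isolated assms)
qed

lemma nontriv_zorder_neg_iff:
  assumes "nontriv_mero f"
  shows "zorder f z < 0 \<longleftrightarrow> is_pole f z"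
proof
  assume "zorder f z < 0"
  then show "is_pole f z"
    by (intro zorder_neg_imp_is_pole nontriv_mero_meromorphic nontriv_mero_ev assms)
next
  assume "is_pole f z"
  then show "zorder f z < 0"
    using isolated_pole_imp_neg_zorder[of f z] nontriv_mero_isolated[OF assms, of z] by auto
qed

abbreviation divisor_in :: "(complex \<Rightarrow> complex) \<Rightarrow> real \<Rightarrow> complex set" where
  "divisor_in f R \<equiv> {c \<in> cball 0 R. zorder f c \<noteq> 0}"

text \<open>Points of nonzero order are zeros or poles; these are sparse in the plane, and a sparse
  set meets a compact disc in finitely many points.\<close>

lemma finite_zorder_cball:
  assumes "nontriv_mero f"
  shows "finite {z \<in> cball 0 R. zorder f z \<noteq> 0}"
proof -
  have "\<forall>\<^sub>\<approx>z\<in>UNIV. \<not> is_pole f z \<and> \<not> isolated_zero f z"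
    using nontriv_mero_meromorphic[OF assms, of UNIV]
    by (intro eventually_conj meromorphic_on_imp_not_pole_cosparse meromorphic_on_imp_not_zero_cosparse)
  then have "\<forall>\<^sub>\<approx>z\<in>UNIV. zorder f z = 0"
    by eventually_elim
      (auto intro!: not_pole_not_isolated_zero_imp_zorder_eq_0 nontriv_mero_meromorphic nontriv_mero_freq assms)
  then have "{z. zorder f z \<noteq> 0} sparse_in UNIV"
    by (simp add: eventually_cosparse)
  then have "finite ({z. zorder f z \<noteq> 0} \<inter> cball 0 R)"
    using sparse_in_compact_finite[of "{z. zorder f z \<noteq> 0}" "cball 0 R"] sparse_in_subset[of _ UNIV]
    by (metis Int_commute compact_cball subset_UNIV)
  then show ?thesis by (simp add: Int_def conj_commute)
qed

lemma finite_zorder_ball: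
  assumes "nontriv_mero f"
  shows "finite {z \<in> ball 0 R. zorder f z \<noteq> 0}"
  by (rule finite_subset[OF _ finite_zorder_cball[OF assms, of R]]) auto

lemma zorder_nonneg_analytic_remove_sings:
  assumes "nontriv_mero f" "zorder f z \<ge> 0"
  shows "remove_sings f analytic_on {z}"
proof -
  have "\<not> is_pole f z" using nontriv_zorder_neg_iff[OF assms(1), of z] assms(2) by auto
  then obtain c where "(f \<longlongrightarrow> c) (at z)"
    using nontriv_mero_isolated(2)[OF assms(1), of z] by (auto simp: not_essential_def)
  then show ?thesis
    using remove_sings_analytic_at nontriv_mero_isolated(1)[OF assms(1), of z] by blast
qed

lemma zorder_zero_analytic_remove_sings:
  assumes "nontriv_mero f" "zorder f z = 0"
  shows "remove_sings f analytic_on {z}" "remove_sings f z \<noteq> 0"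
proof -
  show a: "remove_sings f analytic_on {z}"
    by (rule zorder_nonneg_analytic_remove_sings) (use assms in auto)
  have "zorder (remove_sings f) z = 0"
    using assms nontriv_mero_isolated(1)[OF assms(1), of z] by simp
  then show "remove_sings f z \<noteq> 0"
    using zorder_eq_0_iff[OF a] nontriv_mero_freq[OF nontriv_mero_remove_sings[OF assms(1)]] by simp
qed

text \<open>\<open>U\<close> is the quotient by the product, with removable singularities filled in.
  The exponents \<open>n\<close> are arbitrary and the conclusions pointwise, so \<open>Z\<close>
  may be the divisor in a single disc: \<open>U\<close> is zero-free where \<open>n\<close> matches
  the order and still analytic where \<open>n\<close> does not exceed it.\<close>

lemma zero_free_factorization:
  assumes "nontriv_mero f" "finite Z"
  obtains U where "nontriv_mero U"
    "\<And>z. zorder f z = (if z \<in> Z then n z else 0) \<Longrightarrow> U analytic_on {z} \<and> U z \<noteq> 0"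
    "\<And>z. z \<notin> Z \<Longrightarrow> f analytic_on {z} \<Longrightarrow> f z = U z * (\<Prod>c\<in>Z. (z - c) powi n c)"
    "\<And>z. zorder f z \<ge> (if z \<in> Z then n z else 0) \<Longrightarrow> U analytic_on {z}"
proof -
  let ?P = "\<lambda>w. \<Prod>c\<in>Z. (w - c) powi n c"
  let ?q = "\<lambda>w. f w / ?P w"
  have P: "nontriv_mero ?P"
    by (intro nontriv_mero_prod nontriv_mero_powi nontriv_mero_linear)
  have q: "nontriv_mero ?q" by (intro nontriv_mero_divide assms P)
  show ?thesis
  proof (rule that[of "remove_sings ?q"])
    show "nontriv_mero (remove_sings ?q)" by (rule nontriv_mero_remove_sings[OF q])
    fix z
    show "remove_sings ?q analytic_on {z} \<and> remove_sings ?q z \<noteq> 0"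
      if "zorder f z = (if z \<in> Z then n z else 0)"
    proof -
      have "zorder ?q z = 0"
        using nontriv_zorder_divide[OF assms(1) P, of z] that zorder_prod_linear_powi[OF assms(2), of n z]
        by simp
      with zorder_zero_analytic_remove_sings[OF q] show ?thesis by blast
    qed
    show "remove_sings ?q analytic_on {z}" if "zorder f z \<ge> (if z \<in> Z then n z else 0)"
    proof (rule zorder_nonneg_analytic_remove_sings[OF q])
      show "zorder ?q z \<ge> 0"
        using nontriv_zorder_divide[OF assms(1) P, of z] that zorder_prod_linear_powi[OF assms(2), of n z]
        by simp
    qed
    assume z: "z \<notin> Z" "f analytic_on {z}"
    have nz: "?P z \<noteq> 0" using z assms(2) by (auto simp: )
    have "?P analytic_on {z}" using z by (intro analytic_intros) auto
    then have "?q analytic_on {z}" using z nz by (intro analytic_intros) auto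
    then have "remove_sings ?q z = ?q z" by simp
    then show "f z = remove_sings ?q z * ?P z" using nz by simp
  qed
qed

section \<open>Counting zeros minus poles in a disc\<close>

text \<open>This is \<open>N(h,r)\<close> of the overview. Orders are negative at poles, which makes
  the count additive under products.\<close>

definition zcount :: "(complex \<Rightarrow> complex) \<Rightarrow> real \<Rightarrow> int" where
  "zcount f r = (\<Sum>z | z \<in> ball 0 r \<and> zorder f z \<noteq> 0. zorder f z)"

lemma zcount_eq_sum:
  assumes "nontriv_mero f" "finite A" "A \<subseteq> ball 0 r" "\<And>z. z \<in> ball 0 r \<Longrightarrow> zorder f z \<noteq> 0 \<Longrightarrow> z \<in> A"
  shows "zcount f r = (\<Sum>z\<in>A. zorder f z)"
  unfolding zcount_def by (rule sum.mono_neutral_left) (use assms in auto)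

lemma zcount_mult:
  assumes "nontriv_mero f" "nontriv_mero g"
  shows "zcount (\<lambda>z. f z * g z) r = zcount f r + zcount g r"
proof -
  let ?A = "{z \<in> ball 0 r. zorder f z \<noteq> 0} \<union> {z \<in> ball 0 r. zorder g z \<noteq> 0}"
  have fin: "finite ?A" using finite_zorder_ball assms by blast
  have z: "zorder (\<lambda>z. f z * g z) z = zorder f z + zorder g z" for z
    by (rule nontriv_zorder_mult[OF assms])
  have "zcount (\<lambda>z. f z * g z) r = (\<Sum>z\<in>?A. zorder f z + zorder g z)"
    by (subst zcount_eq_sum[OF nontriv_mero_mult[OF assms] fin]) (auto simp: z)
  also have "\<dots> = zcount f r + zcount g r"
    by (subst (1 2) zcount_eq_sum[OF _ fin]) (auto simp: assms sum.distrib)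
  finally show ?thesis .
qed

lemma zcount_divide:
  assumes "nontriv_mero f" "nontriv_mero g"
  shows "zcount (\<lambda>z. f z / g z) r = zcount f r - zcount g r"
proof -
  let ?A = "{z \<in> ball 0 r. zorder f z \<noteq> 0} \<union> {z \<in> ball 0 r. zorder g z \<noteq> 0}"
  have fin: "finite ?A" using finite_zorder_ball assms by blast
  have z: "zorder (\<lambda>z. f z / g z) z = zorder f z - zorder g z" for z
    by (rule nontriv_zorder_divide[OF assms])
  have "zcount (\<lambda>z. f z / g z) r = (\<Sum>z\<in>?A. zorder f z - zorder g z)"
    by (subst zcount_eq_sum[OF nontriv_mero_divide[OF assms] fin]) (auto simp: z)
  also have "\<dots> = zcount f r - zcount g r"
    by (subst (1 2) zcount_eq_sum[OF _ fin]) (auto simp: assms sum_subtractf)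
  finally show ?thesis .
qed

lemma analytic_at_imp_DERIV: "f analytic_on {z} \<Longrightarrow> (f has_field_derivative deriv f z) (at z)"
  by (simp add: analytic_on_imp_differentiable_at field_differentiable_derivI)

text \<open>\<open>Ln (c Q)\<close> is a primitive of \<open>Q'/Q\<close> near the circle, so the argument principle gives 0.\<close>
lemma zcount_eq_0_if_near_const:
  assumes Q: "nontriv_mero Q" and r: "r > 0"
    and an: "\<And>z. norm z = r \<Longrightarrow> Q analytic_on {z}"
    and near: "\<And>z. norm z = r \<Longrightarrow> norm (c * Q z - 1) < 1"
  shows "zcount Q r = 0"
proof -
  \<comment> \<open>The values of \<open>Q\<close> at its singularities are arbitrary; after this
    normalization every point is a pole or a point of analyticity, as the argument principle
    requires.\<close>
  define Q1 where "Q1 = remove_sings Q"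
  have Q1: "nontriv_mero Q1" unfolding Q1_def by (rule nontriv_mero_remove_sings[OF Q])
  have nice: "Q1 nicely_meromorphic_on UNIV"
    unfolding Q1_def by (intro remove_sings_nicely_meromorphic nontriv_mero_meromorphic Q)
  have zo: "zorder Q1 z = zorder Q z" for z
    unfolding Q1_def using nontriv_mero_isolated(1)[OF Q, of z] by simp
  have zc: "zcount Q r = zcount Q1 r" by (simp add: zcount_def zo)
  have Q1eq: "Q1 z = Q z" if "norm z = r" for z using an[OF that] by (simp add: Q1_def)
  have pole_or: "is_pole Q1 z \<or> Q1 analytic_on {z}" for z
    using nicely_meromorphic_on_imp_analytic_at[OF nice, of z] by blast
  have near1: "norm (c * Q1 z - 1) < 1" if "norm z = r" for z using near[OF that] Q1eq[OF that] by simp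
  have nz: "Q1 z \<noteq> 0" if "norm z = r" for z using near1[OF that] by auto
  have npole: "\<not> is_pole Q1 z" if "norm z = r" for z
  proof -
    have "Q analytic_on {z}" using an[OF that] .
    then have "\<not> is_pole Q z" by (rule analytic_at_imp_no_pole)
    then show ?thesis using zo nontriv_zorder_neg_iff[OF Q] nontriv_zorder_neg_iff[OF Q1] by metis
  qed
  have an1: "Q1 analytic_on {z}" if "norm z = r" for z using pole_or npole that by blast
  define S where "S = ball (0::complex) (r + 1)"
  define P where "P = {z. is_pole Q1 z}"
  define pz where "pz = {w \<in> S. Q1 w = 0 \<or> w \<in> P}"
  have pz_zo: "zorder Q1 w \<noteq> 0 \<longleftrightarrow> w \<in> pz" if "w \<in> S" for w
  proof (cases "is_pole Q1 w")
    case True then show ?thesis using that nontriv_zorder_neg_iff[OF Q1, of w] by (auto simp: pz_def P_def)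
  next
    case False
    then have "Q1 analytic_on {w}" using pole_or by blast
    from zorder_eq_0_iff[OF this nontriv_mero_freq[OF Q1]] show ?thesis
      using that False by (auto simp: pz_def P_def)
  qed
  have "pz \<subseteq> {z \<in> cball 0 (r+1). zorder Q1 z \<noteq> 0}"
    using pz_zo by (auto simp: pz_def S_def)
  then have fin: "finite pz" using finite_zorder_cball[OF Q1] finite_subset by blast
  have "contour_integral (circlepath 0 r) (\<lambda>x. deriv Q1 x * 1 / Q1 x) =
      2 * pi * \<i> * (\<Sum>p\<in>pz. winding_number (circlepath 0 r) p * 1 * zorder Q1 p)"
    unfolding pz_def
  proof (rule argument_principle)
    show "Q1 holomorphic_on S - P"
      using pole_or unfolding P_def
      by (intro analytic_imp_holomorphic, subst analytic_on_analytic_at) blast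
    show "path_image (circlepath 0 r) \<subseteq> S - {w \<in> S. Q1 w = 0 \<or> w \<in> P}"
      using r nz npole by (auto simp: S_def P_def)
    show "\<forall>z. z \<notin> S \<longrightarrow> winding_number (circlepath 0 r) z = 0"
      using r by (auto simp: S_def intro!: winding_number_zero_outside[where s = "cball 0 r"])
  qed (use fin r in \<open>auto simp: S_def P_def pz_def\<close>)
  moreover have "contour_integral (circlepath 0 r) (\<lambda>x. deriv Q1 x * 1 / Q1 x) = 0"
  proof (rule contour_integral_unique)
    have cnz: "c \<noteq> 0"
    proof
      assume "c = 0"
      with near1[of "of_real r"] r show False by simp
    qed
    have der: "((\<lambda>z. Ln (c * Q1 z)) has_field_derivative deriv Q1 z * 1 / Q1 z)
        (at z within sphere 0 r)" if "z \<in> sphere 0 r" for z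
    proof -
      have nr: "norm z = r" using that by simp
      \<comment> \<open>The disc of radius 1 about 1 lies in the right half-plane, where the
        principal logarithm is differentiable.\<close>
      have "Re (c * Q1 z) > 0"
        using near1[OF nr] abs_Re_le_cmod[of "c * Q1 z - 1"] by simp
      then have np: "c * Q1 z \<notin> \<real>\<^sub>\<le>\<^sub>0" by (auto simp: complex_nonpos_Reals_iff)
      have "(Q1 has_field_derivative deriv Q1 z) (at z)"
        by (rule analytic_at_imp_DERIV[OF an1[OF nr]])
      then have "((\<lambda>z. Ln (c * Q1 z)) has_field_derivative (c * deriv Q1 z) * inverse (c * Q1 z)) (at z)"
        using np by (auto intro!: derivative_eq_intros simp: field_simps)
      then show ?thesis using cnz nz[OF nr] by (auto simp: field_simps intro: has_field_derivative_at_within)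
    qed
    have "((\<lambda>x. deriv Q1 x * 1 / Q1 x) has_contour_integral
       (Ln (c * Q1 (pathfinish (circlepath 0 r))) - Ln (c * Q1 (pathstart (circlepath 0 r))))) (circlepath 0 r)"
      by (rule contour_integral_primitive[OF der]) (use r in auto)
    then show "((\<lambda>x. deriv Q1 x * 1 / Q1 x) has_contour_integral 0) (circlepath 0 r)" by simp
  qed
  ultimately have "(\<Sum>p\<in>pz. winding_number (circlepath 0 r) p * zorder Q1 p) = 0" by simp
  also have "(\<Sum>p\<in>pz. winding_number (circlepath 0 r) p * zorder Q1 p)
      = (\<Sum>p\<in>pz. if norm p < r then of_int (zorder Q1 p) else 0)"
  proof (rule sum.cong)
    fix p assume p: "p \<in> pz"
    have ne: "norm p \<noteq> r" using p nz npole by (auto simp: pz_def P_def)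
    show "winding_number (circlepath 0 r) p * zorder Q1 p = (if norm p < r then of_int (zorder Q1 p) else 0)"
    proof (cases "norm p < r")
      case True
      then show ?thesis using winding_number_circlepath[of p 0 r] by simp
    next
      case False
      then have "winding_number (circlepath 0 r) p = 0"
        using ne r by (intro winding_number_zero_outside[where s = "cball 0 r"]) auto
      then show ?thesis using False by simp
    qed
  qed auto
  also have "\<dots> = of_int (\<Sum>p\<in>{p\<in>pz. norm p < r}. zorder Q1 p)"
    using fin by (simp add: sum.If_cases Int_def)
  finally have 0: "(\<Sum>p\<in>{p\<in>pz. norm p < r}. zorder Q1 p) = 0" by (simp only: of_int_eq_0_iff)
  have "zcount Q1 r = (\<Sum>p\<in>{p\<in>pz. norm p < r}. zorder Q1 p)"
    by (rule zcount_eq_sum[OF Q1]) (use fin pz_zo in \<open>auto simp: S_def\<close>)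
  with 0 zc show ?thesis by simp
qed

section \<open>Poisson--Jensen and Borel--Caratheodory inequalities\<close>

lemma lnplus_nonneg: "lnplus x \<ge> 0" by (simp add: lnplus_def)

lemma ln_le_lnplus: "x > 0 \<Longrightarrow> ln x \<le> lnplus x" by (simp add: lnplus_def)

text \<open>In this form continuity is visible, since \<open>ln\<close> is applied only to arguments
  at least 1.\<close>

lemma lnplus_eq_max: "lnplus x = max 0 (ln (max 1 x))"
  by (simp add: lnplus_def max_def)

lemma lnplus_mono: "x \<le> y \<Longrightarrow> lnplus x \<le> lnplus y"
  by (simp add: lnplus_def)

lemma lnplus_mult_le:
  assumes "x \<ge> 0" "y \<ge> 0"
  shows "lnplus (x * y) \<le> lnplus x + lnplus y"
proof (cases "x * y \<le> 1")
  case True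
  then show ?thesis using lnplus_nonneg[of x] lnplus_nonneg[of y] by (simp add: lnplus_def)
next
  case False
  then have pos: "x > 0" "y > 0" using assms by (auto simp: less_le intro: ccontr)
  then have "lnplus (x * y) = ln x + ln y" using False by (simp add: lnplus_def ln_mult)
  then show ?thesis using ln_le_lnplus pos by (metis add_mono)
qed

lemma continuous_on_lnplus_norm:
  assumes "continuous_on A h"
  shows "continuous_on A (\<lambda>t. lnplus (norm (h t)))"
  unfolding lnplus_eq_max by (intro continuous_intros assms) auto

abbreviation lnplus_circle :: "(complex \<Rightarrow> complex) \<Rightarrow> real \<Rightarrow> real" where
  "lnplus_circle f R \<equiv> integral {0..2*pi} (\<lambda>t. lnplus (norm (f (of_real R * cis t))))"

text \<open>\<open>ln |U|\<close> is the real part of a branch \<open>L\<close> of the logarithm,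
  hence the Poisson integral of its boundary values. For \<open>|z| \<le> R/2\<close> the kernel is
  at most \<open>(R + |z|) / (R - |z|) \<le> 3\<close>, and it may be replaced by 3 once
  \<open>ln\<close> has been replaced by the nonnegative \<open>lnplus\<close>.\<close>

lemma poisson_zero_free:
  assumes hol: "U holomorphic_on ball 0 R1" and nz: "\<And>w. w \<in> ball 0 R1 \<Longrightarrow> U w \<noteq> 0"
    and R: "0 < R" "R < R1" and z: "norm z \<le> R / 2"
  shows "ln (norm (U z)) \<le> 3 / (2*pi) * lnplus_circle U R"
proof -
  obtain L where L: "L holomorphic_on ball 0 R1" "\<And>w. w \<in> ball 0 R1 \<Longrightarrow> exp (L w) = U w"
    by (rule holomorphic_logarithm_exists[of "ball 0 R1" U 0]) (use hol nz R in auto)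
  have ReL: "Re (L w) = ln (norm (U w))" if "norm w < R1" for w
    using L(2)[of w] that by (metis mem_ball_0 ln_exp norm_exp_eq_Re)
  \<comment> \<open>The added factor equals 1 at \<open>z\<close>, so Cauchy's formula still returns
    \<open>L z\<close>, while on the circle it turns the Cauchy kernel into the Poisson
    kernel.\<close>
  define k where "k = (\<lambda>w. L w * of_real (R^2 - (norm z)^2) / (of_real (R^2) - cnj z * w))"
  have nz2: "of_real (R^2) - cnj z * w \<noteq> 0" if "norm w \<le> R" for w
  proof
    assume "of_real (R^2) - cnj z * w = 0"
    then have "norm (of_real (R^2) :: complex) = norm (cnj z * w)" by simp
    then have "R^2 = norm z * norm w" by (simp add: norm_mult norm_power)
    also have "\<dots> \<le> (R/2) * R" using z that R by (intro mult_mono) auto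
    finally show False using R by (simp add: power2_eq_square)
  qed
  have "k holomorphic_on cball 0 R" unfolding k_def
    by (intro holomorphic_intros holomorphic_on_subset[OF L(1)]) (use R nz2 in auto)
  then have "((\<lambda>u. k u / (u - z)) has_contour_integral (2 * of_real pi * \<i> * k z)) (circlepath 0 R)"
    by (rule Cauchy_integral_circlepath_simple) (use z R in auto)
  moreover have "k z = L z"
  proof -
    have "of_real (R^2 - (norm z)^2) = of_real (R^2) - cnj z * z"
      by (simp add: complex_norm_square[of z, simplified] mult.commute)
    then show ?thesis using nz2[of z] z R by (simp add: k_def)
  qed
  ultimately have int: "((\<lambda>t. k (of_real R * cis t) / (of_real R * cis t - z) * of_real R * \<i> * cis t)
      has_integral (2 * of_real pi * \<i> * L z)) {0..2*pi}"
    by (simp add: circlepath_def has_contour_integral_part_circlepath_iff)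
  \<comment> \<open>The Poisson kernel at \<open>z\<close>, without the factor
    \<open>1 / (2 pi)\<close>.\<close>
  define K where "K = (\<lambda>t. (R^2 - (norm z)^2) / (norm (of_real R * cis t - z))^2)"
  have eq: "k (of_real R * cis t) / (of_real R * cis t - z) * of_real R * \<i> * cis t
     = \<i> * (L (of_real R * cis t) * of_real (K t))" for t
  proof -
    define w where "w = of_real R * cis t"
    have nw: "norm w = R" using R by (simp add: w_def norm_mult)
    have ww: "of_real (R^2) = w * cnj w" using complex_norm_square[of w] nw by (metis of_real_power)
    have wz: "w \<noteq> z" using nw z R by auto
    have "of_real ((norm (w - z))^2) = (w - z) * (cnj w - cnj z)"
      by (simp only: complex_norm_square complex_cnj_diff)
    moreover have "w * (cnj w - cnj z) = of_real (R^2) - cnj z * w" by (simp only: ww right_diff_distrib mult.commute[of "cnj z"])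
    ultimately have "w / ((of_real (R^2) - cnj z * w) * (w - z)) = 1 / of_real ((norm (w - z))^2)"
      using wz nw R by (metis (no_types, lifting) mult.assoc mult.commute mult_divide_mult_cancel_left nonzero_mult_divide_mult_cancel_left2 norm_zero order_less_irrefl mult_1_right)
    then have "L w * of_real (R^2 - (norm z)^2) * (w / ((of_real (R^2) - cnj z * w) * (w - z))) = L w * of_real (K t)"
      by (simp add: K_def w_def)
    moreover have "a / d1 / d2 * of_real R * \<i> * cis t = \<i> * (a * (of_real R * cis t / (d1 * d2)))" for a d1 d2
      by (simp add: field_simps)
    ultimately show ?thesis unfolding k_def by (simp only: w_def)
  qed
  have "((\<lambda>t. Re (L (of_real R * cis t)) * K t) has_integral 2 * pi * Re (L z)) {0..2*pi}"
  proof -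
    have "((\<lambda>t. - \<i> * (\<i> * (L (of_real R * cis t) * of_real (K t)))) has_integral 
        - \<i> * (2 * of_real pi * \<i> * L z)) {0..2*pi}"
      using has_integral_mult_right[OF int[unfolded eq], of "-\<i>"] .
    then have "((\<lambda>t. L (of_real R * cis t) * of_real (K t)) has_integral (2 * of_real pi * L z)) {0..2*pi}"
      by (simp add: algebra_simps)
    from has_integral_linear[OF this bounded_linear_Re] show ?thesis
      by (simp add: o_def)
  qed
  moreover have "((\<lambda>t. 3 * lnplus (norm (U (of_real R * cis t)))) has_integral
     3 * lnplus_circle U R) {0..2*pi}"
  proof (intro has_integral_mult_right integrable_integral integrable_continuous_interval)
    have "continuous_on {0..2*pi} (\<lambda>t. U (of_real R * cis t))"
      by (rule continuous_on_compose2[OF holomorphic_on_imp_continuous_on[OF hol]])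
         (use R in \<open>auto intro!: continuous_intros simp: norm_mult\<close>)
    then show "continuous_on {0..2*pi} (\<lambda>t. lnplus (norm (U (of_real R * cis t))))"
      by (rule continuous_on_lnplus_norm)
  qed
  ultimately have "2 * pi * Re (L z) \<le> 3 * lnplus_circle U R"
  proof (rule has_integral_le)
    fix t
    define w where "w = of_real R * cis t"
    have nw: "norm w = R" using R by (simp add: w_def norm_mult)
    have d: "R - norm z \<le> norm (w - z)" using nw norm_triangle_ineq2[of w z] by simp
    have pos: "R - norm z > 0" using z R by linarith
    have "K t = (R - norm z) * (R + norm z) / (norm (w - z))^2"
      by (simp add: K_def w_def power2_eq_square algebra_simps)
    also have "\<dots> \<le> (R - norm z) * (R + norm z) / (R - norm z)^2"
      using d pos R by (intro divide_left_mono power_mono mult_nonneg_nonneg mult_pos_pos zero_less_power) auto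
    also have "\<dots> = (R + norm z) / (R - norm z)" using pos by (simp add: power2_eq_square)
    also have "\<dots> \<le> 3" using pos z by (simp add: divide_le_eq)
    finally have K3: "K t \<le> 3" .
    have "norm z < R" using pos by simp
    then have K0: "K t \<ge> 0" unfolding K_def by (intro divide_nonneg_nonneg) (auto intro!: power_mono)
    have "Re (L w) * K t \<le> lnplus (norm (U w)) * K t"
      using ReL[of w] nw R nz[of w] by (intro mult_right_mono K0) (auto intro: ln_le_lnplus)
    also have "\<dots> \<le> lnplus (norm (U w)) * 3" by (intro mult_left_mono K3 lnplus_nonneg)
    finally show "Re (L (of_real R * cis t)) * K t \<le> 3 * lnplus (norm (U (of_real R * cis t)))"
      by (simp add: w_def)
  qed
  then show ?thesis using ReL[of z] z R by (simp add: field_simps)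
qed

text \<open>The sign of the right side decides how the modulus of the Blaschke factor
  \<open>R (w - c) / (R^2 - cnj c w)\<close> compares with 1: at most 1 in the disc, equal to 1 on
  the circle.\<close>

lemma blaschke_identity:
  fixes c w :: complex
  shows "(norm (of_real (R^2) - cnj c * w))^2 - (R * norm (w - c))^2 = (R^2 - (norm w)^2) * (R^2 - (norm c)^2)"
  by (simp add: cmod_power2 power_mult_distrib) (simp add: power2_eq_square algebra_simps)

lemma blaschke_le:
  fixes c w :: complex
  assumes "norm c \<le> R" "norm w \<le> R"
  shows "R * norm (w - c) \<le> norm (of_real (R^2) - cnj c * w)"
proof (rule power2_le_imp_le)
  have "R \<ge> 0" using assms norm_ge_zero order_trans by blast
  then have "(R^2 - (norm w)^2) * (R^2 - (norm c)^2) \<ge> 0"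
    using assms by (intro mult_nonneg_nonneg) (auto intro!: power_mono)
  then show "(R * norm (w - c))^2 \<le> (norm (of_real (R^2) - cnj c * w))^2"
    using blaschke_identity[of R c w] by linarith
qed auto

lemma blaschke_eq:
  fixes c w :: complex
  assumes "norm w = R"
  shows "norm (of_real (R^2) - cnj c * w) = R * norm (w - c)"
proof -
  have "(norm (of_real (R^2) - cnj c * w))^2 = (R * norm (w - c))^2"
    using blaschke_identity[of R c w] assms by simp
  moreover have "R \<ge> 0" using assms by auto
  ultimately show ?thesis by (simp add: power2_eq_iff_nonneg)
qed

text \<open>The set where \<open>U\<close> is holomorphic and nonzero is open and contains the
  compact disc, hence also all points within some \<open>e\<close> of it.\<close>

lemma zero_free_nhd_cball:
  assumes "U analytic_on cball 0 R" "\<And>w. w \<in> cball 0 R \<Longrightarrow> U w \<noteq> (0::complex)" "R > 0"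
  obtains R1 where "R1 > R" "U holomorphic_on ball 0 R1" "\<And>w. w \<in> ball 0 R1 \<Longrightarrow> U w \<noteq> 0"
proof -
  obtain S where S: "open S" "cball 0 R \<subseteq> S" "U holomorphic_on S"
    using assms(1) analytic_on_holomorphic by auto
  define T where "T = S \<inter> U -` (- {0})"
  have "open T" unfolding T_def using S holomorphic_on_imp_continuous_on
    by (intro continuous_open_preimage) auto
  moreover have "cball 0 R \<subseteq> T" using S assms(2) by (auto simp: T_def)
  ultimately obtain e where e: "e > 0" "(\<Union>x\<in>cball 0 R. ball x e) \<subseteq> T"
    using compact_subset_open_imp_ball_epsilon_subset[of "cball 0 R" T] by (metis compact_cball)
  have sub: "ball 0 (R + e) \<subseteq> T"
  proof
    fix w :: complex assume w: "w \<in> ball 0 (R + e)"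
    show "w \<in> T"
    proof (cases "norm w \<le> R")
      case True
      then show ?thesis using \<open>cball 0 R \<subseteq> T\<close> by auto
    next
      case False
      \<comment> \<open>The radial projection of \<open>w\<close> to the closed disc, at distance
        \<open>norm w - R\<close>.\<close>
      define x where "x = of_real (R / norm w) * w"
      have nw: "norm w > R" "norm w > 0" using False assms(3) by auto
      have "norm x = R" using nw assms(3) by (simp add: x_def norm_mult norm_divide)
      moreover have "dist x w < e"
      proof -
        have "x - w = of_real (R / norm w - 1) * w" by (simp add: x_def algebra_simps)
        then have "norm (x - w) = \<bar>R / norm w - 1\<bar> * norm w"
          by (simp only: norm_mult norm_of_real)
        also have "\<dots> = norm w - R" using nw by (simp add: abs_if field_simps)
        finally show ?thesis using w by (simp add: dist_norm)
      qed
      ultimately show ?thesis using e(2) by force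
    qed
  qed
  show ?thesis
    by (rule that[of "R + e"]) (use e sub S in \<open>auto simp: T_def intro: holomorphic_on_subset\<close>)
qed

text \<open>Each zero factor \<open>w - c\<close> is exchanged for
  \<open>(R^2 - cnj c w) / R\<close>, which has the same modulus on the circle, at least the same
  modulus inside, and no zero in the closed disc. The boundary integral is unchanged and the
  zero-free case applies.\<close>

lemma poisson_jensen_ineq:
  assumes V: "nontriv_mero V" and an: "V analytic_on cball 0 R" and R: "R > 0"
    and nz: "\<And>w. norm w = R \<Longrightarrow> V w \<noteq> 0" and z: "norm z \<le> R / 2" "V z \<noteq> 0"
  shows "ln (norm (V z)) \<le> 3 / (2*pi) * lnplus_circle V R"
proof -
  define Z where "Z = divisor_in V R"
  have finZ: "finite Z" unfolding Z_def by (rule finite_zorder_cball[OF V])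
  have an1: "V analytic_on {w}" if "norm w \<le> R" for w
    using an that by (auto intro: analytic_on_subset)
  have zo: "zorder V w = 0 \<longleftrightarrow> V w \<noteq> 0" if "norm w \<le> R" for w
    by (rule zorder_eq_0_iff[OF an1[OF that] nontriv_mero_freq[OF V]])
  have zge: "zorder V w \<ge> 0" if "norm w \<le> R" for w
    by (rule zorder_ge_0[OF an1[OF that] nontriv_mero_freq[OF V]])
  have Zlt: "norm c < R" if "c \<in> Z" for c
    using that nz[of c] zo[of c] by (auto simp: Z_def less_le)
  define m where "m = (\<lambda>c. nat (zorder V c))"
  obtain U where U: "nontriv_mero U"
    "\<And>z. zorder V z = (if z \<in> Z then int (m z) else 0) \<Longrightarrow> U analytic_on {z} \<and> U z \<noteq> 0"
    "\<And>z. z \<notin> Z \<Longrightarrow> V analytic_on {z} \<Longrightarrow> V z = U z * (\<Prod>c\<in>Z. (z - c) powi int (m c))"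
    by (rule zero_free_factorization[OF V finZ, of "\<lambda>c. int (m c)"]) blast
  have Uan: "U analytic_on {w}" "U w \<noteq> 0" if "norm w \<le> R" for w
    using U(2)[of w] that zge[of w] by (auto simp: Z_def m_def)
  define W where "W = (\<lambda>w. U w * (\<Prod>c\<in>Z. ((of_real (R^2) - cnj c * w) / of_real R) ^ m c))"
  have fac: "of_real (R^2) - cnj c * w \<noteq> 0" if "c \<in> Z" "norm w \<le> R" for c w
  proof
    assume "of_real (R^2) - cnj c * w = 0"
    then have "norm (of_real (R^2) :: complex) = norm (cnj c * w)" by simp
    then have "R^2 = norm c * norm w" by (simp add: norm_mult norm_power)
    also have "\<dots> \<le> norm c * R" using that by (intro mult_left_mono) auto
    also have "\<dots> < R * R" using Zlt[OF that(1)] R by simp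
    finally show False by (simp add: power2_eq_square)
  qed
  have Wnz: "W w \<noteq> 0" if "w \<in> cball 0 R" for w
    using Uan[of w] that fac R finZ by (auto simp: W_def)
  have Uan': "U analytic_on cball 0 R"
    by (subst analytic_on_analytic_at) (use Uan in auto)
  have Wan: "W analytic_on cball 0 R" unfolding W_def
    by (intro analytic_intros Uan') (use R in auto)
  obtain R1 where R1: "R1 > R" "W holomorphic_on ball 0 R1" "\<And>w. w \<in> ball 0 R1 \<Longrightarrow> W w \<noteq> 0"
    by (rule zero_free_nhd_cball[OF Wan Wnz R]) auto
  have Vn: "norm (V w) = norm (U w) * (\<Prod>c\<in>Z. norm (w - c) ^ m c)" if "w \<notin> Z" "norm w \<le> R" for w
    using U(3)[OF that(1) an1[OF that(2)]] by (simp add: norm_mult prod_norm[symmetric] norm_power)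
  have Wn: "norm (W w) = norm (U w) * (\<Prod>c\<in>Z. (norm (of_real (R^2) - cnj c * w) / R) ^ m c)" for w
    using R by (simp add: W_def norm_mult prod_norm[symmetric] norm_power norm_divide)
  have sph: "norm (V w) = norm (W w)" if "norm w = R" for w
  proof -
    have "w \<notin> Z" using Zlt that by auto
    then show ?thesis using Vn[of w] that R unfolding Wn by (simp add: blaschke_eq del: of_real_power)
  qed
  have "V z \<noteq> 0" "norm z \<le> R" using z R by auto
  then have zZ: "z \<notin> Z" using zo[of z] by (auto simp: Z_def)
  have "norm (V z) \<le> norm (W z)" unfolding Vn[OF zZ \<open>norm z \<le> R\<close>] Wn
  proof (intro mult_left_mono prod_mono conjI power_mono)
    fix c assume "c \<in> Z"
    then show "norm (z - c) \<le> norm (of_real (R^2) - cnj c * z) / R"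
      using blaschke_le[of c R z] Zlt[of c] \<open>norm z \<le> R\<close> R by (simp add: field_simps)
  qed auto
  then have "ln (norm (V z)) \<le> ln (norm (W z))" using z(2) Wnz[of z] \<open>norm z \<le> R\<close> by simp
  also have "\<dots> \<le> 3 / (2*pi) * lnplus_circle W R"
    by (rule poisson_zero_free[OF R1(2,3) R R1(1) z(1)])
  also have "lnplus_circle W R =
     lnplus_circle V R"
    using R by (intro integral_cong) (simp add: sph norm_mult)
  finally show ?thesis .
qed

text \<open>The Borel--Caratheodory argument: a branch \<open>w\<close> of \<open>log U - log U(z0)\<close> has real part below \<open>A\<close>,
  so the Schwarz lemma applies to \<open>w / (2A - w)\<close>.\<close>
lemma log_deriv_bound:
  assumes hol: "U holomorphic_on ball 0 R" and nz: "\<And>w. w \<in> ball 0 R \<Longrightarrow> U w \<noteq> 0"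
    and R: "R > 0" and ub: "\<And>w. w \<in> ball 0 R \<Longrightarrow> norm (U w) \<le> exp K"
    and lb: "norm (U z0) \<ge> exp (-K)" and z0: "norm z0 \<le> R / 16" and z: "norm z \<le> R / 2"
    and K: "K \<ge> 0"
  shows "norm (deriv U z / U z) \<le> 52 * (2 * K + 1) / R"
proof -
  obtain L where L: "L holomorphic_on ball 0 R" "\<And>w. w \<in> ball 0 R \<Longrightarrow> exp (L w) = U w"
    by (rule holomorphic_logarithm_exists[of "ball 0 R" U 0]) (use hol nz R in auto)
  have ReL: "norm (U w) = exp (Re (L w))" if "w \<in> ball 0 R" for w
    using L(2)[OF that] norm_exp_eq_Re by metis
  \<comment> \<open>Real parts at most \<open>K\<close> everywhere and at least \<open>-K\<close> at
    \<open>z0\<close> give \<open>Re w \<le> 2K\<close>; the extra 1 makes the inequality strict and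
    \<open>A\<close> positive.\<close>
  define A where "A = 2 * K + 1"
  have A: "A > 0" using K by (simp add: A_def)
  define w where "w = (\<lambda>z. L z - L z0)"
  have z0R: "z0 \<in> ball 0 R" using z0 R by auto
  have Rew: "Re (w x) < A" if "x \<in> ball 0 R" for x
  proof -
    have "Re (L x) \<le> K" using ub[OF that] ReL[OF that] by simp
    moreover have "Re (L z0) \<ge> - K" using lb ReL[OF z0R] by simp
    ultimately show ?thesis by (simp add: w_def A_def)
  qed
  have whol: "w holomorphic_on ball 0 R" unfolding w_def by (intro holomorphic_intros L)
  have nz2: "2 * of_real A - w x \<noteq> 0" if "x \<in> ball 0 R" for x
  proof
    assume "2 * of_real A - w x = 0"
    then have "w x = of_real (2 * A)" by simp
    then have "Re (w x) = 2 * A" by simp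
    then show False using Rew[OF that] A by simp
  qed
  define \<phi> where "\<phi> = (\<lambda>x. w x / (2 * of_real A - w x))"
  have \<phi>hol: "\<phi> holomorphic_on ball 0 R" unfolding \<phi>_def
    by (intro holomorphic_intros whol) (use nz2 in auto)
  have \<phi>1: "norm (\<phi> x) < 1" if "x \<in> ball 0 R" for x
  proof -
    have "norm (w x) < norm (2 * of_real A - w x)"
    proof (rule power2_less_imp_less)
      have "(2*A - Re (w x))^2 - (Re (w x))^2 = 4 * A * (A - Re (w x))"
        by (simp add: power2_eq_square algebra_simps)
      also have "\<dots> > 0" using A Rew[OF that] by simp
      finally show "(norm (w x))^2 < (norm (2 * of_real A - w x))^2"
        by (simp add: cmod_power2)
    qed auto
    then show ?thesis using nz2[OF that] by (simp add: \<phi>_def norm_divide)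
  qed
  \<comment> \<open>The disc of this radius about \<open>z0\<close> fits into
    \<open>ball 0 R\<close>; rescaled to the unit disc, it carries the Schwarz lemma for a function
    vanishing at \<open>z0\<close>.\<close>
  define \<rho> where "\<rho> = R - norm z0"
  have \<rho>: "\<rho> \<ge> 15 * R / 16" "\<rho> > 0" using z0 R by (auto simp: \<rho>_def)
  have sub: "z0 + of_real \<rho> * \<xi> \<in> ball 0 R" if "norm \<xi> < 1" for \<xi>
  proof -
    have "norm (z0 + of_real \<rho> * \<xi>) \<le> norm z0 + \<rho> * norm \<xi>"
      using norm_triangle_ineq[of z0 "of_real \<rho> * \<xi>"] \<rho> by (simp add: norm_mult)
    also have "\<dots> < norm z0 + \<rho>" using that \<rho> by simp
    finally show ?thesis by (simp add: \<rho>_def)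
  qed
  have sch: "norm (\<phi> (z0 + of_real \<rho> * \<xi>)) \<le> norm \<xi>" if "norm \<xi> < 1" for \<xi>
  proof (rule Schwarz_Lemma(1)[of "\<lambda>\<xi>. \<phi> (z0 + of_real \<rho> * \<xi>)"])
    have "\<phi> \<circ> (\<lambda>\<xi>. z0 + of_real \<rho> * \<xi>) holomorphic_on ball 0 1"
      by (rule holomorphic_on_compose_gen[OF _ \<phi>hol]) (use sub in \<open>auto intro!: holomorphic_intros\<close>)
    then show "(\<lambda>\<xi>. \<phi> (z0 + of_real \<rho> * \<xi>)) holomorphic_on ball 0 1" by (simp add: o_def)
  qed (use that sub \<phi>1 in \<open>auto simp: \<phi>_def w_def\<close>)
  \<comment> \<open>Here \<open>|x - z0| \<le> 3R/4 + R/16 = 13R/16\<close> and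
    \<open>\<rho> \<ge> 15R/16\<close>, so \<open>|\<phi>| \<le> 13/15\<close>. Solving for
    \<open>w = 2A \<phi> / (1 + \<phi>)\<close> gives
    \<open>2A (13/15) / (2/15) = 13A\<close>.\<close>
  have wb: "norm (w x) \<le> 13 * A" if x: "norm x \<le> 3 * R / 4" for x
  proof -
    have xR: "x \<in> ball 0 R" using x R by auto
    define \<xi> where "\<xi> = (x - z0) / of_real \<rho>"
    have "norm \<xi> = norm (x - z0) / \<rho>" using \<rho> by (simp add: \<xi>_def norm_divide)
    also have "norm (x - z0) \<le> 13 * R / 16" using norm_triangle_ineq4[of x z0] x z0 by linarith
    also have "13 * R / 16 / \<rho> \<le> 13 / 15" using \<rho> R by (simp add: field_simps)
    finally have t: "norm \<xi> \<le> 13 / 15" using \<rho> by (simp add: divide_right_mono)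
    have "z0 + of_real \<rho> * \<xi> = x" using \<rho> by (simp add: \<xi>_def)
    then have \<phi>t: "norm (\<phi> x) \<le> 13 / 15" using sch[of \<xi>] t by auto
    have "w x * (1 + \<phi> x) = 2 * of_real A * \<phi> x"
      using nz2[OF xR] by (simp add: \<phi>_def field_simps)
    then have "norm (w x) * norm (1 + \<phi> x) = 2 * A * norm (\<phi> x)"
      using A by (metis norm_mult norm_of_real norm_numeral abs_of_pos)
    moreover have "norm (1 + \<phi> x) \<ge> 2 / 15"
      using norm_triangle_ineq2[of 1 "- \<phi> x"] \<phi>t by simp
    then have "norm (w x) * (2 / 15) \<le> norm (w x) * norm (1 + \<phi> x)"
      by (intro mult_left_mono) auto
    moreover have "2 * A * norm (\<phi> x) \<le> 2 * A * (13 / 15)"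
      using \<phi>t A by (intro mult_left_mono) auto
    ultimately show ?thesis by simp
  qed
  have sub2: "cball z (R / 4) \<subseteq> ball 0 R"
  proof
    fix x assume "x \<in> cball z (R/4)"
    then have "norm x \<le> norm z + R / 4" using norm_triangle_ineq[of z "x - z"]
      by (simp add: dist_norm norm_minus_commute)
    then show "x \<in> ball 0 R" using z R by simp
  qed
  \<comment> \<open>Cauchy's estimate on a disc of radius \<open>R/4\<close>, which stays within
    \<open>|x| \<le> 3R/4\<close>: this is the origin of \<open>52 = 4 * 13\<close>.\<close>
  have "norm ((deriv ^^ 1) w z) \<le> fact 1 * (13 * A) / (R / 4) ^ 1"
  proof (rule Cauchy_inequality)
    show "w holomorphic_on ball z (R/4)" using whol sub2 ball_subset_cball holomorphic_on_subset by blast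
    show "continuous_on (cball z (R/4)) w"
      using whol sub2 holomorphic_on_imp_continuous_on continuous_on_subset by blast
    fix x assume "norm (z - x) = R / 4"
    then have "norm x \<le> norm z + R / 4" using norm_triangle_ineq[of z "x - z"]
      by (simp add: norm_minus_commute)
    then show "norm (w x) \<le> 13 * A" using z by (intro wb) simp
  qed (use R in auto)
  then have db: "norm (deriv w z) \<le> 52 * A / R" by simp
  have zR: "z \<in> ball 0 R" using z R by auto
  have "(L has_field_derivative deriv L z) (at z)"
    using L(1) zR holomorphic_derivI by blast
  then have "(w has_field_derivative deriv L z) (at z)" and
    "((\<lambda>x. exp (L x)) has_field_derivative exp (L z) * deriv L z) (at z)"
    unfolding w_def by (auto intro!: derivative_eq_intros)
  then have dw: "deriv w z = deriv L z" and dU: "deriv (\<lambda>x. exp (L x)) z = exp (L z) * deriv L z"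
    by (auto intro: DERIV_imp_deriv)
  have "deriv U z = deriv (\<lambda>x. exp (L x)) z"
    by (rule deriv_cong_ev) (use L(2) zR in \<open>auto intro!: eventually_nhds_in_open[THEN eventually_mono, of "ball 0 R"]\<close>)
  then have "deriv U z / U z = deriv w z" using dU dw L(2)[OF zR] nz[OF zR] by (metis nonzero_mult_div_cancel_left)
  then show ?thesis using db by (simp add: A_def)
qed

section \<open>The Nevanlinna characteristic and slow growth\<close>

lemma pole_mult_eq:
  assumes "nontriv_mero f"
  shows "pole_mult f z = nat (- zorder f z)"
  using nontriv_zorder_neg_iff[OF assms, of z] by (auto simp: pole_mult_def)

lemma finite_poles_cball:
  assumes "nontriv_mero f"
  shows "finite {z \<in> cball 0 R. is_pole f z}"
  by (rule finite_subset[OF _ finite_zorder_cball[OF assms, of R]])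
     (use nontriv_zorder_neg_iff[OF assms] in force)

text \<open>The pole count is a step function, and each nonzero pole \<open>b\<close> contributes
  the integral of \<open>1/t\<close> over \<open>[|b|, R]\<close>.\<close>

lemma counting_eq:
  assumes f: "nontriv_mero f" and R: "R > 0"
  shows "counting f R = (\<Sum>b | b \<in> cball 0 R - {0} \<and> is_pole f b. real (pole_mult f b) * ln (R / norm b))
     + pole_count f 0 * ln R"
proof -
  define B where "B = {b \<in> cball 0 R - {0}. is_pole f b}"
  have finB: "finite B" by (rule finite_subset[OF _ finite_poles_cball[OF f, of R]]) (auto simp: B_def)
  \<comment> \<open>At \<open>t = 0\<close> both sides vanish: the left one by the convention for
    division by 0, the right one because every \<open>b\<close> in \<open>B\<close> is
    nonzero.\<close>
  have pc: "(pole_count f t - pole_count f 0) / t = (\<Sum>b\<in>B. real (pole_mult f b) * (if t \<in> {norm b..R} then 1 / t else 0))"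
    if t: "t \<in> {0..R}" for t
  proof -
    have "pole_count f t = (\<Sum>b\<in>{b\<in>B. norm b \<le> t} \<union> {z \<in> cball 0 0. is_pole f z}. real (pole_mult f b))"
      unfolding pole_count_def of_nat_sum using t by (intro sum.cong) (auto simp: B_def)
    also have "\<dots> = (\<Sum>b\<in>{b\<in>B. norm b \<le> t}. real (pole_mult f b)) + pole_count f 0"
      unfolding pole_count_def of_nat_sum
    proof (rule sum.union_disjoint)
      show "finite {b \<in> B. norm b \<le> t}" using finB by simp
    qed (auto simp: B_def)
    also have "(\<Sum>b\<in>{b\<in>B. norm b \<le> t}. real (pole_mult f b)) = (\<Sum>b\<in>B. if norm b \<le> t then real (pole_mult f b) else 0)"
      using finB by (simp add: sum.If_cases Int_def)
    finally have "(pole_count f t - pole_count f 0) / t = (\<Sum>b\<in>B. if norm b \<le> t then real (pole_mult f b) else 0) / t"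
      by simp
    also have "\<dots> = (\<Sum>b\<in>B. real (pole_mult f b) * (if t \<in> {norm b..R} then 1 / t else 0))"
      unfolding sum_divide_distrib using t by (intro sum.cong) auto
    finally show ?thesis .
  qed
  have "((\<lambda>t. real (pole_mult f b) * (if t \<in> {norm b..R} then 1 / t else 0)) has_integral
      real (pole_mult f b) * ln (R / norm b)) {0..R}" if "b \<in> B" for b
  proof (rule has_integral_mult_right)
    have b: "0 < norm b" "norm b \<le> R" using that by (auto simp: B_def)
    have "((\<lambda>t. 1 / t) has_integral (ln R - ln (norm b))) {norm b..R}"
    proof (rule fundamental_theorem_of_calculus)
      fix x assume "x \<in> {norm b..R}"
      then have "x > 0" using b(1) by (metis atLeastAtMost_iff order_less_le_trans)
      then have "(ln has_real_derivative 1 / x) (at x within {norm b..R})"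
        by (auto intro!: derivative_eq_intros)
      then show "(ln has_vector_derivative 1 / x) (at x within {norm b..R})"
        by (simp add: has_real_derivative_iff_has_vector_derivative)
    qed (use b in auto)
    then have "((\<lambda>t. if t \<in> {norm b..R} then 1 / t else 0) has_integral (ln R - ln (norm b))) {0..R}"
      by (subst has_integral_restrict) (use b in auto)
    then show "((\<lambda>t. if t \<in> {norm b..R} then 1 / t else 0) has_integral (ln (R / norm b))) {0..R}"
      using b R by (simp add: ln_div)
  qed
  then have "((\<lambda>t. (\<Sum>b\<in>B. real (pole_mult f b) * (if t \<in> {norm b..R} then 1 / t else 0))) has_integral
      (\<Sum>b\<in>B. real (pole_mult f b) * ln (R / norm b))) {0..R}"
    by (intro has_integral_sum finB)
  then have "((\<lambda>t. (pole_count f t - pole_count f 0) / t) has_integral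
      (\<Sum>b\<in>B. real (pole_mult f b) * ln (R / norm b))) {0..R}"
    by (rule has_integral_eq[rotated]) (simp add: pc)
  then show ?thesis by (simp add: counting_def integral_unique B_def)
qed

lemma pole_count_nonneg: "pole_count f r \<ge> 0"
  unfolding pole_count_def by (rule of_nat_0_le_iff)

lemma counting_nonneg:
  assumes "nontriv_mero f" "R \<ge> 1"
  shows "counting f R \<ge> 0"
proof -
  have "(\<Sum>b | b \<in> cball 0 R - {0} \<and> is_pole f b. real (pole_mult f b) * ln (R / norm b)) \<ge> 0"
    by (intro sum_nonneg mult_nonneg_nonneg) auto
  then show ?thesis using counting_eq[OF assms(1), of R] assms pole_count_nonneg[of f 0] by simp
qed

text \<open>A pole with \<open>|b| \<le> R\<close> has weight
  \<open>ln (R^2 / |b|) \<ge> ln R\<close> in the counting function at \<open>R^2\<close>. A bound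
  of order \<open>(ln R)^2\<close> thus leaves \<open>O(ln R)\<close> poles.\<close>

lemma pole_count_le_counting:
  assumes f: "nontriv_mero f" and R: "R \<ge> 1"
  shows "pole_count f R * ln R \<le> counting f (R^2)"
proof -
  let ?B = "\<lambda>R. {b \<in> cball 0 R - {0}. is_pole f b}"
  have R2: "R \<le> R^2" using R by (simp add: self_le_power)
  have fin: "finite (?B r)" for r
    by (rule finite_subset[OF _ finite_poles_cball[OF f, of r]]) auto
  have lnR: "ln R \<ge> 0" using R by simp
  have "pole_count f R = (\<Sum>b\<in>?B R \<union> {z \<in> cball 0 0. is_pole f z}. real (pole_mult f b))"
    unfolding pole_count_def of_nat_sum using R by (intro sum.cong) auto
  also have "\<dots> = (\<Sum>b\<in>?B R. real (pole_mult f b)) + pole_count f 0"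
    unfolding pole_count_def of_nat_sum by (rule sum.union_disjoint[OF fin]) auto
  finally have "pole_count f R * ln R = (\<Sum>b\<in>?B R. real (pole_mult f b) * ln R) + pole_count f 0 * ln R"
    by (simp add: algebra_simps sum_distrib_left)
  also have "(\<Sum>b\<in>?B R. real (pole_mult f b) * ln R) \<le> (\<Sum>b\<in>?B R. real (pole_mult f b) * ln (R^2 / norm b))"
  proof (intro sum_mono mult_left_mono)
    fix b assume "b \<in> ?B R"
    then have b: "0 < norm b" "norm b \<le> R" by auto
    then have "R \<le> R^2 / norm b" using R by (simp add: power2_eq_square field_simps)
    then show "ln R \<le> ln (R^2 / norm b)" using R by simp
  qed auto
  also have "\<dots> \<le> (\<Sum>b\<in>?B (R^2). real (pole_mult f b) * ln (R^2 / norm b))"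
    by (rule sum_mono2[OF fin]) (use R2 in auto)
  also have "pole_count f 0 * ln R \<le> pole_count f 0 * ln (R^2)"
    using R lnR pole_count_nonneg[of f 0] by (intro mult_left_mono) (simp_all add: ln_realpow)
  finally show ?thesis using counting_eq[OF f, of "R^2"] R by simp
qed

lemma proximity_nonneg: "proximity f r \<ge> 0"
proof -
  let ?h = "\<lambda>\<theta>. lnplus (norm (f (of_real r * exp (\<i> * of_real \<theta>))))"
  have "integral {0..2*pi} ?h \<ge> 0"
  \<comment> \<open>For arbitrary \<open>f\<close> the integrand may fail to be integrable; the
    integral is then 0 by convention.\<close>
  proof (cases "?h integrable_on {0..2*pi}")
    case True
    then show ?thesis by (intro integral_nonneg) (auto simp: lnplus_nonneg)
  qed (simp add: not_integrable_integral)
  then show ?thesis by (simp add: proximity_def)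
qed

text \<open>The parametrization is injective on \<open>[0, 2 pi)\<close>, and the closed interval
  adds one point. Finitely many exceptional values on a circle are therefore negligible in the
  proximity integral.\<close>

lemma finite_circle_preimage:
  assumes "finite X" "r > 0"
  shows "finite {\<theta> \<in> {0..2*pi}. of_real r * exp (\<i> * of_real \<theta>) \<in> X}"
proof -
  let ?e = "\<lambda>\<theta>::real. of_real r * exp (\<i> * of_real \<theta>)"
  have "inj_on ?e {0..<2*pi}"
  proof (rule inj_onI)
    fix x y assume xy: "x \<in> {0..<2*pi}" "y \<in> {0..<2*pi}" "?e x = ?e y"
    then have "cis x = cis y" using assms(2) by (simp add: cis_conv_exp)
    then have "sin x = sin y" "cos x = cos y" by (auto simp: complex_eq_iff)
    then obtain n :: int where "x = y + 2 * pi * n" using sin_cos_eq_iff[of x y] by (auto simp: algebra_simps)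
    then have n: "x - y = 2 * pi * of_int n" by simp
    have "\<bar>x - y\<bar> < 2 * pi" using xy by auto
    then have "\<bar>of_int n :: real\<bar> < 1" unfolding n by (simp add: abs_mult)
    then have "n = 0" by linarith
    then show "x = y" using n by simp
  qed
  then have "finite (?e -` X \<inter> {0..<2*pi})" using finite_vimage_IntI assms(1) by blast
  then have "finite (insert (2*pi) (?e -` X \<inter> {0..<2*pi}))" by simp
  then show ?thesis by (rule finite_subset[rotated]) auto
qed

text \<open>Poles and orders depend only on punctured neighbourhoods, and on a circle the values
  change at finitely many points only. This permits passing to a nicely meromorphic
  function.\<close>

lemma nevanlinna_T_remove_sings:
  assumes f: "nontriv_mero f" and r: "r > 0"
  shows "nevanlinna_T (remove_sings f) r = nevanlinna_T f r"
proof -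
  have iso: "isolated_singularity_at f z" for z by (rule nontriv_mero_isolated[OF f])
  have rf: "nontriv_mero (remove_sings f)" by (rule nontriv_mero_remove_sings[OF f])
  have zo: "zorder (remove_sings f) z = zorder f z" for z using iso by simp
  have ip: "is_pole (remove_sings f) z = is_pole f z" for z
    using nontriv_zorder_neg_iff[OF f] nontriv_zorder_neg_iff[OF rf] zo by metis
  have "pole_count (remove_sings f) t = pole_count f t" for t
    by (simp add: pole_count_def pole_mult_def ip zo)
  then have cnt: "counting (remove_sings f) r = counting f r" by (simp add: counting_def)
  have "\<forall>\<^sub>\<approx>z\<in>UNIV. remove_sings f z = f z"
    by (rule eventually_remove_sings_eq[OF nontriv_mero_meromorphic[OF f]])
  then have "{z. remove_sings f z \<noteq> f z} sparse_in UNIV" by (simp add: eventually_cosparse)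
  then have "finite ({z. remove_sings f z \<noteq> f z} \<inter> cball 0 r)"
    using sparse_in_compact_finite[of "{z. remove_sings f z \<noteq> f z}" "cball 0 r"] sparse_in_subset[of _ UNIV]
    by (metis Int_commute compact_cball subset_UNIV)
  from finite_circle_preimage[OF this r]
  have fin: "finite {\<theta> \<in> {0..2*pi}. of_real r * exp (\<i> * of_real \<theta>) \<in> {z. remove_sings f z \<noteq> f z} \<inter> cball 0 r}" .
  have "integral {0..2*pi} (\<lambda>\<theta>. lnplus (norm (remove_sings f (of_real r * exp (\<i> * of_real \<theta>))))) =
     integral {0..2*pi} (\<lambda>\<theta>. lnplus (norm (f (of_real r * exp (\<i> * of_real \<theta>)))))"
    by (rule integral_spike[OF negligible_finite[OF fin]]) (use r in \<open>auto simp: norm_mult\<close>)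
  then have "proximity (remove_sings f) r = proximity f r" by (simp add: proximity_def)
  with cnt show ?thesis by (simp add: nevanlinna_T_def)
qed

text \<open>A pole of \<open>f\<close> in \<open>ball 0 R\<close> must occur in \<open>B\<close>, since \<open>V\<close> is holomorphic there.\<close>
definition slow_growth_at :: "(complex \<Rightarrow> complex) \<Rightarrow> real \<Rightarrow> real \<Rightarrow> bool" where
  "slow_growth_at f C R \<longleftrightarrow> (\<exists>B m V. finite B \<and> (\<forall>b\<in>B. is_pole f b \<and> norm b \<le> C * R) \<and>
     (\<Sum>b\<in>B. real (m b)) \<le> C * ln R \<and> V holomorphic_on ball 0 R \<and>
     (\<forall>z\<in>ball 0 R. norm (V z) \<le> exp (C * (ln R)^2)) \<and>
     (\<forall>z\<in>ball 0 R. f analytic_on {z} \<longrightarrow> V z = f z * (\<Prod>b\<in>B. (z - b) ^ m b)))"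

text \<open>The factorization may change with \<open>R\<close>; only the constant is
  uniform.\<close>

definition slow_growth :: "(complex \<Rightarrow> complex) \<Rightarrow> bool" where
  "slow_growth f \<longleftrightarrow> (\<exists>C R0. C \<ge> 0 \<and> (\<forall>R\<ge>R0. slow_growth_at f C R))"

lemma norm_prod_linear_le:
  fixes z :: complex
  assumes "\<And>b. b \<in> B \<Longrightarrow> norm (z - b) \<le> D" "D \<ge> 1"
  shows "norm (\<Prod>b\<in>B. (z - b) ^ m b) \<le> exp ((\<Sum>b\<in>B. real (m b)) * ln D)"
proof -
  have "norm (\<Prod>b\<in>B. (z - b) ^ m b) = (\<Prod>b\<in>B. norm (z - b) ^ m b)"
    by (simp add: prod_norm[symmetric] norm_power)
  also have "\<dots> \<le> (\<Prod>b\<in>B. D ^ m b)"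
    using assms by (intro prod_mono conjI power_mono) auto
  also have "\<dots> = (\<Prod>b\<in>B. exp (real (m b) * ln D))"
    using assms(2) by (intro prod.cong refl) (simp add: exp_of_nat_mult)
  also have "\<dots> = exp ((\<Sum>b\<in>B. real (m b)) * ln D)"
    by (cases "finite B") (simp_all add: exp_sum sum_distrib_right)
  finally show ?thesis .
qed

text \<open>\<open>P\<close> clears the poles in a disc of radius \<open>S\<close> between
  \<open>2R\<close> and \<open>4R\<close>. The Poisson-Jensen inequality on \<open>|z| = S\<close>
  bounds \<open>ln |f P|\<close> by the proximity of \<open>f\<close> plus
  \<open>deg P * ln (2S)\<close>, and both are \<open>O((ln R)^2)\<close>.\<close>

lemma slow_growth_if_nevanlinna:
  assumes f: "nontriv_mero f" and nice: "f nicely_meromorphic_on UNIV"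
    and T: "(\<lambda>r. nevanlinna_T f r) \<in> O[at_top](\<lambda>r. (ln r) ^ 2)"
  shows "slow_growth f"
proof -
  from landau_o.bigE[OF T] obtain c where c: "c > 0"
    "\<forall>\<^sub>F r in at_top. norm (nevanlinna_T f r) \<le> c * norm ((ln r)^2)" by auto
  from c(2) obtain r0 where r0: "\<And>r. r \<ge> r0 \<Longrightarrow> nevanlinna_T f r \<le> c * (ln r)^2"
    unfolding eventually_at_top_linorder by (auto simp: abs_le_iff)
  \<comment> \<open>\<open>60 c = 3 (4 + 16) c\<close> arises in the bound for \<open>V\<close>; the
    summand 4 covers \<open>|b| \<le> S \<le> 4R\<close>.\<close>
  define C where "C = 60 * c + 4"
  have main: "slow_growth_at f C R"
    if R: "R \<ge> max 8 r0" for R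
  proof -
    have R8: "R \<ge> 8" "R \<ge> r0" using R by auto
    define L where "L = ln R"
    have L: "L > 0" using R8 by (simp add: L_def)
    \<comment> \<open>An interval contains a radius different from the finitely many moduli of zeros
      and poles.\<close>
    have "finite (norm ` divisor_in f (4*R))"
      using finite_zorder_cball[OF f] by blast
    moreover have "infinite {2*R..4*R}" using R8 by (simp add: infinite_Icc)
    ultimately have "\<not> {2*R..4*R} \<subseteq> norm ` divisor_in f (4*R)"
      using finite_subset by blast
    then obtain S where S: "S \<in> {2*R..4*R}" "S \<notin> norm ` divisor_in f (4*R)"
      by blast
    have S1: "S \<ge> 2 * R" "S \<le> 4 * R" "S \<ge> 16" "S \<ge> r0" "S > 0" using S R8 by auto
    have Szo: "zorder f z = 0" if "norm z = S" for z
      using S that by (auto simp: image_iff)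
    have lnS: "ln S \<le> 2 * L" "ln S > 0" "ln (2 * S) \<le> 2 * L"
    proof -
      have "8 * R \<le> R * R" using R8 by (intro mult_right_mono) auto
      then have "2 * S \<le> R^2" using S1 unfolding power2_eq_square by linarith
      then have "ln (2 * S) \<le> ln (R^2)" using S1 by simp
      also have "\<dots> = 2 * L" using R8 by (simp add: L_def ln_realpow)
      finally show "ln (2 * S) \<le> 2 * L" .
      moreover have "ln S \<le> ln (2 * S)" using S1 by simp
      ultimately show "ln S \<le> 2 * L" by linarith
      show "ln S > 0" using S1 by simp
    qed
    have S2: "S \<le> S^2" using S1 by (simp add: self_le_power)
    have prox: "proximity f S \<le> 4 * c * L^2"
    proof -
      have "proximity f S \<le> nevanlinna_T f S"
        using counting_nonneg[OF f, of S] S1 by (simp add: nevanlinna_T_def)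
      also have "\<dots> \<le> c * (ln S)^2" using r0 S1 by simp
      also have "\<dots> \<le> c * (2*L)^2" using lnS c by (intro mult_left_mono power_mono) auto
      finally show ?thesis by (simp add: power_mult_distrib)
    qed
    have pc: "pole_count f S \<le> 8 * c * L"
    proof -
      have "pole_count f S * ln S \<le> counting f (S^2)" using pole_count_le_counting[OF f] S1 by simp
      also have "\<dots> \<le> nevanlinna_T f (S^2)" using proximity_nonneg by (simp add: nevanlinna_T_def)
      also have "\<dots> \<le> c * (ln (S^2))^2" using r0 S1 S2 by simp
      also have "ln (S^2) = 2 * ln S" using S1 by (simp add: ln_realpow)
      also have "c * (2 * ln S)^2 = (4 * c * ln S) * ln S" by (simp add: power2_eq_square)
      finally have "pole_count f S \<le> 4 * c * ln S" using lnS by simp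
      also have "\<dots> \<le> 4 * c * (2 * L)" using lnS c by (intro mult_left_mono) auto
      finally show ?thesis by simp
    qed
    define B where "B = {z \<in> cball 0 S. is_pole f z}"
    have finB: "finite B" unfolding B_def by (rule finite_poles_cball[OF f])
    define m where "m = pole_mult f"
    have summ: "(\<Sum>b\<in>B. real (m b)) = pole_count f S" by (simp add: m_def B_def pole_count_def)
    define P where "P = (\<lambda>z. \<Prod>b\<in>B. (z - b) ^ m b)"
    have P: "nontriv_mero P" unfolding P_def by (rule nontriv_mero_prod_linear)
    have Pan: "P analytic_on A" for A unfolding P_def by (intro analytic_intros)
    have zoP: "zorder P z = (if z \<in> B then int (m z) else 0)" for z
      unfolding P_def using zorder_prod_linear_powi[OF finB, of "\<lambda>b. int (m b)" z] by simp
    define q where "q = (\<lambda>z. f z * P z)"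
    have q: "nontriv_mero q" unfolding q_def by (rule nontriv_mero_mult[OF f P])
    define V where "V = remove_sings q"
    have V: "nontriv_mero V" unfolding V_def by (rule nontriv_mero_remove_sings[OF q])
    have zoq: "zorder q z \<ge> 0" if "norm z \<le> S" for z
      unfolding q_def nontriv_zorder_mult[OF f P] zoP
      using that nontriv_zorder_neg_iff[OF f, of z] by (auto simp: m_def pole_mult_eq[OF f] B_def)
    have Van1: "V analytic_on {z}" if "norm z \<le> S" for z
      unfolding V_def by (rule zorder_nonneg_analytic_remove_sings[OF q zoq[OF that]])
    have Van: "V analytic_on cball 0 S" by (subst analytic_on_analytic_at) (use Van1 in auto)
    have Veq: "V z = f z * P z" if "f analytic_on {z}" for z
    proof -
      have "q analytic_on {z}" unfolding q_def by (intro analytic_intros that Pan)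
      then show ?thesis by (simp add: V_def q_def)
    qed
    have fan: "f analytic_on {z}" "f z \<noteq> 0" if "norm z = S" for z
    proof -
      have "\<not> is_pole f z" using nontriv_zorder_neg_iff[OF f, of z] Szo[OF that] by auto
      then show "f analytic_on {z}" using nicely_meromorphic_on_imp_analytic_at[OF nice] by auto
      from zorder_eq_0_iff[OF this nontriv_mero_freq[OF f]] show "f z \<noteq> 0" using Szo[OF that] by simp
    qed
    have Pnz: "P z \<noteq> 0" if "norm z = S" for z
    proof -
      have "z \<notin> B" using fan[OF that] by (auto simp: B_def analytic_at_imp_no_pole)
      then show ?thesis using finB by (auto simp: P_def)
    qed
    have Pb: "norm (P z) \<le> exp (pole_count f S * ln (2 * S))" if "norm z \<le> S" for z
      unfolding P_def summ[symmetric]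
    proof (rule norm_prod_linear_le)
      fix b assume "b \<in> B"
      then show "norm (z - b) \<le> 2 * S" using that norm_triangle_ineq4[of z b] by (simp add: B_def)
    qed (use S1 in simp)
    define I where "I = lnplus_circle f S"
    have I: "I = 2 * pi * proximity f S" by (simp add: I_def proximity_def cis_conv_exp)
    have fan2: "f analytic_on sphere 0 S" by (subst analytic_on_analytic_at) (use fan in auto)
    have intV: "lnplus_circle V S \<le> I + 2 * pi * (pole_count f S * ln (2 * S))"
    proof (rule has_integral_le)
      show "((\<lambda>t. lnplus (norm (V (of_real S * cis t)))) has_integral
         lnplus_circle V S) {0..2*pi}"
        by (intro integrable_integral integrable_continuous_interval continuous_on_lnplus_norm
          continuous_on_compose2[OF holomorphic_on_imp_continuous_on[OF analytic_imp_holomorphic[OF Van]]])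
          (use S1 in \<open>auto intro!: continuous_intros simp: norm_mult\<close>)
      have "((\<lambda>t. lnplus (norm (f (of_real S * cis t)))) has_integral I) {0..2*pi}"
        unfolding I_def by (intro integrable_integral integrable_continuous_interval continuous_on_lnplus_norm
          continuous_on_compose2[OF holomorphic_on_imp_continuous_on[OF analytic_imp_holomorphic[OF fan2]]])
          (use S1 in \<open>auto intro!: continuous_intros simp: norm_mult\<close>)
      from has_integral_add[OF this has_integral_const_real[of "pole_count f S * ln (2 * S)" 0 "2*pi"]]
      show "((\<lambda>t. lnplus (norm (f (of_real S * cis t))) + pole_count f S * ln (2 * S)) has_integral
        I + 2 * pi * (pole_count f S * ln (2 * S))) {0..2*pi}" by simp
      fix t
      define w where "w = of_real S * cis t"
      have nw: "norm w = S" using S1 by (simp add: w_def norm_mult)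
      have "pole_count f S * ln (2*S) \<ge> 0" using S1 pole_count_nonneg by (intro mult_nonneg_nonneg) auto
      then have "lnplus (norm (P w)) \<le> pole_count f S * ln (2*S)"
        using order_trans[OF lnplus_mono[OF Pb[of w]]] nw by (simp add: lnplus_def)
      moreover have "lnplus (norm (V w)) \<le> lnplus (norm (f w)) + lnplus (norm (P w))"
        using Veq[of w] fan[OF nw] lnplus_mult_le[of "norm (f w)" "norm (P w)"] by (simp add: norm_mult)
      ultimately show "lnplus (norm (V (of_real S * cis t))) \<le> lnplus (norm (f (of_real S * cis t))) + pole_count f S * ln (2 * S)"
        unfolding w_def by simp
    qed
    have Vb: "norm (V z) \<le> exp (C * L^2)" if z: "norm z < R" for z
    proof (cases "V z = 0")
      case False
      have "ln (norm (V z)) \<le> 3 / (2*pi) * lnplus_circle V S"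
        by (rule poisson_jensen_ineq[OF V Van S1(5)])
           (use z S1 False Veq fan Pnz in auto)
      also have "\<dots> \<le> 3 / (2*pi) * (I + 2 * pi * (pole_count f S * ln (2 * S)))"
        by (intro mult_left_mono intV) auto
      also have "\<dots> = 3 * (proximity f S + pole_count f S * ln (2*S))"
        unfolding I by (simp add: field_simps)
      also have "\<dots> \<le> 3 * (4 * c * L^2 + (8 * c * L) * (2 * L))"
        using prox pc lnS S1 c L pole_count_nonneg[of f S] by (intro mult_left_mono add_mono mult_mono) auto
      also have "\<dots> = 60 * c * L^2" by (simp add: power2_eq_square)
      also have "\<dots> \<le> C * L^2" by (intro mult_right_mono) (auto simp: C_def)
      finally show ?thesis using False by (metis exp_le_cancel_iff exp_ln zero_less_norm_iff)
    qed simp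
    show ?thesis unfolding slow_growth_at_def
    proof (intro exI conjI ballI impI)
      show "finite B" by (rule finB)
      show "(\<Sum>b\<in>B. real (m b)) \<le> C * ln R"
      proof -
        have "8 * c * L \<le> C * L" using c L by (intro mult_right_mono) (auto simp: C_def)
        then show ?thesis using pc summ by (simp add: L_def)
      qed
      show "V holomorphic_on ball 0 R"
        using analytic_imp_holomorphic[OF Van] by (rule holomorphic_on_subset) (use S1 R8 in auto)
      fix z :: complex assume "z \<in> ball 0 R"
      then show "norm (V z) \<le> exp (C * (ln R)^2)" using Vb[of z] by (simp add: L_def)
      assume "f analytic_on {z}"
      then show "V z = f z * (\<Prod>b\<in>B. (z - b) ^ m b)" using Veq[of z] by (simp add: P_def)
    next
      fix b assume b: "b \<in> B"
      then show "is_pole f b" by (simp add: B_def)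
      have "norm b \<le> 4 * R" using b S1 by (simp add: B_def)
      also have "\<dots> \<le> C * R" using c R8 by (intro mult_right_mono) (auto simp: C_def)
      finally show "norm b \<le> C * R" .
    qed
  qed
  then show ?thesis unfolding slow_growth_def
    by (intro exI[of _ C] exI[of _ "max 8 r0"] conjI allI impI main)
       (use c in \<open>simp_all add: C_def\<close>)
qed

text \<open>Cauchy's estimate on a disc of radius 1, which fits because \<open>R \<ge> 1\<close>;
  with this radius the bound is inherited without loss.\<close>

lemma deriv_bound_unit:
  assumes "h holomorphic_on ball 0 (2 * R)" "R \<ge> 1" "norm z < R"
    and "\<And>w. w \<in> ball 0 (2 * R) \<Longrightarrow> norm (h w) \<le> K"
  shows "norm (deriv h z) \<le> K"
proof -
  have sub: "cball z (1::real) \<subseteq> ball 0 (2 * R)"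
  proof
    fix x assume "x \<in> cball z 1"
    then have "norm x \<le> norm z + 1" using norm_triangle_ineq[of z "x - z"]
      by (simp add: dist_norm norm_minus_commute)
    then show "x \<in> ball 0 (2 * R)" using assms by simp
  qed
  have "norm ((deriv ^^ 1) h z) \<le> fact 1 * K / 1 ^ 1"
  proof (rule Cauchy_inequality)
    show "h holomorphic_on ball z 1" using assms(1) sub ball_subset_cball holomorphic_on_subset by blast
    show "continuous_on (cball z 1) h"
      using assms(1) sub holomorphic_on_imp_continuous_on continuous_on_subset by blast
    fix x assume "norm (z - x) = 1"
    then have "x \<in> cball z 1" by (simp add: dist_norm)
    then show "norm (h x) \<le> K" using sub assms(4) by blast
  qed auto
  then show ?thesis by simp
qed

text \<open>If \<open>V = f P\<close> then \<open>f' P\<^sup>2 = V' P - V P'\<close>.\<close>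
lemma slow_growth_deriv:
  assumes f: "nontriv_mero f" and nice: "f nicely_meromorphic_on UNIV" and "slow_growth f"
  shows "slow_growth (deriv f)"
proof -
  from assms(3) obtain C R0 where C: "C \<ge> 0" and ex: "\<And>R. R \<ge> R0 \<Longrightarrow> slow_growth_at f C R"
    unfolding slow_growth_def by blast
  \<comment> \<open>Large enough for the three demands below: \<open>8C + 1\<close> for the size of
    \<open>W\<close>, \<open>4C\<close> for the doubled multiplicities, \<open>2C\<close> for the
    location of the poles.\<close>
  define D where "D = 12 * C + 1"
  have main: "slow_growth_at (deriv f) D R"
    \<comment> \<open>The threshold \<open>2 + 2C\<close> gives
      \<open>|z - b| \<le> (2 + 2C) R \<le> R^2\<close>, so each factor of \<open>P\<close> costs at
      most \<open>2 ln R\<close> in the exponent.\<close>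
    if R: "R \<ge> max (max R0 3) (2 + 2 * C)" for R
  proof -
    have R3: "R \<ge> 3" "R \<ge> 2 + 2 * C" "2 * R \<ge> R0" using R by auto
    define L where "L = ln R"
    have "exp 1 \<le> R" using exp_le R3 by linarith
    then have L: "L \<ge> 1" using R3 by (metis L_def exp_gt_zero ln_exp ln_le_cancel_iff order_less_le_trans)
    have "ln (2 * R) \<le> ln (R^2)" using R3 by (simp add: power2_eq_square)
    then have l2: "ln (2 * R) \<le> 2 * L" "ln (2*R) \<ge> 0" using R3 by (simp_all add: ln_realpow L_def)
    obtain B m V where B: "finite B" "\<And>b. b \<in> B \<Longrightarrow> is_pole f b" "\<And>b. b \<in> B \<Longrightarrow> norm b \<le> C * (2 * R)"
      and m: "(\<Sum>b\<in>B. real (m b)) \<le> C * ln (2 * R)" and V: "V holomorphic_on ball 0 (2 * R)"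
      "\<And>z. z \<in> ball 0 (2*R) \<Longrightarrow> norm (V z) \<le> exp (C * (ln (2 * R))^2)"
      "\<And>z. z \<in> ball 0 (2*R) \<Longrightarrow> f analytic_on {z} \<Longrightarrow> V z = f z * (\<Prod>b\<in>B. (z - b) ^ m b)"
      using ex[of "2 * R"] R3 unfolding slow_growth_at_def by auto
    define n where "n = (\<Sum>b\<in>B. real (m b))"
    have n: "n \<le> 2 * C * L" "n \<ge> 0"
    proof -
      have "n \<le> C * (2 * L)" using m l2 C mult_left_mono[of "ln (2*R)" "2*L" C] by (simp add: n_def)
      then show "n \<le> 2 * C * L" by simp
    qed (auto simp: n_def intro: sum_nonneg)
    define P where "P = (\<lambda>z. \<Prod>b\<in>B. (z - b) ^ m b)"
    have Phol: "P holomorphic_on A" for A unfolding P_def by (intro holomorphic_intros)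
    have Pb: "norm (P z) \<le> exp (4 * C * L^2)" if z: "z \<in> ball 0 (2 * R)" for z
    proof -
      have "norm (P z) \<le> exp (n * ln (R^2))" unfolding P_def n_def
      proof (rule norm_prod_linear_le)
        fix b assume "b \<in> B"
        then have "norm (z - b) \<le> 2 * R + C * (2 * R)"
          using B(3)[of b] z norm_triangle_ineq4[of z b] by simp
        also have "\<dots> = (2 + 2 * C) * R" by (simp add: algebra_simps)
        also have "\<dots> \<le> R * R" using R3 by (intro mult_right_mono) auto
        finally show "norm (z - b) \<le> R^2" by (simp add: power2_eq_square)
      next
        show "1 \<le> R^2" using R3 by simp
      qed
      also have "n * ln (R^2) = n * (2 * L)" using R3 by (simp add: ln_realpow L_def)
      also have "\<dots> \<le> (2 * C * L) * (2 * L)" using n L by (intro mult_right_mono) auto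
      finally show ?thesis by (simp add: power2_eq_square mult_ac)
    qed
    have Vb: "norm (V z) \<le> exp (4 * C * L^2)" if z: "z \<in> ball 0 (2 * R)" for z
    proof -
      have "(ln (2*R))^2 \<le> (2 * L)^2" using l2 by (intro power_mono) auto
      then have "C * (ln (2*R))^2 \<le> 4 * C * L^2" using mult_left_mono[OF _ C] by (fastforce simp: power_mult_distrib)
      then show ?thesis using V(2)[OF z] by (meson exp_le_cancel_iff order_trans)
    qed
    define W where "W = (\<lambda>z. deriv V z * P z - V z * deriv P z)"
    have Whol: "W holomorphic_on ball 0 R" unfolding W_def
      by (intro holomorphic_intros Phol holomorphic_on_subset[OF V(1)]) (use R3 in auto)
    have Wb: "norm (W z) \<le> exp (D * L^2)" if z: "z \<in> ball 0 R" for z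
    proof -
      let ?E = "exp (4 * C * L^2)"
      have z2: "z \<in> ball 0 (2 * R)" using z R3 by auto
      have dV: "norm (deriv V z) \<le> ?E" by (rule deriv_bound_unit[OF V(1)]) (use R3 z Vb in auto)
      have dP: "norm (deriv P z) \<le> ?E" by (rule deriv_bound_unit[OF Phol]) (use R3 z Pb in auto)
      have "norm (W z) \<le> norm (deriv V z) * norm (P z) + norm (V z) * norm (deriv P z)"
        unfolding W_def using norm_triangle_ineq4[of "deriv V z * P z" "V z * deriv P z"] by (simp add: norm_mult)
      also have "\<dots> \<le> ?E * ?E + ?E * ?E"
        by (intro add_mono mult_mono dV dP Pb[OF z2] Vb[OF z2]) auto
      also have "\<dots> = 2 * exp (8 * C * L^2)" by (simp flip: exp_add)
      also have "\<dots> \<le> exp (L^2) * exp (8 * C * L^2)"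
      proof (intro mult_right_mono)
        have "1 \<le> L^2" using L by simp
        then have "1 + 1 \<le> exp (L^2)" using exp_ge_add_one_self[of "L^2"] by linarith
        then show "2 \<le> exp (L^2)" by simp
      qed auto
      also have "\<dots> = exp ((8 * C + 1) * L^2)" by (simp add: algebra_simps flip: exp_add)
      also have "\<dots> \<le> exp (D * L^2)" using C by (simp add: D_def mult_right_mono)
      finally show ?thesis .
    qed
    have ana: "f analytic_on {z}" if "deriv f analytic_on {z}" for z
    proof -
      have "\<not> is_pole (deriv f) z" using that by (rule analytic_at_imp_no_pole)
      then have "\<not> is_pole f z" using is_pole_deriv_iff[OF nontriv_mero_meromorphic[OF f]] by blast
      then show ?thesis using nicely_meromorphic_on_imp_analytic_at[OF nice] by auto
    qed
    have Weq: "W z = deriv f z * (\<Prod>b\<in>B. (z - b) ^ (2 * m b))" if z: "z \<in> ball 0 R" "deriv f analytic_on {z}" for z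
    proof -
      have fz: "f analytic_on {z}" by (rule ana[OF z(2)])
      then obtain e where e: "e > 0" "f holomorphic_on ball z e"
        unfolding analytic_on_def by auto
      have z2: "z \<in> ball 0 (2 * R)" using z R3 by auto
      let ?A = "ball z e \<inter> ball 0 (2*R)"
      have "deriv V z = deriv (\<lambda>x. f x * P x) z"
      proof (rule deriv_cong_ev)
        have "\<forall>\<^sub>F x in nhds z. x \<in> ?A" using e z2 by (intro eventually_nhds_in_open) auto
        then show "\<forall>\<^sub>F x in nhds z. V x = f x * P x"
        proof eventually_elim
          case (elim x)
          then have "f analytic_on {x}" using e by (meson IntD1 analytic_at open_ball)
          then show ?case using V(3)[of x] elim by (simp add: P_def)
        qed
      qed simp
      also have "\<dots> = f z * deriv P z + deriv f z * P z"
      proof (rule complex_derivative_mult_at)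
        show "f analytic_on {z}" by fact
        show "P analytic_on {z}" unfolding P_def by (intro analytic_intros)
      qed
      finally have "W z = (f z * deriv P z + deriv f z * P z) * P z - (f z * P z) * deriv P z"
        using V(3)[OF z2 fz] by (simp add: W_def P_def)
      also have "\<dots> = deriv f z * (P z)^2" by (simp add: algebra_simps power2_eq_square)
      finally show ?thesis by (simp add: P_def power_mult prod_power_distrib[symmetric] mult.commute[of 2])
    qed
    show ?thesis unfolding slow_growth_at_def
    proof (rule exI[of _ B], rule exI[of _ "\<lambda>b. 2 * m b"], rule exI[of _ W], intro conjI ballI impI)
      show "finite B" by fact
      show "(\<Sum>b\<in>B. real (2 * m b)) \<le> D * ln R"
      proof -
        have "(\<Sum>b\<in>B. real (2 * m b)) = 2 * n" by (simp add: n_def sum_distrib_left)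
        also have "\<dots> \<le> 4 * C * L" using n by simp
        also have "\<dots> \<le> D * L" using C L by (intro mult_right_mono) (auto simp: D_def)
        finally show ?thesis by (simp add: L_def)
      qed
      show "W holomorphic_on ball 0 R" by fact
      fix z :: complex assume z: "z \<in> ball 0 R"
      show "norm (W z) \<le> exp (D * (ln R)^2)" using Wb[OF z] by (simp add: L_def)
      assume "deriv f analytic_on {z}"
      then show "W z = deriv f z * (\<Prod>b\<in>B. (z - b) ^ (2 * m b))" by (rule Weq[OF z])
    next
      fix b assume b: "b \<in> B"
      then show "is_pole (deriv f) b" using B(2) is_pole_deriv_iff[OF nontriv_mero_meromorphic[OF f]] by blast
      have "norm b \<le> (2 * C) * R" using B(3)[OF b] by simp
      also have "\<dots> \<le> D * R" using C R3 by (intro mult_right_mono) (auto simp: D_def)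
      finally show "norm b \<le> D * R" .
    qed
  qed
  then show ?thesis unfolding slow_growth_def
    by (intro exI[of _ D] exI[of _ "max (max R0 3) (2 + 2 * C)"] conjI allI impI main)
       (use C in \<open>simp_all add: D_def\<close>)
qed

section \<open>Zeros, poles and the logarithmic derivative\<close>

lemma norm_prod_linear_ge:
  fixes z :: complex
  assumes "\<And>b. b \<in> B \<Longrightarrow> norm (z - b) \<ge> D" "D > 0"
  shows "norm (\<Prod>b\<in>B. (z - b) ^ m b) \<ge> exp ((\<Sum>b\<in>B. real (m b)) * ln D)"
proof -
  have "exp ((\<Sum>b\<in>B. real (m b)) * ln D) = (\<Prod>b\<in>B. exp (real (m b) * ln D))"
    by (cases "finite B") (simp_all add: exp_sum sum_distrib_right)
  also have "\<dots> = (\<Prod>b\<in>B. D ^ m b)"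
    using assms(2) by (intro prod.cong refl) (simp add: exp_of_nat_mult)
  also have "\<dots> \<le> (\<Prod>b\<in>B. norm (z - b) ^ m b)"
    using assms by (intro prod_mono conjI power_mono) auto
  also have "\<dots> = norm (\<Prod>b\<in>B. (z - b) ^ m b)"
    by (simp add: prod_norm[symmetric] norm_power)
  finally show ?thesis .
qed

lemma has_field_derivative_prod_linear_powi:
  fixes z :: complex
  assumes "z \<notin> B"
  shows "((\<lambda>x. \<Prod>b\<in>B. (x - b) powi n b) has_field_derivative
     (\<Prod>b\<in>B. (z - b) powi n b) * (\<Sum>b\<in>B. of_int (n b) / (z - b))) (at z)"
proof -
  have "((\<lambda>x. \<Prod>b\<in>B. (x - b) powi n b) has_field_derivative
     (\<Prod>b\<in>B. (z - b) powi n b) * (\<Sum>b\<in>B. (of_int (n b) * (z - b) powi (n b - 1)) / (z - b) powi n b)) (at z)"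
    by (rule has_field_derivative_prod') (use assms in \<open>auto intro!: derivative_eq_intros\<close>)
  also have "(\<Sum>b\<in>B. (of_int (n b) * (z - b) powi (n b - 1)) / (z - b) powi n b) = (\<Sum>b\<in>B. of_int (n b) / (z - b))"
  proof (rule sum.cong)
    fix b assume "b \<in> B"
    then have nz: "z - b \<noteq> 0" using assms by auto
    then have "(z - b) powi (n b - 1) = (z - b) powi n b / (z - b)" by (simp add: power_int_diff)
    then show "of_int (n b) * (z - b) powi (n b - 1) / (z - b) powi n b = of_int (n b) / (z - b)"
      using nz by simp
  qed simp
  finally show ?thesis .
qed

lemma has_field_derivative_prod_linear:
  fixes z :: complex
  assumes "z \<notin> B"
  shows "((\<lambda>x. \<Prod>b\<in>B. (x - b) ^ m b) has_field_derivative
     (\<Prod>b\<in>B. (z - b) ^ m b) * (\<Sum>b\<in>B. of_nat (m b) / (z - b))) (at z)"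
  using has_field_derivative_prod_linear_powi[OF assms, of "\<lambda>b. int (m b)"] by simp

lemma eq_at_if_eventually_eq:
  fixes h k :: "complex \<Rightarrow> complex"
  assumes "isCont h z" "isCont k z" "\<forall>\<^sub>F w in at z. h w = k w"
  shows "h z = k z"
proof -
  have "(h \<longlongrightarrow> h z) (at z)" "(k \<longlongrightarrow> k z) (at z)" using assms by (auto simp: isCont_def)
  moreover have "(h \<longlongrightarrow> k z) (at z)"
    using calculation(2) assms(3) by (subst tendsto_cong)
  ultimately show ?thesis using tendsto_unique[OF trivial_limit_at] by blast
qed

lemma eventually_analytic_at:
  assumes "f meromorphic_on UNIV"
  shows "\<forall>\<^sub>F w in at z. f analytic_on {w}"
  using meromorphic_on_imp_analytic_cosparse[OF assms] by (auto simp: eventually_cosparse_open_eq)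

text \<open>A base point fixed once for all radii: the clearing polynomials have their zeros at
  poles of \<open>F\<close>, so their size at \<open>z0\<close> is bounded below through
  \<open>\<delta>\<close>.\<close>

lemma nontriv_mero_regular_point:
  assumes F: "nontriv_mero F"
  obtains z0 \<delta> where "F analytic_on {z0}" "F z0 \<noteq> 0" "0 < \<delta>" "\<delta> \<le> 1" "\<forall>b. is_pole F b \<longrightarrow> \<delta> \<le> norm (z0 - b)"
proof -
  have "\<forall>\<^sub>F w in at 0. F analytic_on {w} \<and> F w \<noteq> 0"
    by (intro eventually_conj eventually_analytic_at nontriv_mero_meromorphic nontriv_mero_ev F)
  then obtain z0 where z0: "F analytic_on {z0}" "F z0 \<noteq> 0"
    using eventually_happens[of _ "at (0::complex)"] by auto
  from z0(1) obtain e where e: "e > 0" "F holomorphic_on ball z0 e" unfolding analytic_on_def by auto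
  have "min e 1 \<le> norm (z0 - b)" if "is_pole F b" for b
  proof (rule ccontr)
    assume "\<not> min e 1 \<le> norm (z0 - b)"
    then have "b \<in> ball z0 e" by (auto simp: dist_norm)
    then have "F analytic_on {b}" using e analytic_at by blast
    then show False using that analytic_at_imp_no_pole by blast
  qed
  with z0 e that[of z0 "min e 1"] show thesis by auto
qed

abbreviation divisor_mass :: "(complex \<Rightarrow> complex) \<Rightarrow> real \<Rightarrow> real" where
  "divisor_mass f R \<equiv> (\<Sum>c\<in>divisor_in f R. \<bar>real_of_int (zorder f c)\<bar>)"

abbreviation log_deriv_error :: "(complex \<Rightarrow> complex) \<Rightarrow> real \<Rightarrow> complex \<Rightarrow> real" where
  "log_deriv_error f R z \<equiv> norm (deriv f z / f z - (\<Sum>c\<in>divisor_in f R. of_int (zorder f c) / (z - c)))"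

text \<open>Counting is done by comparing \<open>U = V / \<Prod>(z - c)\<^sup>k\<close> at a fixed point with its maximum on a
  circle of radius about \<open>R\<^sup>2\<close>; the Borel--Caratheodory bound is then applied to the zero-free \<open>U\<close>.\<close>
lemma slow_growth_zeros_poles:
  assumes F: "nontriv_mero F" and slow: "slow_growth F"
  obtains C R0 where "C \<ge> 0"
    "\<And>R. R \<ge> R0 \<Longrightarrow> divisor_mass F R \<le> C * ln R"
    "\<And>R z. R \<ge> R0 \<Longrightarrow> norm z \<le> R / 2 \<Longrightarrow> F analytic_on {z} \<Longrightarrow> F z \<noteq> 0 \<Longrightarrow>
       log_deriv_error F R z \<le> C * (ln R)^2 / R"
proof -
  from slow obtain C R0 where C: "C \<ge> 0" and ex: "\<And>R. R \<ge> R0 \<Longrightarrow> slow_growth_at F C R"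
    unfolding slow_growth_def by blast
  obtain z0 \<delta> where z0: "F analytic_on {z0}" "F z0 \<noteq> 0" and \<delta>: "0 < \<delta>" "\<delta> \<le> 1" "\<forall>b. is_pole F b \<longrightarrow> \<delta> \<le> norm (z0 - b)"
    by (rule nontriv_mero_regular_point[OF F])
  \<comment> \<open>Chosen so that \<open>|F z0 * P z0| \<ge> exp (- c1 L)\<close>: the first term
    accounts for \<open>F z0\<close>, the second for at most \<open>3 C L\<close> factors of modulus
    at least \<open>\<delta>\<close>.\<close>
  define c1 where "c1 = max 0 (- ln (norm (F z0))) + 3 * C * (- ln \<delta>)"
  have "3 * C * (- ln \<delta>) \<ge> 0" using C \<delta> by (intro mult_nonneg_nonneg) auto
  then have c1: "c1 \<ge> 0" unfolding c1_def by linarith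
  define N0 where "N0 = 18 * C + 2 * c1"
  define D where "D = N0 + 6 * C + 52 * (2 * (36 * C + 4 * c1) + 1) + 6 * C"
  have D: "D \<ge> 0" "N0 + 3 * C \<le> D" using C c1 by (auto simp: D_def N0_def)
  define R1 where "R1 = Max {R0, 8, 16 * norm z0}"
  have main: "divisor_mass F R \<le> D * ln R \<and>
    (\<forall>z. norm z \<le> R / 2 \<longrightarrow> F analytic_on {z} \<longrightarrow> F z \<noteq> 0 \<longrightarrow>
       log_deriv_error F R z \<le> D * (ln R)^2 / R)"
    if R: "R \<ge> R1" for R
  proof -
    have R8: "R \<ge> 8" "R \<ge> R0" "norm z0 \<le> R / 16" using R by (auto simp: R1_def)
    define L where "L = ln R"
    have L1: "L \<ge> 1"
    proof -
      have "exp 1 \<le> R" using exp_le R8 by linarith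
      then show ?thesis using R8 by (metis L_def exp_gt_zero ln_exp ln_le_cancel_iff order_less_le_trans)
    qed
    \<comment> \<open>On \<open>|w| = S\<close> every factor of \<open>Q\<close> has modulus at
      least \<open>S - R \<ge> R^2\<close>, so \<open>|Q| \<ge> exp (2 N L)\<close>, while at
      \<open>z0\<close> only \<open>|Q| \<le> exp (3/2 N L)\<close>. The gap of
      \<open>N L / 2\<close> in the exponents bounds \<open>N\<close>.\<close>
    define S where "S = 4 * R^2"
    have S: "S - R \<ge> R^2" "S > R" "2 * S \<ge> R0" "R < 2 * S" "S > 0"
    proof -
      have "8 * R \<le> R^2" using R8 by (simp add: power2_eq_square)
      then show "S - R \<ge> R^2" "S > R" "2 * S \<ge> R0" "R < 2 * S" "S > 0" using R8 by (auto simp: S_def)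
    qed
    have ln2S: "ln (2 * S) \<le> 3 * L" "ln (2 * S) \<ge> 0"
    proof -
      have "8 * R^2 \<le> R * R^2" using R8 by (intro mult_right_mono) auto
      then have "2 * S \<le> R^3" by (simp add: S_def power3_eq_cube power2_eq_square)
      then have "ln (2 * S) \<le> ln (R^3)" using S R8 by (subst ln_le_cancel_iff) auto
      then show "ln (2 * S) \<le> 3 * L" using R8 by (simp add: ln_realpow L_def)
      show "ln (2 * S) \<ge> 0" using S R8 by simp
    qed
    obtain B m V where B: "finite B" "\<And>b. b \<in> B \<Longrightarrow> is_pole F b"
      and m: "(\<Sum>b\<in>B. real (m b)) \<le> C * ln (2 * S)" and V: "V holomorphic_on ball 0 (2 * S)"
      "\<And>z. z \<in> ball 0 (2*S) \<Longrightarrow> norm (V z) \<le> exp (C * (ln (2 * S))^2)"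
      "\<And>z. z \<in> ball 0 (2*S) \<Longrightarrow> F analytic_on {z} \<Longrightarrow> V z = F z * (\<Prod>b\<in>B. (z - b) ^ m b)"
      using ex[OF S(3)] unfolding slow_growth_at_def by auto
    define n where "n = (\<Sum>b\<in>B. real (m b))"
    have n: "n \<ge> 0" "n \<le> 3 * C * L"
    proof -
      show "n \<ge> 0" by (auto simp: n_def intro: sum_nonneg)
      have "n \<le> C * (3 * L)" using m ln2S mult_left_mono[OF ln2S(1) C] by (simp add: n_def)
      then show "n \<le> 3 * C * L" by simp
    qed
    define P where "P = (\<lambda>z. \<Prod>b\<in>B. (z - b) ^ m b)"
    have P: "nontriv_mero P" unfolding P_def by (rule nontriv_mero_prod_linear)
    have Pan: "P analytic_on A" for A unfolding P_def by (intro analytic_intros)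
    have zoP: "zorder P z = (if z \<in> B then int (m z) else 0)" for z
      unfolding P_def using zorder_prod_linear_powi[OF B(1), of "\<lambda>b. int (m b)" z] by simp
    define q where "q = (\<lambda>z. F z * P z)"
    have q: "nontriv_mero q" unfolding q_def by (rule nontriv_mero_mult[OF F P])
    have zoq: "zorder q z = zorder F z + zorder P z" for z
      unfolding q_def by (rule nontriv_zorder_mult[OF F P])
    have Van: "V analytic_on {z}" if "z \<in> ball 0 (2*S)" for z
      using V(1) that analytic_at by blast
    have evVq: "\<forall>\<^sub>F w in at z. V w = q w" if z: "z \<in> ball 0 (2*S)" for z
    proof -
      have "\<forall>\<^sub>F w in at z. w \<in> ball 0 (2*S)" using z by (intro eventually_at_in_open') auto
      moreover have "\<forall>\<^sub>F w in at z. F analytic_on {w}"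
        by (intro eventually_analytic_at nontriv_mero_meromorphic F)
      ultimately show ?thesis by eventually_elim (use V(3) in \<open>auto simp: q_def P_def\<close>)
    qed
    have zoq0: "zorder q z \<ge> 0" if z: "z \<in> ball 0 (2*S)" for z
    proof -
      have "zorder q z = zorder V z"
        by (rule zorder_cong) (use evVq[OF z] in \<open>auto elim: eventually_mono\<close>)
      moreover have "\<exists>\<^sub>F w in at z. V w \<noteq> 0"
        using frequently_eventually_frequently[OF nontriv_mero_freq[OF q] evVq[OF z]]
        by (rule frequently_elim1) auto
      ultimately show ?thesis using zorder_ge_0[OF Van[OF z]] by simp
    qed
    define Z where "Z = divisor_in q R"
    have finZ: "finite Z" unfolding Z_def by (rule finite_zorder_cball[OF q])
    define k where "k = (\<lambda>c. nat (zorder q c))"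
    obtain U where U: "nontriv_mero U"
      "\<And>z. zorder q z = (if z \<in> Z then int (k z) else 0) \<Longrightarrow> U analytic_on {z} \<and> U z \<noteq> 0"
      "\<And>z. z \<notin> Z \<Longrightarrow> q analytic_on {z} \<Longrightarrow> q z = U z * (\<Prod>c\<in>Z. (z - c) powi int (k c))"
      "\<And>z. zorder q z \<ge> (if z \<in> Z then int (k z) else 0) \<Longrightarrow> U analytic_on {z}"
      by (rule zero_free_factorization[OF q finZ, of "\<lambda>c. int (k c)"]) blast
    have Uan: "U analytic_on {z}" if "z \<in> ball 0 (2*S)" for z
      by (rule U(4)) (use zoq0[OF that] in \<open>auto simp: k_def\<close>)
    have Unz: "U z \<noteq> 0" if "norm z \<le> R" for z
    proof -
      have "z \<in> ball 0 (2*S)" using that S by simp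
      then show ?thesis using U(2)[of z] zoq0[of z] that by (auto simp: Z_def k_def)
    qed
    define Q where "Q = (\<lambda>z. \<Prod>c\<in>Z. (z - c) ^ k c)"
    have Qan: "Q analytic_on A" for A unfolding Q_def by (intro analytic_intros)
    have VU: "V z = U z * Q z" if z: "z \<in> ball 0 (2*S)" for z
    proof (rule eq_at_if_eventually_eq[where h = V and k = "\<lambda>z. U z * Q z"])
      show "isCont V z" using Van[OF z] analytic_at_imp_isCont by blast
      have "(\<lambda>w. U w * Q w) analytic_on {z}" by (intro analytic_intros Uan[OF z] Qan)
      then show "isCont (\<lambda>w. U w * Q w) z" using analytic_at_imp_isCont by blast
      have "\<forall>\<^sub>F w in at z. w \<notin> Z" using islimpt_finite[OF finZ, of z] unfolding islimpt_iff_eventually by simp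
      moreover have "\<forall>\<^sub>F w in at z. q analytic_on {w}"
        by (intro eventually_analytic_at nontriv_mero_meromorphic q)
      ultimately show "\<forall>\<^sub>F w in at z. V w = U w * Q w" using evVq[OF z]
        by eventually_elim (use U(3) in \<open>auto simp: Q_def\<close>)
    qed
    define N where "N = (\<Sum>c\<in>Z. real (k c))"
    have N: "N \<ge> 0" by (auto simp: N_def intro: sum_nonneg)
    have Uhol: "U holomorphic_on ball 0 (2*S)"
      by (rule analytic_imp_holomorphic, subst analytic_on_analytic_at) (use Uan in auto)
    have Usph: "norm (U w) \<le> exp (9 * C * L^2 - 2 * N * L)" if w: "norm w = S" for w
    proof -
      have wb: "w \<in> ball 0 (2*S)" using w S by simp
      have "exp (N * ln (R^2)) \<le> norm (Q w)" unfolding Q_def N_def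
      proof (rule norm_prod_linear_ge)
        fix c assume "c \<in> Z"
        then have "norm c \<le> R" by (simp add: Z_def)
        then show "R^2 \<le> norm (w - c)" using norm_triangle_ineq2[of w c] w S(1) by linarith
      qed (use R8 in simp)
      moreover have "ln (R^2) = 2 * L" using R8 by (simp add: ln_realpow L_def)
      ultimately have Qge: "exp (2 * N * L) \<le> norm (Q w)" by (simp add: mult_ac)
      have "(ln (2*S))^2 \<le> (3*L)^2" using ln2S by (intro power_mono) auto
      then have "C * (ln (2*S))^2 \<le> C * (3 * L)^2" by (rule mult_left_mono[OF _ C])
      also have "C * (3 * L)^2 = 9 * C * L^2" by (simp add: power_mult_distrib)
      finally have Vle: "norm (V w) \<le> exp (9 * C * L^2)"
        using V(2)[OF wb] by (meson exp_le_cancel_iff order_trans)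
      have "norm (U w) * exp (2 * N * L) \<le> norm (U w) * norm (Q w)"
        by (intro mult_left_mono Qge) auto
      also have "\<dots> = norm (V w)" using VU[OF wb] by (simp add: norm_mult)
      also note Vle
      finally show ?thesis by (simp only: exp_diff pos_le_divide_eq exp_gt_zero)
    qed
    have Ub: "norm (U w) \<le> exp (9 * C * L^2 - 2 * N * L)" if w: "norm w \<le> S" for w
    proof (rule maximum_modulus_frontier[where f = U and S = "cball 0 S" and \<xi> = w])
      show "U holomorphic_on interior (cball 0 S)"
        by (rule holomorphic_on_subset[OF Uhol]) (use S in auto)
      have "U holomorphic_on closure (cball 0 S)"
        by (rule holomorphic_on_subset[OF Uhol]) (use S in auto)
      then show "continuous_on (closure (cball 0 S)) U" by (rule holomorphic_on_imp_continuous_on)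
    qed (use w S Usph in auto)
    have z0R: "z0 \<in> ball 0 (2*S)" using R8 S by (simp; linarith)
    have Uz0: "norm (U z0) \<ge> exp (- (c1 * L) - 3/2 * N * L)"
    proof -
      have "norm (Q z0) \<le> exp (N * ln (2 * R))" unfolding Q_def N_def
      proof (rule norm_prod_linear_le)
        fix c assume "c \<in> Z"
        then have "norm c \<le> R" by (simp add: Z_def)
        then show "norm (z0 - c) \<le> 2 * R" using norm_triangle_ineq4[of z0 c] R8 by linarith
      qed (use R8 in simp)
      moreover have "N * ln (2 * R) \<le> N * (3/2 * L)"
      proof (intro mult_left_mono N)
        have "(2::real)^2 \<le> R" using R8 by simp
        then have "ln ((2::real)^2) \<le> ln R" by (subst ln_le_cancel_iff) (use R8 in auto)
        moreover have "ln ((2::real)^2) = 2 * ln 2" by (subst ln_realpow) simp_all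
        ultimately have "2 * ln (2::real) \<le> L" unfolding L_def by metis
        then show "ln (2 * R) \<le> 3/2 * L" using R8 by (simp add: ln_mult L_def)
      qed
      moreover have "N * (3/2 * L) = 3/2 * N * L" by simp
      ultimately have Qle: "norm (Q z0) \<le> exp (3/2 * N * L)"
        by (metis exp_le_cancel_iff order_trans)
      have "exp (n * ln \<delta>) \<le> norm (P z0)" unfolding P_def n_def
        by (rule norm_prod_linear_ge) (use \<delta> B in auto)
      moreover have "n * (- ln \<delta>) \<le> (3 * C * L) * (- ln \<delta>)"
        using n \<delta> by (intro mult_right_mono) auto
      then have "- (3 * C * (- ln \<delta>)) * L \<le> n * ln \<delta>" by (simp add: algebra_simps)
      ultimately have Pge: "exp (- (3 * C * (- ln \<delta>)) * L) \<le> norm (P z0)"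
        by (meson exp_le_cancel_iff order_trans)
      have "- max 0 (- ln (norm (F z0))) * L \<le> - max 0 (- ln (norm (F z0)))"
        using L1 mult_left_mono[of 1 L "max 0 (- ln (norm (F z0)))"] by simp
      then have "- max 0 (- ln (norm (F z0))) * L \<le> ln (norm (F z0))" by linarith
      then have Fge: "exp (- max 0 (- ln (norm (F z0))) * L) \<le> norm (F z0)"
        using z0 by (metis exp_le_cancel_iff exp_ln zero_less_norm_iff)
      have "exp (- (c1 * L)) = exp (- max 0 (- ln (norm (F z0))) * L) * exp (- (3 * C * (- ln \<delta>)) * L)"
        by (simp add: c1_def algebra_simps flip: exp_add)
      also have "\<dots> \<le> norm (F z0) * norm (P z0)" by (intro mult_mono Fge Pge) auto
      also have "\<dots> = norm (V z0)" using V(3)[OF z0R z0(1)] by (simp add: P_def norm_mult)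
      also have "\<dots> = norm (U z0) * norm (Q z0)" using VU[OF z0R] by (simp add: norm_mult)
      also have "\<dots> \<le> norm (U z0) * exp (3/2 * N * L)" by (intro mult_left_mono Qle) auto
      finally show ?thesis by (simp only: exp_diff pos_divide_le_eq exp_gt_zero)
    qed
    have NL: "N \<le> N0 * L"
    proof -
      have "norm z0 \<le> S" using R8 S by linarith
      then have "exp (- (c1 * L) - 3/2 * N * L) \<le> exp (9 * C * L^2 - 2 * N * L)"
        using Uz0 Ub[of z0] by linarith
      then have "N * L \<le> 18 * C * L^2 + 2 * c1 * L" by simp
      also have "\<dots> = (18 * C * L + 2 * c1) * L" by (simp add: power2_eq_square algebra_simps)
      finally have "N \<le> 18 * C * L + 2 * c1" using L1 by simp
      also have "\<dots> \<le> 18 * C * L + 2 * c1 * L" using L1 c1 mult_left_mono[of 1 L "2 * c1"] by simp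
      finally show ?thesis by (simp add: N0_def algebra_simps)
    qed
    \<comment> \<open>Covers both the upper bound \<open>9 C L^2\<close> for \<open>ln |U|\<close>
      and the loss at \<open>z0\<close>, which is at most \<open>(27 C + 4 c1) L^2\<close>.\<close>
    define K where "K = (36 * C + 4 * c1) * L^2"
    have K0: "K \<ge> 0" using C c1 by (simp add: K_def)
    have L2: "L \<le> L^2" using L1 by (simp add: power2_eq_square)
    have ldU: "norm (deriv U z / U z) \<le> 52 * (2 * K + 1) / R" if z: "norm z \<le> R / 2" for z
    proof (rule log_deriv_bound[where U = U and R = R and K = K and z = z and ?z0.0 = z0])
      show "U holomorphic_on ball 0 R" by (rule holomorphic_on_subset[OF Uhol]) (use S in auto)
      fix w :: complex assume w: "w \<in> ball 0 R"
      show "U w \<noteq> 0" using Unz w by simp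
      have "9 * C * L^2 - 2 * N * L \<le> 9 * C * L^2" using N L1 by simp
      also have "\<dots> \<le> K" unfolding K_def using C c1 by (intro mult_right_mono) auto
      finally have "exp (9 * C * L^2 - 2 * N * L) \<le> exp K" by simp
      moreover have "norm w \<le> S" using w S by simp
      ultimately show "norm (U w) \<le> exp K" using Ub[of w] by (meson order_trans)
    next
      have "3/2 * N * L \<le> 3/2 * (N0 * L) * L" using NL L1 by (intro mult_right_mono) auto
      moreover have "c1 * L \<le> c1 * L^2" using L2 c1 by (rule mult_left_mono)
      moreover have "3/2 * (N0 * L) * L + c1 * L^2 = (27 * C + 4 * c1) * L^2"
        by (simp add: N0_def power2_eq_square algebra_simps)
      moreover have "(27 * C + 4 * c1) * L^2 \<le> K" unfolding K_def using C by (intro mult_right_mono) auto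
      ultimately have "- K \<le> - (c1 * L) - 3/2 * N * L" by linarith
      then show "exp (- K) \<le> norm (U z0)" using Uz0 by (meson exp_le_cancel_iff order_trans)
    qed (use R8 z K0 in auto)
    let ?A = "divisor_in F R"
    define BR where "BR = B \<inter> cball 0 R"
    have finBR: "finite BR" using B by (simp add: BR_def)
    \<comment> \<open>The multiplicities \<open>m\<close> may exceed the pole orders of
      \<open>F\<close>; the excess reappears as zeros of \<open>q\<close>, so the difference is
      still the order of \<open>F\<close>.\<close>
    have zoF: "zorder F c = int (if c \<in> Z then k c else 0) - int (if c \<in> BR then m c else 0)" if c: "c \<in> cball 0 R" for c
    proof -
      have "c \<in> ball 0 (2*S)" using c S by simp
      then show ?thesis using zoq[of c] zoP[of c] zoq0[of c] c
        by (cases "c \<in> B") (auto simp: Z_def k_def BR_def)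
    qed
    have sub: "?A \<subseteq> Z \<union> BR"
    proof
      fix c assume "c \<in> ?A"
      then show "c \<in> Z \<union> BR" using zoF[of c] by (auto split: if_splits)
    qed
    have "(\<Sum>c\<in>?A. \<bar>real_of_int (zorder F c)\<bar>) \<le> (\<Sum>c\<in>Z \<union> BR. \<bar>real_of_int (zorder F c)\<bar>)"
      by (rule sum_mono2) (use finZ finBR sub in auto)
    also have "\<dots> \<le> (\<Sum>c\<in>Z \<union> BR. (if c \<in> Z then real (k c) else 0) + (if c \<in> BR then real (m c) else 0))"
    proof (rule sum_mono)
      fix c assume "c \<in> Z \<union> BR"
      then have "c \<in> cball 0 R" by (auto simp: Z_def BR_def)
      from zoF[OF this] show "\<bar>real_of_int (zorder F c)\<bar> \<le> (if c \<in> Z then real (k c) else 0) + (if c \<in> BR then real (m c) else 0)"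
        by auto
    qed
    also have "\<dots> = N + (\<Sum>c\<in>BR. real (m c))"
    proof -
      have "(Z \<union> BR) \<inter> Z = Z" "(Z \<union> BR) \<inter> BR = BR" by auto
      then show ?thesis using finZ finBR by (simp add: sum.distrib sum.If_cases N_def)
    qed
    also have "(\<Sum>c\<in>BR. real (m c)) \<le> n" unfolding n_def by (rule sum_mono2) (use B in \<open>auto simp: BR_def\<close>)
    also have "N + n \<le> (N0 + 3 * C) * L" using NL n by (simp add: algebra_simps)
    also have "\<dots> \<le> D * L" using D L1 by (intro mult_right_mono) auto
    finally have count: "(\<Sum>c\<in>?A. \<bar>real_of_int (zorder F c)\<bar>) \<le> D * ln R" by (simp add: L_def)
    have ld: "norm (deriv F z / F z - (\<Sum>c\<in>?A. of_int (zorder F c) / (z - c))) \<le> D * (ln R)^2 / R"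
      if z: "norm z \<le> R / 2" "F analytic_on {z}" "F z \<noteq> 0" for z
    proof -
      have zS: "z \<in> ball 0 (2*S)" using z S R8 by (simp; linarith)
      have zB: "z \<notin> B" using B(2) z(2) analytic_at_imp_no_pole by blast
      then have Pz: "P z \<noteq> 0" using B by (simp add: P_def)
      have qan: "q analytic_on {z}" unfolding q_def by (intro analytic_intros z Pan)
      have "q z \<noteq> 0" using Pz z by (simp add: q_def)
      then have "zorder q z = 0" using zorder_eq_0I[OF qan] by simp
      then have zZ: "z \<notin> Z" by (simp add: Z_def)
      then have Qz: "Q z \<noteq> 0" using finZ by (simp add: Q_def)
      have Uz: "U z \<noteq> 0" using Unz z R8 by simp
      have "(U has_field_derivative deriv U z) (at z)"
        by (rule analytic_at_imp_DERIV[OF Uan[OF zS]])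
      moreover have "(Q has_field_derivative Q z * (\<Sum>c\<in>Z. of_nat (k c) / (z - c))) (at z)"
        unfolding Q_def by (rule has_field_derivative_prod_linear[OF zZ])
      moreover have "(P has_field_derivative P z * (\<Sum>b\<in>B. of_nat (m b) / (z - b))) (at z)"
        unfolding P_def by (rule has_field_derivative_prod_linear[OF zB])
      ultimately have der: "((\<lambda>x. U x * Q x / P x) has_field_derivative
        ((deriv U z * Q z + U z * (Q z * (\<Sum>c\<in>Z. of_nat (k c) / (z - c)))) * P z -
          U z * Q z * (P z * (\<Sum>b\<in>B. of_nat (m b) / (z - b)))) / (P z * P z)) (at z)"
        using Pz by (auto intro!: derivative_eq_intros simp: algebra_simps)
      obtain e where e: "e > 0" "F holomorphic_on ball z e" using z(2) unfolding analytic_on_def by auto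
      have "\<forall>\<^sub>F x in nhds z. x \<in> - B"
        using zB B(1) by (intro eventually_nhds_in_open) (auto simp: finite_imp_closed)
      then have "\<forall>\<^sub>F x in nhds z. P x \<noteq> 0"
        by eventually_elim (use B(1) in \<open>auto simp: P_def\<close>)
      moreover have "\<forall>\<^sub>F x in nhds z. x \<in> ball z e \<inter> ball 0 (2*S)" using e zS by (intro eventually_nhds_in_open) auto
      ultimately have "\<forall>\<^sub>F x in nhds z. F x = U x * Q x / P x"
      proof eventually_elim
        case (elim x)
        then have "F analytic_on {x}" using e by (meson IntD1 analytic_at open_ball)
        then show ?case using V(3)[of x] VU[of x] elim by (simp add: P_def)
      qed
      then have "deriv F z = deriv (\<lambda>x. U x * Q x / P x) z" and Fz: "F z = U z * Q z / P z"
        by (auto intro: deriv_cong_ev eventually_nhds_x_imp_x)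
      have alg: "((u' * q + u * (q * s)) * p - u * q * (p * t)) / (p * p) / (u * q / p) = u' / u + s - t"
        if "u \<noteq> 0" "q \<noteq> 0" "p \<noteq> 0" for u u' q p s t :: complex
        using that by (simp add: field_simps)
      have e1: "deriv F z / F z = deriv U z / U z + (\<Sum>c\<in>Z. of_nat (k c) / (z - c)) - (\<Sum>b\<in>B. of_nat (m b) / (z - b))"
        unfolding \<open>deriv F z = deriv (\<lambda>x. U x * Q x / P x) z\<close> Fz DERIV_imp_deriv[OF der]
        by (rule alg[OF Uz Qz Pz])
      have e2: "(\<Sum>c\<in>?A. of_int (zorder F c) / (z - c)) =
         (\<Sum>c\<in>Z. of_nat (k c) / (z - c)) - (\<Sum>b\<in>BR. of_nat (m b) / (z - b))"
      proof -
        have "(\<Sum>c\<in>?A. of_int (zorder F c) / (z - c)) = (\<Sum>c\<in>Z \<union> BR. of_int (zorder F c) / (z - c))"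
        proof (rule sum.mono_neutral_left)
          show "\<forall>i\<in>Z \<union> BR - ?A. of_int (zorder F i) / (z - i) = 0"
            by (auto simp: Z_def BR_def)
        qed (use finZ finBR sub in auto)
        also have "\<dots> = (\<Sum>c\<in>Z \<union> BR. (if c \<in> Z then of_nat (k c) / (z - c) else 0) - (if c \<in> BR then of_nat (m c) / (z - c) else 0))"
        proof (rule sum.cong)
          fix c assume "c \<in> Z \<union> BR"
          then have "c \<in> cball 0 R" by (auto simp: Z_def BR_def)
          from zoF[OF this] show "of_int (zorder F c) / (z - c) = (if c \<in> Z then of_nat (k c) / (z - c) else 0) - (if c \<in> BR then of_nat (m c) / (z - c) else 0)"
            by (simp add: diff_divide_distrib)
        qed simp
        also have "\<dots> = (\<Sum>c\<in>Z. of_nat (k c) / (z - c)) - (\<Sum>b\<in>BR. of_nat (m b) / (z - b))"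
        proof -
          have "(Z \<union> BR) \<inter> Z = Z" "(Z \<union> BR) \<inter> BR = BR" by auto
          then show ?thesis using finZ finBR by (simp add: sum_subtractf sum.If_cases)
        qed
        finally show ?thesis .
      qed
      \<comment> \<open>Elements of \<open>B\<close> outside the disc are at distance at least
        \<open>R/2\<close> from \<open>z\<close>; each unit of multiplicity there costs
        \<open>2/R\<close>.\<close>
      have e3: "(\<Sum>b\<in>B. of_nat (m b) / (z - b)) = (\<Sum>b\<in>BR. of_nat (m b) / (z - b)) + (\<Sum>b\<in>B - BR. of_nat (m b) / (z - b))"
        using sum.subset_diff[of BR B] B(1) by (simp add: BR_def add.commute)
      have eq: "deriv F z / F z - (\<Sum>c\<in>?A. of_int (zorder F c) / (z - c)) = deriv U z / U z - (\<Sum>b\<in>B - BR. of_nat (m b) / (z - b))"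
        unfolding e1 e2 e3 by simp
      have "norm (\<Sum>b\<in>B - BR. of_nat (m b) / (z - b)) \<le> (\<Sum>b\<in>B - BR. real (m b) * (2 / R))"
      proof (rule sum_norm_le)
        fix b assume "b \<in> B - BR"
        then have "norm b > R" by (auto simp: BR_def)
        then have "norm (z - b) \<ge> R / 2" using z norm_triangle_ineq2[of b z] by (simp add: norm_minus_commute)
        then have "real (m b) / norm (z - b) \<le> real (m b) / (R / 2)"
          using R8 by (intro divide_left_mono) (auto intro!: mult_pos_pos)
        then show "norm (of_nat (m b) / (z - b)) \<le> real (m b) * (2 / R)"
          by (simp add: norm_divide)
      qed
      also have "\<dots> \<le> n * (2 / R)"
        unfolding n_def sum_distrib_right[symmetric] using R8 B
        by (intro mult_right_mono sum_mono2) auto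
      also have "\<dots> \<le> (3 * C * L) * (2 / R)" using n R8 by (intro mult_right_mono) auto
      finally have s: "norm (\<Sum>b\<in>B - BR. of_nat (m b) / (z - b)) \<le> 6 * C * L / R" by simp
      have "norm (deriv F z / F z - (\<Sum>c\<in>?A. of_int (zorder F c) / (z - c))) \<le> 52 * (2 * K + 1) / R + 6 * C * L / R"
        unfolding eq using norm_triangle_ineq4[of "deriv U z / U z"] ldU[OF z(1)] s by (smt (verit))
      also have "\<dots> = (52 * (2 * K + 1) + 6 * C * L) / R" by (simp add: add_divide_distrib)
      also have "\<dots> \<le> D * L^2 / R"
      proof (intro divide_right_mono)
        have "1 \<le> L^2" using L1 by simp
        moreover have "6 * C * L \<le> 6 * C * L^2" using L2 C by (intro mult_left_mono) auto
        ultimately have "52 * (2 * K + 1) + 6 * C * L \<le> (52 * (2 * (36 * C + 4 * c1) + 1) + 6 * C) * L^2"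
          by (simp add: K_def algebra_simps)
        also have "\<dots> \<le> D * L^2" using C c1 by (intro mult_right_mono) (auto simp: D_def N0_def)
        finally show "52 * (2 * K + 1) + 6 * C * L \<le> D * L^2" .
      qed (use R8 in auto)
      finally show ?thesis by (simp add: L_def)
    qed
    show ?thesis using count ld by blast
  qed
  show ?thesis by (rule that[of D R1]) (use D main in \<open>blast+\<close>)
qed

section \<open>Annuli free of zeros and poles\<close>

text \<open>Exponential decay in the coordinate \<open>log |z|\<close> is weakened to a kernel whose
  primitive \<open>arctan\<close> is bounded and easy to average.\<close>

lemma exp_minus_le_inverse_square:
  fixes u :: real
  assumes "u \<ge> 0"
  shows "exp (- u) \<le> 2 / (1 + u^2)"
proof -
  have "1 + u^2 \<le> 2 * exp u"
    using exp_lower_Taylor_quadratic[OF assms] assms by (simp add: power2_eq_square)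
  moreover have "1 + u^2 > 0" by (simp add: add_pos_nonneg)
  ultimately show ?thesis by (simp add: exp_minus field_simps)
qed

text \<open>Apply the mean value theorem to \<open>\<Sum>w(arctan (t - x) + B h arctan ((t - x)/h))\<close>, whose total
  increase is at most \<open>\<pi> (1 + B h) \<Sum>w\<close>. The second summand penalizes points within \<open>h\<close> of \<open>t\<close>.\<close>
lemma exists_separated_point:
  fixes x w :: "'a \<Rightarrow> real"
  assumes fin: "finite I" and w: "\<And>i. i \<in> I \<Longrightarrow> w i \<ge> 1" and A: "A > 0" and L: "L > 0"
    and sum: "(\<Sum>i\<in>I. w i) \<le> A * L"
  defines "B \<equiv> 8 * pi * A" and "h \<equiv> 1 / (4 * pi * A)"
  obtains t where "L < t" "t < 2 * L" "\<And>i. i \<in> I \<Longrightarrow> \<bar>t - x i\<bar> > h"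
    "(\<Sum>i\<in>I. w i / (1 + (t - x i)^2)) < B / 2"
proof -
  \<comment> \<open>With \<open>B h = 2\<close> the total increase is at most
    \<open>3 pi A L\<close>, so some \<open>t\<close> in an interval of length \<open>L\<close> has
    derivative at most \<open>3 pi A\<close>. This is below \<open>B/2 = 4 pi A\<close>, the least
    contribution of a point within distance \<open>h\<close>.\<close>
  have Bh: "B > 0" "h > 0" "B * h = 2" using A by (simp_all add: B_def h_def)
  define \<Psi> where "\<Psi> = (\<lambda>t. \<Sum>i\<in>I. w i * (arctan (t - x i) + B * h * arctan ((t - x i) / h)))"
  define \<psi> where "\<psi> = (\<lambda>t. \<Sum>i\<in>I. w i * (1 / (1 + (t - x i)^2) + B / (1 + ((t - x i) / h)^2)))"
  have pos1: "1 + s^2 > 0" for s :: real by (simp add: add_pos_nonneg)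
  have der: "(\<Psi> has_real_derivative \<psi> t) (at t)" for t
    unfolding \<Psi>_def \<psi>_def
  proof (rule DERIV_sum)
    fix i
    show "((\<lambda>t. w i * (arctan (t - x i) + B * h * arctan ((t - x i) / h))) has_real_derivative
        w i * (1 / (1 + (t - x i)^2) + B / (1 + ((t - x i) / h)^2))) (at t)"
      using Bh(2) pos1[of "t - x i"] pos1[of "(t - x i) / h"]
      by (auto intro!: derivative_eq_intros simp: divide_inverse)
  qed
  obtain t where t: "L < t" "t < 2 * L" "\<Psi> (2 * L) - \<Psi> L = (2 * L - L) * \<psi> t"
    using MVT2[of L "2 * L" \<Psi> \<psi>] der L by auto
  have atan: "arctan a - arctan b \<le> pi" for a b
    using arctan_bounded[of a] arctan_bounded[of b] by linarith
  have "\<Psi> (2 * L) - \<Psi> L = (\<Sum>i\<in>I. w i * ((arctan (2 * L - x i) - arctan (L - x i)) + B * h * (arctan ((2 * L - x i) / h) - arctan ((L - x i) / h))))"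
    unfolding \<Psi>_def sum_subtractf[symmetric] by (intro sum.cong) (auto simp: algebra_simps)
  also have "\<dots> \<le> (\<Sum>i\<in>I. w i * (pi + B * h * pi))"
    by (intro sum_mono mult_left_mono add_mono atan) (use Bh w in \<open>fastforce+\<close>)
  also have "\<dots> = (\<Sum>i\<in>I. w i) * (3 * pi)" using Bh by (simp add: sum_distrib_right)
  also have "\<dots> \<le> (A * L) * (3 * pi)" by (intro mult_right_mono sum) auto
  finally have "\<psi> t \<le> A * 3 * pi" using t(3) L by (simp add: field_simps)
  also have "\<dots> < B / 2" using A by (simp add: B_def)
  finally have \<psi>: "\<psi> t < B / 2" .
  have le_psi: "w i * (1 / (1 + (t - x i)^2) + B / (1 + ((t - x i) / h)^2)) \<le> \<psi> t" if i: "i \<in> I" for i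
    unfolding \<psi>_def
  proof (rule member_le_sum[OF i _ fin])
    fix j assume "j \<in> I - {i}"
    then show "0 \<le> w j * (1 / (1 + (t - x j)^2) + B / (1 + ((t - x j) / h)^2))"
      using w[of j] Bh pos1[of "t - x j"] pos1[of "(t - x j) / h"]
      by (intro mult_nonneg_nonneg add_nonneg_nonneg divide_nonneg_pos) auto
  qed
  have sep: "\<bar>t - x i\<bar> > h" if i: "i \<in> I" for i
  proof (rule ccontr)
    assume "\<not> \<bar>t - x i\<bar> > h"
    then have "\<bar>(t - x i) / h\<bar> \<le> 1" using Bh by simp
    then have "((t - x i) / h)^2 \<le> 1" using abs_square_le_1 by blast
    then have "B / 2 \<le> B / (1 + ((t - x i) / h)^2)" using Bh pos1[of "(t - x i) / h"] by (intro divide_left_mono) auto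
    also have "\<dots> \<le> 1 / (1 + (t - x i)^2) + B / (1 + ((t - x i) / h)^2)" using pos1[of "t - x i"] by simp
    also have "\<dots> \<le> w i * (1 / (1 + (t - x i)^2) + B / (1 + ((t - x i) / h)^2))"
      using w[OF i] Bh pos1[of "t - x i"] pos1[of "(t - x i) / h"] mult_right_mono[of 1 "w i" "1 / (1 + (t - x i)^2) + B / (1 + ((t - x i) / h)^2)"]
      by (simp add: add_nonneg_nonneg)
    also have "\<dots> \<le> \<psi> t" by (rule le_psi[OF i])
    finally show False using \<psi> by simp
  qed
  have "(\<Sum>i\<in>I. w i / (1 + (t - x i)^2)) \<le> \<psi> t" unfolding \<psi>_def
  proof (rule sum_mono)
    fix i assume i: "i \<in> I"
    have "B / (1 + ((t - x i) / h)^2) \<ge> 0" using Bh pos1[of "(t - x i) / h"] by simp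
    then have "w i * (1 / (1 + (t - x i)^2)) \<le> w i * (1 / (1 + (t - x i)^2) + B / (1 + ((t - x i) / h)^2))"
      using w[OF i] by (intro mult_left_mono) auto
    then show "w i / (1 + (t - x i)^2) \<le> w i * (1 / (1 + (t - x i)^2) + B / (1 + ((t - x i) / h)^2))" by simp
  qed
  with \<psi> have "(\<Sum>i\<in>I. w i / (1 + (t - x i)^2)) < B / 2" by linarith
  with t sep show ?thesis using that by blast
qed

text \<open>The annulus has half-width \<open>\<eta>\<close> in the coordinate
  \<open>log |z|\<close>. The last clause says that \<open>F\<close> behaves like a power with
  exponent \<open>zcount F r\<close>; together with the first it gives
  \<open>F'/F = O(ln r / r)\<close>, which is small on the scale of a unit shift.\<close>

definition regular_annulus :: "(complex \<Rightarrow> complex) \<Rightarrow> real \<Rightarrow> real \<Rightarrow> real \<Rightarrow> bool" where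
  "regular_annulus F K \<eta> r \<longleftrightarrow> \<bar>zcount F r\<bar> \<le> K * ln r \<and>
     (\<forall>z. r * exp (- \<eta>) \<le> norm z \<longrightarrow> norm z \<le> r * exp \<eta> \<longrightarrow> zorder F z = 0 \<and>
       (F analytic_on {z} \<longrightarrow> F z \<noteq> 0 \<longrightarrow> norm (z * deriv F z / F z - of_int (zcount F r)) \<le> K))"

text \<open>With \<open>q = exp (- |ln |z| - ln |c||)\<close>, the term \<open>z / (z - c)\<close>
  differs by at most \<open>q / (1 - q)\<close> from 1 if \<open>c\<close> lies inside the circle
  and from 0 if it lies outside. The gap \<open>h\<close> keeps \<open>1 - q\<close> away from 0 and
  ensures that \<open>z\<close> and the circle lie on the same side of \<open>c\<close>.\<close>

lemma norm_log_deriv_term: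
  fixes z c :: complex
  assumes c: "c \<noteq> 0" and z: "z \<noteq> 0" and h: "h > 0" "\<bar>t - ln (norm c)\<bar> > h" "\<bar>ln (norm z) - t\<bar> \<le> h / 2"
  shows "norm (z / (z - c) - (if norm c < exp t then 1 else 0))
     \<le> (2 * exp (h/2) / (1 - exp (- h/2))) / (1 + (t - ln (norm c))^2)"
proof -
  define s x where "s = ln (norm z)" and "x = ln (norm c)"
  have nz: "norm z = exp s" and nc: "norm c = exp x" using c z by (simp_all add: s_def x_def)
  define q where "q = exp (- \<bar>s - x\<bar>)"
  have sx: "\<bar>s - x\<bar> \<ge> \<bar>t - x\<bar> - h / 2" using h(3) unfolding s_def x_def by linarith
  have q1: "q \<le> exp (- h / 2)" using sx h(2) unfolding q_def x_def by simp
  have q2: "q \<le> exp (h/2) * (2 / (1 + (t - x)^2))"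
  proof -
    have "q \<le> exp (h/2 + - \<bar>t - x\<bar>)" using sx by (simp add: q_def)
    also have "\<dots> = exp (h/2) * exp (- \<bar>t - x\<bar>)" by (rule exp_add)
    also have "\<dots> \<le> exp (h/2) * (2 / (1 + \<bar>t - x\<bar>^2))"
      by (intro mult_left_mono exp_minus_le_inverse_square) auto
    finally show ?thesis by simp
  qed
  have e1: "1 - exp (- h/2) > 0" using h by simp
  have qlt: "q < 1" using q1 e1 by linarith
  have lhs: "norm (z / (z - c) - (if norm c < exp t then 1 else 0)) \<le> q / (1 - q)"
  proof (cases "x < t")
    case True
    then have "x < s" using h sx unfolding s_def x_def by linarith
    then have q: "q = exp x / exp s" by (simp add: q_def flip: exp_diff)
    have zc: "z - c \<noteq> 0" using \<open>x < s\<close> nz nc by auto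
    have "z / (z - c) - (if norm c < exp t then 1 else 0) = c / (z - c)"
      using True nc zc by (simp add: field_simps)
    then have "norm (z / (z - c) - (if norm c < exp t then 1 else 0)) = exp x / norm (z - c)"
      using nc by (simp add: norm_divide)
    also have "\<dots> \<le> exp x / (exp s - exp x)"
      using norm_triangle_ineq2[of z c] nz nc \<open>x < s\<close> by (intro divide_left_mono) (auto intro!: mult_pos_pos)
    also have "\<dots> = q / (1 - q)" unfolding q using \<open>x < s\<close> by (simp add: field_simps)
    finally show ?thesis .
  next
    case False
    then have "s < x" using h sx unfolding s_def x_def by linarith
    then have q: "q = exp s / exp x" by (simp add: q_def flip: exp_diff)
    have "norm (z / (z - c) - (if norm c < exp t then 1 else 0)) = exp s / norm (z - c)"
      using False nc nz by (simp add: norm_divide)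
    also have "\<dots> \<le> exp s / (exp x - exp s)"
      using norm_triangle_ineq2[of c z] nz nc \<open>s < x\<close>
      by (intro divide_left_mono) (auto intro!: mult_pos_pos simp: norm_minus_commute)
    also have "\<dots> = q / (1 - q)" unfolding q using \<open>s < x\<close> by (simp add: field_simps)
    finally show ?thesis .
  qed
  also have "q / (1 - q) \<le> q / (1 - exp (- h/2))"
    using q1 e1 qlt by (intro divide_left_mono) (auto simp: q_def intro!: mult_pos_pos)
  also have "\<dots> \<le> exp (h/2) * (2 / (1 + (t - x)^2)) / (1 - exp (- h/2))"
    using q2 e1 by (intro divide_right_mono) auto
  finally show ?thesis by (simp add: x_def mult_ac)
qed

text \<open>The weights of \<open>O(L)\<close> zeros and poles are averaged over
  \<open>L < t < 2L\<close> in the coordinate \<open>log |z|\<close>. Summing the termwise estimate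
  replaces \<open>z F'/F\<close> by the number of zeros minus poles inside, up to a bounded
  error.\<close>

lemma regular_annuli_exist:
  assumes F: "nontriv_mero F" and C: "C \<ge> 0"
    and cnt: "\<And>R. R \<ge> R0 \<Longrightarrow> divisor_mass F R \<le> C * ln R"
    and ld: "\<And>R z. R \<ge> R0 \<Longrightarrow> norm z \<le> R / 2 \<Longrightarrow> F analytic_on {z} \<Longrightarrow> F z \<noteq> 0 \<Longrightarrow>
       log_deriv_error F R z \<le> C * (ln R)^2 / R"
  obtains K \<eta> where "K > 0" "0 < \<eta>" "\<eta> \<le> 1" "\<And>\<rho>. \<exists>r\<ge>\<rho>. regular_annulus F K \<eta> r"
proof -
  \<comment> \<open>The mass in the disc of radius \<open>exp (4L)\<close> is at most
    \<open>4 C L\<close>; the added 1 keeps \<open>A \<ge> 4\<close>, hence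
    \<open>h \<le> 1\<close>.\<close>
  define A where "A = 4 * (C + 1)"
  have A: "A \<ge> 4" using C by (simp add: A_def)
  define B where "B = 8 * pi * A"
  define h where "h = 1 / (4 * pi * A)"
  have h: "0 < h" "h \<le> 1"
  proof -
    have "1 \<le> pi * A" using pi_ge_two A mult_mono[of 1 pi 1 A] by simp
    then show "0 < h" "h \<le> 1" using A by (simp_all add: h_def)
  qed
  define G where "G = 2 * exp (h/2) / (1 - exp (- h/2))"
  have G: "G > 0" using h by (simp add: G_def)
  have B: "B > 0" using A by (simp add: B_def)
  \<comment> \<open>The three terms bound the averaged kernel sum, the error of the logarithmic
    derivative, and \<open>zcount F r / ln r\<close>.\<close>
  define K where "K = G * (B / 2) + 32 * C + 4 * C"
  have "G * (B / 2) > 0" using G B by simp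
  then have K: "K > 0" "4 * C \<le> K" unfolding K_def using C by linarith+
  have "\<exists>r\<ge>\<rho>0. regular_annulus F K (h/2) r" for \<rho>0
  proof -
    define \<rho> where "\<rho> = max (max 3 \<rho>0) R0"
    have \<rho>: "\<rho> \<ge> 3" "\<rho> \<ge> \<rho>0" "\<rho> \<ge> R0" by (auto simp: \<rho>_def)
    define L where "L = ln \<rho>"
    have L: "L > 0" using \<rho> by (simp add: L_def)
    have eL: "exp L = \<rho>" using \<rho> by (simp add: L_def)
    \<comment> \<open>Since \<open>r \<le> \<rho>^2\<close>, the annulus lies in
      \<open>|z| \<le> \<rho>^3\<close>, so \<open>|z| / R \<le> 1 / \<rho>\<close> absorbs the
      factor \<open>(ln R)^2 = 16 L^2\<close> of the error.\<close>
    define R where "R = \<rho>^4"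
    have R: "R \<ge> \<rho>" using \<rho> by (simp add: R_def self_le_power)
    have lnR: "ln R = 4 * L" using \<rho> by (simp add: R_def L_def ln_realpow)
    define Pt where "Pt = divisor_in F R"
    have finPt: "finite Pt" unfolding Pt_def by (rule finite_zorder_cball[OF F])
    define w where "w = (\<lambda>c. \<bar>real_of_int (zorder F c)\<bar>)"
    have sumw: "(\<Sum>c\<in>Pt. w c) \<le> 4 * C * L"
      using cnt[of R] R \<rho> lnR by (simp add: Pt_def w_def)
    \<comment> \<open>The origin has no logarithmic coordinate. It can be set aside because its term
      \<open>z / (z - 0) - 1\<close> vanishes exactly.\<close>
    have "(\<Sum>c\<in>Pt - {0}. w c) \<le> (\<Sum>c\<in>Pt. w c)" by (rule sum_mono2) (auto simp: finPt w_def)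
    also have "\<dots> \<le> A * L" using sumw L by (simp add: A_def algebra_simps)
    finally have sumw0: "(\<Sum>c\<in>Pt - {0}. w c) \<le> A * L" .
    obtain t where t: "L < t" "t < 2 * L" and sep: "\<And>c. c \<in> Pt - {0} \<Longrightarrow> \<bar>t - ln (norm c)\<bar> > h"
      and sumt: "(\<Sum>c\<in>Pt - {0}. w c / (1 + (t - ln (norm c))^2)) < B / 2"
    proof (rule exists_separated_point[of "Pt - {0}" w A L "\<lambda>c. ln (norm c)"])
      fix c assume "c \<in> Pt - {0}"
      then show "1 \<le> w c" by (auto simp: Pt_def w_def)
    qed (use finPt A L sumw0 in \<open>auto simp: B_def h_def\<close>)
    define r where "r = exp t"
    have r: "r \<ge> \<rho>" "r \<le> \<rho>^2" "ln r = t"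
    proof -
      show "r \<ge> \<rho>" using t eL unfolding r_def by (metis exp_le_cancel_iff less_imp_le)
      have "exp t \<le> exp (2 * L)" using t by simp
      also have "\<dots> = \<rho>^2" using eL by (metis exp_double)
      finally show "r \<le> \<rho>^2" by (simp add: r_def)
    qed (simp add: r_def)
    have ball_sub: "{c \<in> ball 0 r. zorder F c \<noteq> 0} = {c\<in>Pt. norm c < r}"
    proof -
      have "\<rho>^2 \<le> R" unfolding R_def using \<rho> by (intro power_increasing) auto
      then show ?thesis using r by (auto simp: Pt_def)
    qed
    have zc: "zcount F r = (\<Sum>c\<in>Pt. if norm c < r then zorder F c else 0)"
      unfolding zcount_def ball_sub using finPt by (simp add: sum.If_cases Int_def)
    have "\<bar>real_of_int (zcount F r)\<bar> \<le> (\<Sum>c\<in>Pt. \<bar>real_of_int (if norm c < r then zorder F c else 0)\<bar>)"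
      unfolding zc of_int_sum by (rule sum_abs)
    also have "\<dots> \<le> (\<Sum>c\<in>Pt. w c)" by (rule sum_mono) (auto simp: w_def)
    also have "\<dots> \<le> 4 * C * t" using sumw mult_left_mono[of L t "4 * C"] t C by simp
    also have "\<dots> \<le> K * t" using t L K by (intro mult_right_mono) auto
    finally have zcb: "\<bar>real_of_int (zcount F r)\<bar> \<le> K * ln r" using r by simp
    have "zorder F z = 0 \<and> (F analytic_on {z} \<longrightarrow> F z \<noteq> 0 \<longrightarrow> norm (z * deriv F z / F z - of_int (zcount F r)) \<le> K)"
      if z: "r * exp (- (h/2)) \<le> norm z" "norm z \<le> r * exp (h/2)" for z
    proof -
      have rp: "r > 0" by (simp add: r_def)
      have zp: "norm z > 0" using z(1) rp by (meson exp_gt_zero less_le_trans mult_pos_pos)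
      have z0: "z \<noteq> 0" using zp by auto
      have lz: "\<bar>ln (norm z) - t\<bar> \<le> h / 2"
      proof -
        have "ln (r * exp (- (h/2))) \<le> ln (norm z)" using z(1) rp zp by (subst ln_le_cancel_iff) auto
        moreover have "ln (norm z) \<le> ln (r * exp (h/2))" using z(2) rp zp by (subst ln_le_cancel_iff) auto
        ultimately have "t - h / 2 \<le> ln (norm z)" "ln (norm z) \<le> t + h / 2"
          using rp by (simp_all add: ln_mult r_def)
        then show ?thesis by linarith
      qed
      have z3: "norm z \<le> \<rho>^3"
      proof -
        have "exp (h/2) \<le> exp 1" using h by simp
        also have "\<dots> \<le> \<rho>" using exp_le \<rho> by linarith
        finally have "r * exp (h/2) \<le> \<rho>^2 * \<rho>" using r \<rho> by (intro mult_mono) auto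
        then show ?thesis using z(2) by (simp add: power3_eq_cube power2_eq_square)
      qed
      have R3: "R = \<rho>^3 * \<rho>" by (simp add: R_def power4_eq_xxxx power3_eq_cube)
      have zR: "norm z \<le> R / 2"
      proof -
        have "\<rho>^3 * 2 \<le> \<rho>^3 * \<rho>" using \<rho> by (intro mult_left_mono) auto
        then show ?thesis using z3 R3 by linarith
      qed
      have zPt: "z \<notin> Pt"
      proof
        assume "z \<in> Pt"
        then have "\<bar>t - ln (norm z)\<bar> > h" using sep[of z] z0 by simp
        then show False using lz h by linarith
      qed
      moreover have "z \<in> cball 0 R" using zR R \<rho> by simp
      ultimately have zo: "zorder F z = 0" by (simp add: Pt_def)
      have "norm (z * deriv F z / F z - of_int (zcount F r)) \<le> K" if an: "F analytic_on {z}" "F z \<noteq> 0"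
      proof -
        let ?S = "\<Sum>c\<in>Pt. of_int (zorder F c) / (z - c)"
        have 1: "norm (z * (deriv F z / F z - ?S)) \<le> 32 * C"
        proof -
          have "norm (z * (deriv F z / F z - ?S)) \<le> \<rho>^3 * (C * (ln R)^2 / R)"
            unfolding norm_mult Pt_def using R \<rho> by (intro mult_mono z3 ld zR an) auto
          also have "\<dots> = 16 * C * L^2 / \<rho>" using \<rho> by (simp add: R3 lnR[unfolded R3] power_mult_distrib)
          also have "\<dots> \<le> 32 * C"
          proof -
            have "L^2 \<le> 2 * \<rho>" using exp_lower_Taylor_quadratic[of L] L eL by simp
            then have "16 * C * L^2 \<le> 16 * C * (2 * \<rho>)" using C by (intro mult_left_mono) auto
            then show ?thesis using \<rho> by (simp add: divide_le_eq)
          qed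
          finally show ?thesis .
        qed
        have "z * ?S - of_int (zcount F r) = (\<Sum>c\<in>Pt. of_int (zorder F c) * (z / (z - c) - (if norm c < r then 1 else 0)))"
          unfolding zc of_int_sum sum_distrib_left sum_subtractf[symmetric]
          by (intro sum.cong) (auto simp: algebra_simps)
        also have "\<dots> = (\<Sum>c\<in>Pt - {0}. of_int (zorder F c) * (z / (z - c) - (if norm c < r then 1 else 0)))"
          by (rule sum.mono_neutral_right) (use finPt z0 rp in auto)
        finally have "norm (z * ?S - of_int (zcount F r)) \<le> (\<Sum>c\<in>Pt - {0}. norm (of_int (zorder F c) * (z / (z - c) - (if norm c < r then 1 else 0))))"
          using norm_sum by simp
        also have "\<dots> \<le> (\<Sum>c\<in>Pt - {0}. G * (w c / (1 + (t - ln (norm c))^2)))"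
        proof (rule sum_mono)
          fix c assume c: "c \<in> Pt - {0}"
          have "norm (z / (z - c) - (if norm c < r then 1 else 0)) \<le> G / (1 + (t - ln (norm c))^2)"
            unfolding G_def r_def by (rule norm_log_deriv_term) (use c z0 h sep[OF c] lz in auto)
          then have "w c * norm (z / (z - c) - (if norm c < r then 1 else 0)) \<le> w c * (G / (1 + (t - ln (norm c))^2))"
            by (intro mult_left_mono) (auto simp: w_def)
          then show "norm (of_int (zorder F c) * (z / (z - c) - (if norm c < r then 1 else 0))) \<le> G * (w c / (1 + (t - ln (norm c))^2))"
            by (simp add: norm_mult w_def mult_ac)
        qed
        also have "\<dots> \<le> G * (B / 2)"
          unfolding sum_distrib_left[symmetric] using sumt G by (intro mult_left_mono) auto
        finally have 2: "norm (z * ?S - of_int (zcount F r)) \<le> G * (B / 2)" .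
        have eq: "z * deriv F z / F z - of_int (zcount F r) = z * (deriv F z / F z - ?S) + (z * ?S - of_int (zcount F r))"
          by (simp add: algebra_simps)
        have "norm (z * deriv F z / F z - of_int (zcount F r)) \<le> 32 * C + G * (B / 2)"
          unfolding eq by (rule norm_triangle_mono[OF 1 2])
        then show ?thesis using C by (simp add: K_def)
      qed
      with zo show ?thesis by blast
    qed
    then have "regular_annulus F K (h/2) r" unfolding regular_annulus_def using zcb by simp
    then show ?thesis using r \<rho> by (intro exI[of _ r]) auto
  qed
  then show ?thesis using that[of K "h/2"] K h by auto
qed

section \<open>Behaviour of the function on a regular annulus\<close>

lemma regular_annulus_derivD:
  assumes f: "f nicely_meromorphic_on UNIV" and F: "nontriv_mero (deriv f)"
    and reg: "regular_annulus (deriv f) K \<eta> r"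
    and z: "r * exp (- \<eta>) \<le> norm z" "norm z \<le> r * exp \<eta>"
  shows "f analytic_on {z}" "deriv f z \<noteq> 0"
    "norm (z * deriv (deriv f) z / deriv f z - of_int (zcount (deriv f) r)) \<le> K"
proof -
  have mero: "f meromorphic_on {z}" using f by (auto simp: nicely_meromorphic_on_def intro: meromorphic_on_subset)
  have zo: "zorder (deriv f) z = 0" using reg z by (auto simp: regular_annulus_def)
  then have "\<not> is_pole (deriv f) z" using nontriv_zorder_neg_iff[OF F, of z] by auto
  then have "\<not> is_pole f z" using is_pole_deriv_iff[OF mero] by blast
  then show an: "f analytic_on {z}" using nicely_meromorphic_on_imp_analytic_at[OF f] by auto
  then have an': "deriv f analytic_on {z}" by (rule analytic_deriv)
  from zorder_eq_0_iff[OF this nontriv_mero_freq[OF F]] show "deriv f z \<noteq> 0" using zo by simp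
  with an' show "norm (z * deriv (deriv f) z / deriv f z - of_int (zcount (deriv f) r)) \<le> K"
    using reg z by (auto simp: regular_annulus_def)
qed

text \<open>A logarithm of \<open>f'\<close> varies by at most 1/4 on the unit disc about
  \<open>z\<close>, so \<open>f'/f'(z)\<close> stays within 1/2 of 1 there. Integrating from
  \<open>z\<close> to \<open>z + 1\<close> preserves the bound.\<close>

lemma difference_near_deriv:
  fixes f :: "complex \<Rightarrow> complex"
  assumes an: "f analytic_on ball z 2" and nz: "\<And>w. w \<in> ball z 2 \<Longrightarrow> deriv f w \<noteq> 0"
    and bd: "\<And>w. w \<in> ball z 2 \<Longrightarrow> norm (deriv (deriv f) w / deriv f w) \<le> 1 / 4"
  shows "norm ((f (z + 1) - f z) / deriv f z - 1) < 1"
proof -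
  have hol: "f holomorphic_on ball z 2" using an by (rule analytic_imp_holomorphic)
  have hol': "deriv f holomorphic_on ball z 2" by (rule holomorphic_deriv[OF hol]) auto
  obtain L where L: "L holomorphic_on ball z 2" "\<And>w. w \<in> ball z 2 \<Longrightarrow> exp (L w) = deriv f w"
    by (rule holomorphic_logarithm_exists[of "ball z 2" "deriv f" z]) (use hol' nz in auto)
  have dL: "norm (deriv L w) \<le> 1 / 4" if w: "w \<in> ball z 2" for w
  proof -
    have "(L has_field_derivative deriv L w) (at w)" using L(1) w holomorphic_derivI by blast
    then have "((\<lambda>x. exp (L x)) has_field_derivative exp (L w) * deriv L w) (at w)"
      by (auto intro!: derivative_eq_intros)
    then have "deriv (\<lambda>x. exp (L x)) w = exp (L w) * deriv L w" by (rule DERIV_imp_deriv)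
    moreover have "deriv (deriv f) w = deriv (\<lambda>x. exp (L x)) w"
      by (rule deriv_cong_ev) (use L(2) w in \<open>auto intro!: eventually_nhds_in_open[THEN eventually_mono, of "ball z 2"]\<close>)
    ultimately have "deriv (deriv f) w / deriv f w = deriv L w" using L(2)[OF w] nz[OF w] by simp
    then show ?thesis using bd[OF w] by simp
  qed
  have z2: "z \<in> ball z 2" by simp
  have near: "norm (deriv f w / deriv f z - 1) \<le> 1 / 2" if w: "w \<in> cball z 1" for w
  proof -
    have w2: "w \<in> ball z 2" using w by auto
    have "norm (L w - L z) \<le> 1 / 4 * norm (w - z)"
    proof (rule field_differentiable_bound[of "ball z 2" L "deriv L"])
      fix u assume "u \<in> ball z 2"
      then show "(L has_field_derivative deriv L u) (at u within ball z 2)"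
        using L(1) holomorphic_derivI by blast
    qed (use dL w2 in auto)
    also have "\<dots> \<le> 1 / 4" using w by (simp add: dist_norm norm_minus_commute)
    finally have d: "norm (L w - L z) \<le> 1 / 4" .
    have "deriv f w / deriv f z = exp (L w - L z)"
      using L(2)[OF w2] L(2)[OF z2] by (simp add: exp_diff)
    then have "norm (deriv f w / deriv f z - 1) \<le> 3 / 2 * norm (L w - L z)"
      using norm_exp_bounds(2)[of "L w - L z"] d by simp
    then show ?thesis using d by simp
  qed
  \<comment> \<open>Its derivative is \<open>f'/f'(z) - 1\<close>, and its increment over the unit
    step is exactly the quantity to be bounded.\<close>
  define k where "k = (\<lambda>u. f u / deriv f z - u)"
  have "norm (k (z + 1) - k z) \<le> 1 / 2 * norm (z + 1 - z)"
  proof (rule field_differentiable_bound[of "cball z 1" k "\<lambda>u. deriv f u / deriv f z - 1"])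
    fix u assume u: "u \<in> cball z 1"
    then have "(f has_field_derivative deriv f u) (at u)"
      using holomorphic_derivI[OF hol, of u] by simp
    then show "(k has_field_derivative deriv f u / deriv f z - 1) (at u within cball z 1)"
      unfolding k_def
      by (intro has_field_derivative_at_within[OF DERIV_diff[OF DERIV_cdivide DERIV_ident]])
    show "norm (deriv f u / deriv f z - 1) \<le> 1 / 2" by (rule near[OF u])
  qed (auto simp: dist_norm)
  moreover have "k (z + 1) - k z = (f (z + 1) - f z) / deriv f z - 1"
    by (simp add: k_def diff_divide_distrib)
  ultimately show ?thesis by simp
qed

text \<open>The first two size conditions place the discs of radius 2 about points of the circle
  inside the annulus; the third makes \<open>|f''/f'| \<le> 1/4\<close> on them. The quotient of the
  difference by \<open>f'\<close> is then close to 1 on the circle and has count 0.\<close>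

lemma zcount_difference_eq:
  assumes f: "f nicely_meromorphic_on UNIV" and F: "nontriv_mero (deriv f)"
    and g: "nontriv_mero (\<lambda>z. f (z + 1) - f z)"
    and reg: "regular_annulus (deriv f) K \<eta> r" and r: "r > 0" and K: "K > 0"
    and big: "r * (1 - exp (- \<eta>)) \<ge> 2" "r * (exp \<eta> - 1) \<ge> 2" "4 * (K * ln r + K) \<le> r * exp (- \<eta>)"
  shows "zcount (\<lambda>z. f (z + 1) - f z) r = zcount (deriv f) r"
proof -
  define M where "M = zcount (deriv f) r"
  have inn: "r * exp (- \<eta>) \<le> norm w" "norm w \<le> r * exp \<eta>" if z: "norm z = r" "w \<in> ball z 2" for z w
  proof -
    have "norm w \<ge> r - 2" "norm w \<le> r + 2"
      using z norm_triangle_ineq2[of z w] norm_triangle_ineq[of z "w - z"]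
      by (auto simp: dist_norm norm_minus_commute)
    then show "r * exp (- \<eta>) \<le> norm w" "norm w \<le> r * exp \<eta>" using big by (simp_all add: algebra_simps)
  qed
  note D = regular_annulus_derivD[OF f F reg]
  have key: "norm ((f (z + 1) - f z) / deriv f z - 1) < 1" if z: "norm z = r" for z
  proof (rule difference_near_deriv)
    show "f analytic_on ball z 2"
      by (subst analytic_on_analytic_at) (use D(1) inn[OF z] in blast)
    fix w assume w: "w \<in> ball z 2"
    note i = inn[OF z w]
    show "deriv f w \<noteq> 0" using D(2)[OF i] .
    have "norm (w * deriv (deriv f) w / deriv f w) \<le> K + norm (of_int M :: complex)"
      using D(3)[OF i] norm_triangle_sub[of "w * deriv (deriv f) w / deriv f w" "of_int M"]
      unfolding M_def by linarith
    also have "norm (of_int M :: complex) \<le> K * ln r"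
      using reg by (simp add: regular_annulus_def M_def)
    finally have 1: "norm w * norm (deriv (deriv f) w / deriv f w) \<le> K + K * ln r"
      by (simp add: norm_mult norm_divide)
    have "(r * exp (- \<eta>)) * norm (deriv (deriv f) w / deriv f w) \<le> norm w * norm (deriv (deriv f) w / deriv f w)"
      by (intro mult_right_mono i) auto
    also note 1
    also have "K + K * ln r \<le> (r * exp (- \<eta>)) * (1 / 4)" using big by simp
    finally show "norm (deriv (deriv f) w / deriv f w) \<le> 1 / 4"
      using r by (simp only: mult_le_cancel_left_pos mult_pos_pos exp_gt_zero)
  qed
  have an: "f analytic_on {w}" if "norm z = r" "w \<in> ball z 2" for z w
    using D(1) inn[OF that] by blast
  have "zcount (\<lambda>z. (f (z + 1) - f z) / deriv f z) r = 0"
  proof (rule zcount_eq_0_if_near_const[where c = 1])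
    show "nontriv_mero (\<lambda>z. (f (z + 1) - f z) / deriv f z)" by (intro nontriv_mero_divide g F)
    fix z :: complex assume z: "norm z = r"
    show "norm (1 * ((f (z + 1) - f z) / deriv f z) - 1) < 1" using key[OF z] by simp
    have 1: "f analytic_on {z}" "f analytic_on {z + 1}" by (rule an[OF z]; simp add: dist_norm)+
    have "f \<circ> (\<lambda>w. w + 1) analytic_on {z}"
      by (rule analytic_on_compose) (use 1 in \<open>auto intro!: analytic_intros\<close>)
    then have 2: "(\<lambda>w. f (w + 1)) analytic_on {z}" by (simp add: o_def)
    have "deriv f z \<noteq> 0" using D(2) inn[OF z, of z] by simp
    then show "(\<lambda>z. (f (z + 1) - f z) / deriv f z) analytic_on {z}"
      using 1(1) 2 by (intro analytic_intros) auto
  qed (rule r)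
  then show ?thesis using zcount_divide[OF g F, of r] by simp
qed

text \<open>In logarithmic coordinates \<open>z = exp \<zeta>\<close> put \<open>H = f - z f'/(M+1)\<close>; then \<open>H' = - z f' \<psi>/(M+1)\<close> with
  \<open>\<psi>\<close> bounded. To compare \<open>H\<close> on the circle with a single value, move outwards by \<open>\<delta>\<close> first: there
  \<open>f'\<close> has decayed by a factor of about \<open>exp (M \<delta>)\<close>, which makes moving around the circle cheap.\<close>
lemma near_constant_if_steep:
  fixes f :: "complex \<Rightarrow> complex" and M :: int
  assumes r: "r > 0" and \<eta>: "\<eta> > 0" and K: "K > 0"
    and an: "\<And>z. r * exp (- \<eta>) \<le> norm z \<Longrightarrow> norm z \<le> r * exp \<eta> \<Longrightarrow> f analytic_on {z}"
    and nz: "\<And>z. r * exp (- \<eta>) \<le> norm z \<Longrightarrow> norm z \<le> r * exp \<eta> \<Longrightarrow> deriv f z \<noteq> 0"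
    and ld: "\<And>z. r * exp (- \<eta>) \<le> norm z \<Longrightarrow> norm z \<le> r * exp \<eta> \<Longrightarrow>
       norm (z * deriv (deriv f) z / deriv f z - of_int M) \<le> K"
    and \<delta>: "0 < \<delta>" "\<delta> < \<eta>" "\<delta> * K \<le> 1 / 4"
    and M: "real_of_int M + 1 + K \<le> - (K * pi + ln (4 * pi * K + 1)) / \<delta>"
  obtains \<alpha> where "\<And>z. norm z = r \<Longrightarrow> norm (of_int (M + 1) * ((f z - \<alpha>) / (z * deriv f z)) - 1) < 1"
proof -
  \<comment> \<open>The exponent of \<open>z f'\<close>, whose logarithmic derivative in the
    coordinate \<open>\<zeta>\<close> is \<open>N + \<psi>\<close>.\<close>
  define N where "N = real_of_int M + 1"
  have lnK: "ln (4 * pi * K + 1) \<ge> 0" using K by simp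
  have "K * pi \<ge> 0" using K by simp
  then have "- (K * pi + ln (4 * pi * K + 1)) \<le> 0" using lnK by linarith
  then have "- (K * pi + ln (4 * pi * K + 1)) / \<delta> \<le> 0" using \<delta>(1) by (rule divide_nonpos_pos)
  then have NK: "N + K \<le> 0" using M unfolding N_def by linarith
  then have N: "N < 0" using K by linarith
  \<comment> \<open>A strip that \<open>exp\<close> maps into the annulus. It is convex, so
    logarithms exist on it and derivative bounds give Lipschitz bounds.\<close>
  define T where "T = {\<zeta>. \<bar>Re \<zeta> - ln r\<bar> < \<eta>}"
  have Teq: "T = {\<zeta>. Re \<zeta> < ln r + \<eta>} \<inter> {\<zeta>. Re \<zeta> > ln r - \<eta>}" by (auto simp: T_def)
  have T: "open T" "convex T"
    unfolding Teq by (auto intro!: open_Int convex_Int open_halfspace_Re_lt open_halfspace_Re_gt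
      convex_halfspace_Re_lt convex_halfspace_Re_gt)
  have inn: "r * exp (- \<eta>) \<le> norm (exp \<zeta>)" "norm (exp \<zeta>) \<le> r * exp \<eta>" if "\<zeta> \<in> T" for \<zeta>
  proof -
    have "r * exp (- \<eta>) = exp (ln r - \<eta>)" "r * exp \<eta> = exp (ln r + \<eta>)"
      using r by (simp_all add: exp_add exp_diff exp_minus field_simps)
    then show "r * exp (- \<eta>) \<le> norm (exp \<zeta>)" "norm (exp \<zeta>) \<le> r * exp \<eta>"
      using that by (auto simp: T_def)
  qed
  define \<phi> where "\<phi> = (\<lambda>\<zeta>. f (exp \<zeta>))"
  define D where "D = (\<lambda>\<zeta>. exp \<zeta> * deriv f (exp \<zeta>))"
  define \<psi> where "\<psi> = (\<lambda>\<zeta>. exp \<zeta> * deriv (deriv f) (exp \<zeta>) / deriv f (exp \<zeta>) - of_int M)"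
  have Dnz: "D \<zeta> \<noteq> 0" if "\<zeta> \<in> T" for \<zeta> using nz[OF inn[OF that]] by (simp add: D_def)
  have d\<phi>: "(\<phi> has_field_derivative D \<zeta>) (at \<zeta>)" if "\<zeta> \<in> T" for \<zeta>
  proof -
    have "(f has_field_derivative deriv f (exp \<zeta>)) (at (exp \<zeta>))"
      by (rule analytic_at_imp_DERIV[OF an[OF inn[OF that]]])
    from DERIV_chain2[OF this DERIV_exp] show ?thesis by (simp add: \<phi>_def D_def mult.commute)
  qed
  have dD: "(D has_field_derivative D \<zeta> * (of_real N + \<psi> \<zeta>)) (at \<zeta>)" if "\<zeta> \<in> T" for \<zeta>
  proof -
    have "deriv f analytic_on {exp \<zeta>}" by (rule analytic_deriv[OF an[OF inn[OF that]]])
    then have "(deriv f has_field_derivative deriv (deriv f) (exp \<zeta>)) (at (exp \<zeta>))"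
      by (rule analytic_at_imp_DERIV)
    from DERIV_chain2[OF this DERIV_exp]
    have "(D has_field_derivative exp \<zeta> * deriv f (exp \<zeta>) + (deriv (deriv f) (exp \<zeta>) * exp \<zeta>) * exp \<zeta>) (at \<zeta>)"
      unfolding D_def by (auto intro!: derivative_eq_intros)
    moreover have "exp \<zeta> * deriv f (exp \<zeta>) + (deriv (deriv f) (exp \<zeta>) * exp \<zeta>) * exp \<zeta> = D \<zeta> * (of_real N + \<psi> \<zeta>)"
      using Dnz[OF that] by (simp add: D_def N_def \<psi>_def field_simps)
    ultimately show ?thesis by simp
  qed
  have \<psi>: "norm (\<psi> \<zeta>) \<le> K" if "\<zeta> \<in> T" for \<zeta> unfolding \<psi>_def by (rule ld[OF inn[OF that]])
  obtain z1 where z1: "z1 \<in> T" using \<eta> by (auto simp: T_def intro: that[of "of_real (ln r)"])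
  have Dhol: "D holomorphic_on T" using dD T holomorphic_on_open by blast
  obtain \<Lambda> where \<Lambda>: "\<Lambda> holomorphic_on T" "\<And>\<zeta>. \<zeta> \<in> T \<Longrightarrow> exp (\<Lambda> \<zeta>) = D \<zeta>"
    by (rule holomorphic_logarithm_exists[OF T(2,1) Dhol Dnz z1]) auto
  \<comment> \<open>Removing the linear part from the logarithm of \<open>D\<close> leaves a
    function with derivative \<open>\<psi>\<close>, hence \<open>K\<close>-Lipschitz.\<close>
  define Y where "Y = (\<lambda>\<zeta>. \<Lambda> \<zeta> - of_real N * \<zeta>)"
  have dY: "(Y has_field_derivative \<psi> \<zeta>) (at \<zeta>)" if \<zeta>: "\<zeta> \<in> T" for \<zeta>
  proof -
    have dL: "(\<Lambda> has_field_derivative deriv \<Lambda> \<zeta>) (at \<zeta>)" using \<Lambda>(1) T \<zeta> holomorphic_derivI by blast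
    then have "((\<lambda>x. exp (\<Lambda> x)) has_field_derivative exp (\<Lambda> \<zeta>) * deriv \<Lambda> \<zeta>) (at \<zeta>)"
      by (auto intro!: derivative_eq_intros)
    then have "(D has_field_derivative D \<zeta> * deriv \<Lambda> \<zeta>) (at \<zeta>)"
      using \<Lambda>(2) \<zeta> T by (auto intro: has_field_derivative_transform_within_open)
    from DERIV_unique[OF this dD[OF \<zeta>]] have "deriv \<Lambda> \<zeta> = of_real N + \<psi> \<zeta>" using Dnz[OF \<zeta>] by simp
    then show ?thesis unfolding Y_def using dL by (auto intro!: derivative_eq_intros)
  qed
  have Ylip: "norm (Y u - Y v) \<le> K * norm (u - v)" if "u \<in> T" "v \<in> T" for u v
    by (rule field_differentiable_bound[OF T(2), of Y \<psi>])
       (use dY \<psi> that in \<open>auto intro: has_field_derivative_at_within\<close>)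
  have Dgrow: "norm (D v) \<le> norm (D u) * exp (N * (Re v - Re u) + K * norm (v - u))" if "u \<in> T" "v \<in> T" for u v
  proof -
    have e: "norm (D w) = exp (Re (Y w) + N * Re w)" if "w \<in> T" for w
      using \<Lambda>(2)[OF that] norm_exp_eq_Re[of "\<Lambda> w"] by (simp add: Y_def)
    have "Re (Y v) - Re (Y u) \<le> K * norm (v - u)"
      using Ylip[OF that(2,1)] complex_Re_le_cmod[of "Y v - Y u"] by simp
    then have "Re (Y v) + N * Re v \<le> (Re (Y u) + N * Re u) + (N * (Re v - Re u) + K * norm (v - u))"
      by (simp add: algebra_simps)
    then show ?thesis unfolding e[OF that(1)] e[OF that(2)] exp_add[symmetric] exp_le_cancel_iff by simp
  qed
  define H where "H = (\<lambda>\<zeta>. \<phi> \<zeta> - D \<zeta> / of_real N)"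
  have dH: "(H has_field_derivative - (D \<zeta> * \<psi> \<zeta> / of_real N)) (at \<zeta>)" if "\<zeta> \<in> T" for \<zeta>
  proof -
    have "(H has_field_derivative D \<zeta> - (D \<zeta> * (of_real N + \<psi> \<zeta>)) / of_real N) (at \<zeta>)"
      unfolding H_def using d\<phi>[OF that] dD[OF that] N by (auto intro!: derivative_eq_intros)
    moreover have "D \<zeta> - (D \<zeta> * (of_real N + \<psi> \<zeta>)) / of_real N = - (D \<zeta> * \<psi> \<zeta> / of_real N)"
      using N by (simp add: field_simps)
    ultimately show ?thesis by simp
  qed
  have Hseg: "norm (H u - H v) \<le> (b * K / \<bar>N\<bar>) * norm (u - v)"
    if uv: "u \<in> T" "v \<in> T" and b: "\<And>w. w \<in> closed_segment u v \<Longrightarrow> norm (D w) \<le> b" for u v b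
  proof (rule field_differentiable_bound[of "closed_segment u v" H "\<lambda>\<zeta>. - (D \<zeta> * \<psi> \<zeta> / of_real N)"])
    fix w assume w: "w \<in> closed_segment u v"
    then have wT: "w \<in> T" using closed_segment_subset[OF uv T(2)] by auto
    show "(H has_field_derivative - (D w * \<psi> w / of_real N)) (at w within closed_segment u v)"
      using dH[OF wT] by (rule has_field_derivative_at_within)
    have "norm (D w) * norm (\<psi> w) \<le> b * K"
      using b[OF w] \<psi>[OF wT] norm_ge_zero[of "D w"] by (intro mult_mono) (auto intro: order_trans[OF norm_ge_zero])
    then show "norm (- (D w * \<psi> w / of_real N)) \<le> b * K / \<bar>N\<bar>"
      by (simp add: norm_mult norm_divide divide_right_mono)
  qed auto
  \<comment> \<open>The common reference point on the outer circle. Every \<open>u = Ln z\<close>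
    reaches it by a horizontal segment of length \<open>\<delta>\<close> and a vertical one of
    length at most \<open>pi\<close>.\<close>
  define \<zeta>2 where "\<zeta>2 = complex_of_real (ln r + \<delta>)"
  have key: "norm (f z - H \<zeta>2 - z * deriv f z / of_real N) < norm (z * deriv f z) / \<bar>N\<bar>" if z: "norm z = r" for z
  proof -
    have z0: "z \<noteq> 0" using z r by auto
    define u where "u = Ln z"
    have u: "exp u = z" "Re u = ln r" "\<bar>Im u\<bar> \<le> pi"
      using z0 z mpi_less_Im_Ln[of z] Im_Ln_le_pi[of z] by (auto simp: u_def)
    define v where "v = u + of_real \<delta>"
    have mem: "u \<in> T" "v \<in> T" "\<zeta>2 \<in> T" using u \<eta> \<delta> by (auto simp: T_def v_def \<zeta>2_def)
    define d where "d = norm (D u)"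
    have d: "d > 0" using Dnz[OF mem(1)] by (simp add: d_def)
    have 1: "norm (H u - H v) \<le> d * K / \<bar>N\<bar> * \<delta>"
    proof -
      have "norm (H u - H v) \<le> (d * K / \<bar>N\<bar>) * norm (u - v)"
      proof (rule Hseg[OF mem(1,2)])
        fix w assume w: "w \<in> closed_segment u v"
        then obtain s where s: "0 \<le> s" "s \<le> 1" "w = (1 - s) *\<^sub>R u + s *\<^sub>R v"
          by (auto simp: closed_segment_def)
        then have wu: "w - u = of_real (s * \<delta>)" by (simp add: v_def scaleR_conv_of_real algebra_simps)
        have "w \<in> T" using closed_segment_subset[OF mem(1,2) T(2)] w by auto
        then have "norm (D w) \<le> d * exp (N * (Re w - Re u) + K * norm (w - u))"
          unfolding d_def by (rule Dgrow[OF mem(1)])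
        also have "N * (Re w - Re u) + K * norm (w - u) = (N + K) * (s * \<delta>)"
        proof -
          have "Re w - Re u = s * \<delta>" using wu by (metis Re_complex_of_real minus_complex.simps(1))
          moreover have "norm (w - u) = s * \<delta>" unfolding wu using s \<delta> by (simp only: norm_of_real abs_of_nonneg mult_nonneg_nonneg less_imp_le)
          ultimately show ?thesis by (simp add: algebra_simps)
        qed
        also have "(N + K) * (s * \<delta>) \<le> 0" using NK s \<delta> by (intro mult_nonpos_nonneg) auto
        then have "d * exp ((N + K) * (s * \<delta>)) \<le> d * 1" using d by (intro mult_left_mono) auto
        finally show "norm (D w) \<le> d" by simp
      qed
      then show ?thesis using \<delta> by (simp add: v_def)
    qed
    \<comment> \<open>Bounds \<open>|D|\<close> on the vertical segment relative to
      \<open>|D u|\<close>. The hypothesis on \<open>M\<close> makes it at most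
      \<open>1 / (4 pi K + 1)\<close>, so both segments together cost at most
      \<open>1/4 + 1/4\<close>.\<close>
    define E where "E = exp ((N + K) * \<delta> + K * pi)"
    have 2: "norm (H v - H \<zeta>2) \<le> d * E * K / \<bar>N\<bar> * pi"
    proof -
      have vz: "v - \<zeta>2 = \<i> * of_real (Im u)" using u by (simp add: v_def \<zeta>2_def complex_eq_iff)
      have "norm (H v - H \<zeta>2) \<le> (d * E * K / \<bar>N\<bar>) * norm (v - \<zeta>2)"
      proof (rule Hseg[OF mem(2,3)])
        fix w assume w: "w \<in> closed_segment v \<zeta>2"
        have wT: "w \<in> T" using closed_segment_subset[OF mem(2,3) T(2)] w by auto
        from w obtain s where s: "0 \<le> s" "s \<le> 1" "w = (1 - s) *\<^sub>R v + s *\<^sub>R \<zeta>2"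
          by (auto simp: closed_segment_def)
        then have "w - u = of_real \<delta> - of_real s * (v - \<zeta>2)"
          by (simp add: v_def scaleR_conv_of_real algebra_simps)
        then have wu: "w - u = of_real \<delta> - of_real s * (\<i> * of_real (Im u))" unfolding vz .
        have Re: "Re w - Re u = \<delta>" using arg_cong[OF wu, of Re] by simp
        have "norm (w - u) \<le> \<delta> + s * \<bar>Im u\<bar>"
          unfolding wu using norm_triangle_ineq4[of "of_real \<delta>" "of_real s * (\<i> * of_real (Im u))"] s \<delta>
          by (simp add: norm_mult)
        also have "s * \<bar>Im u\<bar> \<le> 1 * pi" using s u by (intro mult_mono) auto
        finally have nwu: "norm (w - u) \<le> \<delta> + pi" by simp
        have "norm (D w) \<le> d * exp (N * (Re w - Re u) + K * norm (w - u))"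
          unfolding d_def by (rule Dgrow[OF mem(1) wT])
        also have "\<dots> \<le> d * E" unfolding E_def Re
        proof (intro mult_left_mono)
          have "K * norm (w - u) \<le> K * (\<delta> + pi)" using nwu K by (intro mult_left_mono) auto
          then show "exp (N * \<delta> + K * norm (w - u)) \<le> exp ((N + K) * \<delta> + K * pi)"
            by (simp add: algebra_simps)
        qed (use d in auto)
        finally show "norm (D w) \<le> d * E" .
      qed
      also have "\<dots> \<le> (d * E * K / \<bar>N\<bar>) * pi"
      proof (rule mult_left_mono)
        show "norm (v - \<zeta>2) \<le> pi" unfolding vz using u by (simp add: norm_mult)
      qed (use d K in \<open>simp add: E_def\<close>)
      finally show ?thesis .
    qed
    have E4: "E * K * pi \<le> 1 / 4"
    proof -
      have "(N + K) * \<delta> \<le> - (K * pi + ln (4 * pi * K + 1))"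
        using M \<delta> by (simp add: N_def pos_le_divide_eq)
      then have "E \<le> exp (- ln (4 * pi * K + 1))" by (simp add: E_def)
      also have "\<dots> = 1 / (4 * pi * K + 1)" using K by (simp add: exp_minus add_pos_pos inverse_eq_divide)
      finally have "E * (K * pi) \<le> 1 / (4 * pi * K + 1) * (K * pi)" using K by (intro mult_right_mono) auto
      also have "\<dots> \<le> 1 / 4" using K by (simp add: field_simps add_pos_pos)
      finally show ?thesis by (simp add: mult.assoc)
    qed
    have "norm (H u - H \<zeta>2) \<le> d * K / \<bar>N\<bar> * \<delta> + d * E * K / \<bar>N\<bar> * pi"
      using 1 2 norm_triangle_ineq[of "H u - H v" "H v - H \<zeta>2"] by simp
    also have "\<dots> = d / \<bar>N\<bar> * (\<delta> * K + E * K * pi)" by (simp add: algebra_simps add_divide_distrib)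
    also have "\<dots> \<le> d / \<bar>N\<bar> * (1 / 4 + 1 / 4)"
      using d \<delta> E4 by (intro mult_left_mono add_mono) auto
    also have "\<dots> < d / \<bar>N\<bar>" using d N by (simp add: field_simps)
    finally have "norm (H u - H \<zeta>2) < d / \<bar>N\<bar>" .
    moreover have "H u - H \<zeta>2 = f z - H \<zeta>2 - z * deriv f z / of_real N"
      by (simp add: H_def \<phi>_def D_def u)
    moreover have "d = norm (z * deriv f z)" by (simp add: d_def D_def u)
    ultimately show ?thesis by simp
  qed
  show ?thesis
  proof (rule that[of "H \<zeta>2"])
    fix z :: complex assume z: "norm z = r"
    have "r * exp (- \<eta>) \<le> norm z" "norm z \<le> r * exp \<eta>" using z r \<eta> by simp_all
    then have w: "z * deriv f z \<noteq> 0" using nz z r by auto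
    define w where "w = z * deriv f z"
    have w0: "w \<noteq> 0" using w by (simp add: w_def)
    have k: "norm (f z - H \<zeta>2 - w / of_real N) < norm w / \<bar>N\<bar>" using key[OF z] by (simp add: w_def)
    have eq: "of_int (M + 1) * ((f z - H \<zeta>2) / w) - 1 = (of_real N / w) * (f z - H \<zeta>2 - w / of_real N)"
    proof -
      have "of_int (M + 1) = complex_of_real N" by (simp add: N_def)
      moreover have "n * (x / w) - 1 = (n / w) * (x - w / n)" if "n \<noteq> 0" for n x :: complex
        using w0 that by (simp add: field_simps)
      ultimately show ?thesis using N by simp
    qed
    have "norm (of_int (M + 1) * ((f z - H \<zeta>2) / w) - 1) = \<bar>N\<bar> / norm w * norm (f z - H \<zeta>2 - w / of_real N)"
      unfolding eq by (simp add: norm_mult norm_divide)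
    also have "\<dots> < \<bar>N\<bar> / norm w * (norm w / \<bar>N\<bar>)"
      by (rule mult_strict_left_mono[OF k], rule divide_pos_pos) (use w0 N in auto)
    also have "\<dots> = 1" using w0 N by simp
    finally show "norm (of_int (M + 1) * ((f z - H \<zeta>2) / (z * deriv f z)) - 1) < 1" by (simp add: w_def)
  qed
qed

section \<open>Rationality criteria and chains of poles\<close>

lemma eventually_log_bounds:
  fixes C :: real
  assumes "C \<ge> 0" "a \<ge> 0"
  shows "((\<lambda>R. C * (ln R)^2 / R) \<longlongrightarrow> 0) at_top"
    and "((\<lambda>R. (C * ln R + a) / R) \<longlongrightarrow> 0) at_top"
    and "((\<lambda>n. C * ln (a + real n) / real n) \<longlonglongrightarrow> 0)"
  by real_asymp+

text \<open>For large \<open>R\<close> the sum over the disc is the sum over the whole divisor,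
  while the error \<open>C (ln R)^2 / R\<close> tends to 0. The logarithmic derivative of the
  zero-free quotient \<open>U\<close> therefore vanishes, and \<open>U\<close> is constant.\<close>

lemma eq_prod_if_finite_zeros_poles:
  assumes F: "nontriv_mero F" and fin: "finite {z. zorder F z \<noteq> 0}" and C: "C \<ge> 0"
    and ld: "\<And>R z. R \<ge> R0 \<Longrightarrow> norm z \<le> R / 2 \<Longrightarrow> F analytic_on {z} \<Longrightarrow> F z \<noteq> 0 \<Longrightarrow>
       log_deriv_error F R z \<le> C * (ln R)^2 / R"
  obtains \<kappa> where "\<And>z. zorder F z = 0 \<Longrightarrow> F analytic_on {z} \<Longrightarrow>
     F z = \<kappa> * (\<Prod>c | zorder F c \<noteq> 0. (z - c) powi zorder F c)"
proof -
  define Z where "Z = {z. zorder F z \<noteq> 0}"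
  have finZ: "finite Z" using fin by (simp add: Z_def)
  define Q where "Q = (\<lambda>z. \<Prod>c\<in>Z. (z - c) powi zorder F c)"
  obtain U where U: "nontriv_mero U"
    "\<And>z. zorder F z = (if z \<in> Z then zorder F z else 0) \<Longrightarrow> U analytic_on {z} \<and> U z \<noteq> 0"
    "\<And>z. z \<notin> Z \<Longrightarrow> F analytic_on {z} \<Longrightarrow> F z = U z * (\<Prod>c\<in>Z. (z - c) powi zorder F c)"
    by (rule zero_free_factorization[OF F finZ, of "zorder F"]) blast
  have Uan: "U analytic_on {z}" and Unz: "U z \<noteq> 0" for z using U(2)[of z] by (auto simp: Z_def)
  obtain b where b: "\<And>c. c \<in> Z \<Longrightarrow> norm c \<le> b"
    using finite_imp_bounded[OF finZ] by (auto simp: bounded_iff)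
  have Ud0: "deriv U z = 0" if z: "z \<notin> Z" "F analytic_on {z}" "F z \<noteq> 0" for z
  proof -
    obtain e where e: "e > 0" "F holomorphic_on ball z e" using z(2) unfolding analytic_on_def by auto
    have "\<forall>\<^sub>F x in nhds z. x \<in> ball z e - Z"
      using e z finZ by (intro eventually_nhds_in_open) (auto intro: open_Diff finite_imp_closed)
    then have ev: "\<forall>\<^sub>F x in nhds z. F x = U x * Q x"
    proof eventually_elim
      case (elim x)
      then have "F analytic_on {x}" using e by (meson DiffD1 analytic_at open_ball)
      then show ?case using U(3)[of x] elim by (simp add: Q_def)
    qed
    have Qz: "Q z \<noteq> 0" using finZ z by (auto simp: Q_def)
    have "(U has_field_derivative deriv U z) (at z)"
      by (rule analytic_at_imp_DERIV[OF Uan[of z]])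
    moreover have "(Q has_field_derivative Q z * (\<Sum>c\<in>Z. of_int (zorder F c) / (z - c))) (at z)"
      unfolding Q_def by (rule has_field_derivative_prod_linear_powi[OF z(1)])
    ultimately have "((\<lambda>x. U x * Q x) has_field_derivative
       deriv U z * Q z + U z * (Q z * (\<Sum>c\<in>Z. of_int (zorder F c) / (z - c)))) (at z)"
      by (auto intro!: derivative_eq_intros)
    then have "deriv F z = deriv U z * Q z + U z * (Q z * (\<Sum>c\<in>Z. of_int (zorder F c) / (z - c)))"
      using deriv_cong_ev[OF ev refl] DERIV_imp_deriv by metis
    moreover have "F z = U z * Q z" using ev by (rule eventually_nhds_x_imp_x)
    ultimately have eq: "deriv F z / F z - (\<Sum>c\<in>Z. of_int (zorder F c) / (z - c)) = deriv U z / U z"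
      using Qz Unz by (simp add: field_simps)
    have "\<forall>\<^sub>F R in at_top. norm (deriv U z / U z) \<le> C * (ln R)^2 / R"
      using eventually_ge_at_top[of R0] eventually_ge_at_top[of b] eventually_ge_at_top[of "2 * norm z"]
    proof eventually_elim
      case (elim R)
      then have "divisor_in F R = Z" using b by (fastforce simp: Z_def)
      then show ?case using ld[of R z] elim z eq by simp
    qed
    then have "norm (deriv U z / U z) \<le> 0"
      by (rule tendsto_lowerbound[OF eventually_log_bounds(1)[OF C order_refl]]) auto
    then show ?thesis using Unz by simp
  qed
  have Ud: "deriv U z = 0" for z
  proof (rule eq_at_if_eventually_eq[where h = "deriv U" and k = "\<lambda>_. 0"])
    show "isCont (deriv U) z" using analytic_deriv[OF Uan] analytic_at_imp_isCont by blast
    have "\<forall>\<^sub>F w in at z. w \<notin> Z" using islimpt_finite[OF finZ, of z] unfolding islimpt_iff_eventually by simp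
    moreover have "\<forall>\<^sub>F w in at z. F analytic_on {w}"
      by (intro eventually_analytic_at nontriv_mero_meromorphic F)
    moreover note nontriv_mero_ev[OF F, of z]
    ultimately show "\<forall>\<^sub>F w in at z. deriv U w = 0" by eventually_elim (use Ud0 in auto)
  qed auto
  have "U constant_on UNIV"
  proof (rule has_field_derivative_0_imp_constant_on)
    fix z show "(U has_field_derivative 0) (at z)"
      using Uan[of z] Ud[of z] field_differentiable_derivI[of U z] by (simp add: analytic_on_imp_differentiable_at)
  qed auto
  then obtain \<kappa> where "\<And>z. U z = \<kappa>" by (auto simp: constant_on_def)
  then show ?thesis using that[of \<kappa>] U(3) by (auto simp: Z_def)
qed

text \<open>The margin 1 gives \<open>1 \<le> |z - c| \<le> 2 |z|\<close>, so negative powers have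
  modulus at most 1.\<close>

lemma norm_prod_powi_le:
  fixes z :: complex
  assumes "finite Z" "\<And>c. c \<in> Z \<Longrightarrow> norm c + 1 \<le> norm z"
  shows "norm (\<Prod>c\<in>Z. (z - c) powi n c) \<le> (2 * norm z) ^ (\<Sum>c\<in>Z. nat \<bar>n c\<bar>)"
proof -
  have "norm (\<Prod>c\<in>Z. (z - c) powi n c) = (\<Prod>c\<in>Z. norm ((z - c) powi n c))" by (simp add: prod_norm)
  also have "\<dots> \<le> (\<Prod>c\<in>Z. (2 * norm z) ^ nat \<bar>n c\<bar>)"
  proof (intro prod_mono conjI norm_ge_zero)
    fix c assume c: "c \<in> Z"
    have b: "1 \<le> norm (z - c)" "norm (z - c) \<le> 2 * norm z"
      using assms(2)[OF c] norm_triangle_ineq2[of z c] norm_triangle_ineq4[of z c] by linarith+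
    show "norm ((z - c) powi n c) \<le> (2 * norm z) ^ nat \<bar>n c\<bar>"
    proof (cases "n c \<ge> 0")
      case True
      then have "norm ((z - c) powi n c) = norm (z - c) ^ nat \<bar>n c\<bar>" by (simp add: power_int_def norm_power)
      also have "\<dots> \<le> (2 * norm z) ^ nat \<bar>n c\<bar>" using b by (intro power_mono) auto
      finally show ?thesis .
    next
      case False
      then have "norm ((z - c) powi n c) = inverse (norm (z - c) ^ nat (- n c))"
        by (simp add: power_int_def norm_power norm_inverse power_inverse)
      also have "\<dots> \<le> 1" using b by (simp add: inverse_le_1_iff one_le_power)
      also have "\<dots> \<le> (2 * norm z) ^ nat \<bar>n c\<bar>" using b by (intro one_le_power) linarith
      finally show ?thesis .
    qed
  qed
  also have "\<dots> = (2 * norm z) ^ (\<Sum>c\<in>Z. nat \<bar>n c\<bar>)" by (simp add: power_sum)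
  finally show ?thesis .
qed

text \<open>Integration along rays from a circle beyond all poles gives \<open>f\<close> polynomial
  growth; clearing the finitely many poles leaves an entire function of polynomial growth, a
  polynomial by Liouville's theorem.\<close>

lemma rational_if_deriv_poly_growth:
  assumes f: "nontriv_mero f" and nice: "f nicely_meromorphic_on UNIV" and fin: "finite {z. is_pole f z}"
    and gr: "\<And>z. norm z \<ge> \<rho> \<Longrightarrow> norm (deriv f z) \<le> B * norm z ^ k"
  obtains p q :: "complex poly" where "q \<noteq> 0" "\<forall>\<^sub>\<approx>z\<in>UNIV. f z = poly p z / poly q z"
proof -
  define X where "X = {z. is_pole f z}"
  have finX: "finite X" using fin by (simp add: X_def)
  obtain b where b: "\<And>c. c \<in> X \<Longrightarrow> norm c \<le> b"
    using finite_imp_bounded[OF finX] by (auto simp: bounded_iff)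
  define s where "s = max (max 1 \<rho>) (b + 1)"
  have s: "s \<ge> 1" "s \<ge> \<rho>" "s \<ge> b + 1" by (auto simp: s_def)
  have an: "f analytic_on {z}" if "z \<notin> X" for z
    using nicely_meromorphic_on_imp_analytic_at[OF nice] that by (auto simp: X_def)
  have notX: "z \<notin> X" if "norm z \<ge> s" for z :: complex using b[of z] that s by auto
  have B: "B * norm z ^ k \<ge> 0" if "norm z \<ge> s" for z :: complex
    using gr[of z] that s norm_ge_zero[of "deriv f z"] by linarith
  have "f analytic_on sphere 0 s" by (subst analytic_on_analytic_at) (use an notX in auto)
  then have "continuous_on (sphere 0 s) f" by (intro holomorphic_on_imp_continuous_on analytic_imp_holomorphic)
  then have "bounded (f ` sphere 0 s)" by (intro compact_imp_bounded compact_continuous_image) auto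
  then obtain A0 where "\<forall>x\<in>sphere 0 s. norm (f x) \<le> A0" unfolding bounded_iff by auto
  then have A0: "norm (f z) \<le> A0" if "norm z = s" for z using that by simp
  define A where "A = max A0 0"
  have fb: "norm (f z) \<le> A + B * norm z ^ k * norm z" if z: "norm z \<ge> s" for z
  proof -
    define z0 where "z0 = of_real (s / norm z) * z"
    have nz: "norm z > 0" using z s by linarith
    have nz0: "norm z0 = s" using nz s by (simp add: z0_def norm_mult norm_divide)
    have seg: "s \<le> norm w \<and> norm w \<le> norm z" if "w \<in> closed_segment z0 z" for w
    proof -
      from that obtain u where u: "0 \<le> u" "u \<le> 1" "w = (1 - u) *\<^sub>R z0 + u *\<^sub>R z" by (auto simp: closed_segment_def)
      then have "w = of_real ((1 - u) * (s / norm z) + u) * z"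
        by (simp add: z0_def scaleR_conv_of_real algebra_simps)
      moreover have "(1 - u) * (s / norm z) + u \<ge> 0" using u s nz by (intro add_nonneg_nonneg mult_nonneg_nonneg) auto
      ultimately have "norm w = ((1 - u) * (s / norm z) + u) * norm z" by (simp only: norm_mult norm_of_real abs_of_nonneg)
      also have "\<dots> = (1 - u) * s + u * norm z" using nz by (simp add: distrib_right)
      finally have nw: "norm w = (1 - u) * s + u * norm z" .
      have "u * s \<le> u * norm z" "(1 - u) * s \<le> (1 - u) * norm z" using u z by (auto intro: mult_left_mono)
      then show ?thesis unfolding nw by (simp add: algebra_simps)
    qed
    have "norm (f z - f z0) \<le> (B * norm z ^ k) * norm (z - z0)"
    proof (rule field_differentiable_bound[of "closed_segment z0 z" f "deriv f"])
      fix w assume w: "w \<in> closed_segment z0 z"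
      have "f analytic_on {w}" using an notX seg[OF w] by blast
      then have "(f has_field_derivative deriv f w) (at w)"
        by (rule analytic_at_imp_DERIV)
      then show "(f has_field_derivative deriv f w) (at w within closed_segment z0 z)"
        by (rule has_field_derivative_at_within)
      have "norm (deriv f w) \<le> B * norm w ^ k" using gr seg[OF w] s by simp
      also have "\<dots> \<le> B * norm z ^ k"
      \<comment> \<open>The sign of \<open>B\<close> is not assumed; a negative one would contradict
        the growth bound at \<open>z\<close>.\<close>
      proof (cases "B \<ge> 0")
        case True
        then show ?thesis using seg[OF w] by (intro mult_left_mono power_mono) auto
      next
        case False
        then have "B * norm z ^ k < 0" using nz by (intro mult_neg_pos) auto
        then show ?thesis using B[OF z] by simp
      qed
      finally show "norm (deriv f w) \<le> B * norm z ^ k" .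
    qed auto
    also have "norm (z - z0) \<le> norm z"
    proof -
      have "z - z0 = of_real (1 - s / norm z) * z" by (simp add: z0_def algebra_simps)
      moreover have "0 \<le> 1 - s / norm z" using z nz by simp
      ultimately have "norm (z - z0) = (1 - s / norm z) * norm z" by (simp only: norm_mult norm_of_real abs_of_nonneg)
      also have "\<dots> = norm z - s" using nz by (simp add: left_diff_distrib)
      finally show ?thesis using s by simp
    qed
    finally have "norm (f z - f z0) \<le> B * norm z ^ k * norm z" using B[OF z] by (simp add: mult_left_mono)
    moreover have "norm (f z0) \<le> A" using A0[OF nz0] by (simp add: A_def)
    ultimately show ?thesis using norm_triangle_sub[of "f z" "f z0"] by linarith
  qed
  define m where "m = (\<lambda>z. nat (- zorder f z))"
  define P where "P = (\<lambda>z. \<Prod>b\<in>X. (z - b) ^ m b)"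
  have P: "nontriv_mero P" unfolding P_def by (rule nontriv_mero_prod_linear)
  have Pan: "P analytic_on S" for S unfolding P_def by (intro analytic_intros)
  have zoP: "zorder P z = (if z \<in> X then int (m z) else 0)" for z
    unfolding P_def using zorder_prod_linear_powi[OF finX, of "\<lambda>b. int (m b)" z] by simp
  define V where "V = remove_sings (\<lambda>z. f z * P z)"
  have "zorder (\<lambda>z. f z * P z) z \<ge> 0" for z
    unfolding nontriv_zorder_mult[OF f P] zoP
    using nontriv_zorder_neg_iff[OF f, of z] by (auto simp: m_def X_def)
  then have Van: "V analytic_on {z}" for z
    unfolding V_def by (rule zorder_nonneg_analytic_remove_sings[OF nontriv_mero_mult[OF f P]])
  have Veq: "V z = f z * P z" if "z \<notin> X" for z
  proof -
    have "(\<lambda>z. f z * P z) analytic_on {z}" by (intro analytic_intros an[OF that] Pan)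
    then show ?thesis by (simp add: V_def)
  qed
  define n where "n = (\<Sum>b\<in>X. m b)"
  have Vb: "norm (V z) \<le> ((A + \<bar>B\<bar>) * 2 ^ n) * norm z ^ (k + 1 + n)" if z: "norm z \<ge> s" for z
  proof -
    have z1: "norm z \<ge> 1" using z s by simp
    have "norm (P z) \<le> (2 * norm z) ^ n"
      using norm_prod_powi_le[OF finX, of z "\<lambda>b. int (m b)"] b z s by (force simp: P_def n_def)
    moreover have "norm (f z) \<le> (A + \<bar>B\<bar>) * norm z ^ (k + 1)"
    proof -
      have "A * 1 \<le> A * norm z ^ (k + 1)" using z1 by (intro mult_left_mono one_le_power) (auto simp: A_def)
      moreover have "B * norm z ^ (k + 1) \<le> \<bar>B\<bar> * norm z ^ (k + 1)" by (intro mult_right_mono) auto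
      ultimately show ?thesis using fb[OF z] by (simp add: algebra_simps)
    qed
    ultimately have "norm (f z) * norm (P z) \<le> ((A + \<bar>B\<bar>) * norm z ^ (k + 1)) * (2 * norm z) ^ n"
      by (intro mult_mono) (auto simp: A_def)
    then show ?thesis using Veq[OF notX[OF z]] by (simp add: norm_mult power_mult_distrib power_add mult_ac)
  qed
  have "V holomorphic_on UNIV"
    by (rule analytic_imp_holomorphic, subst analytic_on_analytic_at) (use Van in auto)
  note V = Liouville_polynomial[OF this Vb]
  define p where "p = (\<Sum>j\<le>k + 1 + n. monom ((deriv ^^ j) V 0 / fact j) j)"
  define q where "q = (\<Prod>b\<in>X. [:- b, 1:] ^ m b)"
  show ?thesis
  proof (rule that[of q p])
    show "q \<noteq> 0" using finX by (simp add: q_def)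
    have "V z = poly p z" for z using V[where \<xi> = z] by (simp add: p_def poly_sum poly_monom)
    moreover have "P z = poly q z" for z by (simp add: q_def P_def poly_prod)
    moreover have "P z \<noteq> 0" if "z \<notin> X" for z using that finX by (auto simp: P_def)
    ultimately have quot: "f z = poly p z / poly q z" if "z \<notin> X" for z
      using Veq[OF that] that by (metis nonzero_mult_div_cancel_right)
    have "\<forall>\<^sub>F w in at z. f w = poly p w / poly q w" for z
    proof -
      have "\<forall>\<^sub>F w in at z. w \<notin> X"
        using islimpt_finite[OF finX, of z] unfolding islimpt_iff_eventually by simp
      then show ?thesis by eventually_elim (rule quot)
    qed
    then show "\<forall>\<^sub>\<approx>z\<in>UNIV. f z = poly p z / poly q z"
      by (simp add: eventually_cosparse_open_eq)
  qed
qed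

section \<open>Sets too sparse to contain arithmetic progressions\<close>

text \<open>The first \<open>n + 1\<close> terms lie in a disc of radius \<open>|z| + n\<close>,
  which holds only \<open>C ln (|z| + n)\<close> points.\<close>

lemma not_all_arithmetic_progression:
  fixes z e :: complex
  assumes fin: "\<And>R. finite {z \<in> cball 0 R. A z}" and C: "C \<ge> 0"
    and cnt: "\<And>R. R \<ge> R0 \<Longrightarrow> real (card {z \<in> cball 0 R. A z}) \<le> C * ln R"
    and e: "norm e = 1"
  shows "\<exists>j::nat. \<not> A (z + of_nat j * e)"
proof (rule ccontr)
  assume "\<not> ?thesis"
  then have all: "A (z + of_nat j * e)" for j by blast
  have "\<forall>\<^sub>F n in sequentially. C * ln (norm z + real n) / real n < 1"
    using order_tendstoD(2)[OF eventually_log_bounds(3)[OF C norm_ge_zero[of z]] zero_less_one] .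
  moreover have "\<forall>\<^sub>F n in sequentially. real n \<ge> max 1 R0"
    by real_asymp
  ultimately have "\<forall>\<^sub>F n in sequentially. False"
  proof eventually_elim
    case (elim n)
    let ?h = "\<lambda>j::nat. z + of_nat j * e"
    have "inj_on ?h {..n}" using e by (auto simp: inj_on_def)
    then have "card (?h ` {..n}) = n + 1" by (simp add: card_image)
    moreover have "?h ` {..n} \<subseteq> {w \<in> cball 0 (norm z + real n). A w}"
    proof (rule image_subsetI)
      fix j assume "j \<in> {..n}"
      then have "z + of_nat j * e \<in> cball 0 (norm z + real n)"
        using norm_triangle_ineq[of z "of_nat j * e"] e by (simp add: norm_mult)
      then show "z + of_nat j * e \<in> {w \<in> cball 0 (norm z + real n). A w}" using all by simp
    qed
    ultimately have "n + 1 \<le> card {w \<in> cball 0 (norm z + real n). A w}"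
      using card_mono[OF fin] by metis
    then have "real n + 1 \<le> C * ln (norm z + real n)"
      using cnt[of "norm z + real n"] elim norm_ge_zero[of z] by linarith
    moreover have "C * ln (norm z + real n) < real n" using elim by (simp add: divide_less_eq)
    ultimately show False by simp
  qed
  then show False by simp
qed

text \<open>Walking left in unit steps from any point of the set must leave it, just before the
  start of a run. With finitely many starts, one of them would serve infinitely many points, and its
  run would be an infinite progression.\<close>

lemma infinite_chain_starts:
  fixes A :: "complex \<Rightarrow> bool"
  assumes fin: "\<And>R. finite {z \<in> cball 0 R. A z}" and C: "C \<ge> 0"
    and cnt: "\<And>R. R \<ge> R0 \<Longrightarrow> real (card {z \<in> cball 0 R. A z}) \<le> C * ln R"
    and inf: "infinite {z. A z}"
  shows "infinite {z. \<not> A z \<and> A (z + 1)}"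
proof
  assume finS: "finite {z. \<not> A z \<and> A (z + 1)}" (is "finite ?S")
  have ex: "\<exists>j::nat. \<not> A (b - of_nat j)" for b
    using not_all_arithmetic_progression[OF fin C cnt, where e = "-1" and z = b] by auto
  \<comment> \<open>The number of steps to the left until the set is first left.\<close>
  define k where "k = (\<lambda>b. LEAST j::nat. \<not> A (b - of_nat j))"
  have k1: "\<not> A (b - of_nat (k b))" for b unfolding k_def by (rule LeastI_ex[OF ex])
  have k2: "A (b - of_nat j)" if "j < k b" for b j using not_less_Least that unfolding k_def by blast
  define s where "s = (\<lambda>b. b - of_nat (k b))"
  have sS: "s b \<in> ?S" if "A b" for b
  proof -
    have "k b \<noteq> 0" using k1[of b] that by (intro notI) simp
    then have "A (b - of_nat (k b - 1))" by (intro k2) simp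
    then show ?thesis using k1[of b] \<open>k b \<noteq> 0\<close> by (simp add: s_def of_nat_diff algebra_simps)
  qed
  have "finite (s ` {z. A z})" by (rule finite_subset[OF _ finS]) (use sS in auto)
  from pigeonhole_infinite[OF inf this] obtain b0 where
    b0: "infinite {b. A b \<and> s b = s b0}" by auto
  have "A (s b0 + 1 + of_nat j * 1)" for j
  proof -
    \<comment> \<open>On the points with a common start \<open>k\<close> is injective, since
      \<open>b = s b + k b\<close>; hence it is unbounded there.\<close>
    have "infinite (k ` {b. A b \<and> s b = s b0})"
    proof
      assume "finite (k ` {b. A b \<and> s b = s b0})"
      moreover have "inj_on k {b. A b \<and> s b = s b0}" 
      proof (rule inj_onI)
        fix x y assume "x \<in> {b. A b \<and> s b = s b0}" "y \<in> {b. A b \<and> s b = s b0}" "k x = k y"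
        then have "s x = s y" "k x = k y" by auto
        then show "x = y" by (simp add: s_def)
      qed
      ultimately show False using b0 finite_imageD by blast
    qed
    then obtain b where b: "A b" "s b = s b0" "k b > j" unfolding infinite_nat_iff_unbounded by auto
    then have "A (b - of_nat (k b - 1 - j))" by (intro k2) auto
    moreover have "b - of_nat (k b - 1 - j) = s b0 + 1 + of_nat j"
      using b by (simp add: s_def of_nat_diff algebra_simps flip: b(2))
    ultimately show ?thesis by simp
  qed
  moreover have "\<exists>j::nat. \<not> A ((s b0 + 1) + of_nat j * 1)"
    by (rule not_all_arithmetic_progression[OF fin C cnt]) auto
  ultimately show False by blast
qed

section \<open>Counting zeros of the difference\<close>

text \<open>Outside the zeros of \<open>\<Delta>f\<close> and \<open>\<Delta>f/f\<close>, a pole of \<open>f\<close> at \<open>z\<close> or \<open>z + 1\<close> is a pole of \<open>\<Delta>f\<close> of the larger of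
  the two multiplicities: cancellation between equal multiplicities would be a zero of \<open>\<Delta>f/f\<close>.\<close>
lemma zcount_difference_le:
  fixes f :: "complex \<Rightarrow> complex"
  assumes f: "nontriv_mero f" and g: "nontriv_mero (\<lambda>z. f (z + 1) - f z)"
    and fin: "finite (mero_zeros (\<lambda>z. f (z + 1) - f z))" "finite (mero_zeros (\<lambda>z. (f (z + 1) - f z) / f z))"
  obtains D :: int where "\<And>r. zcount (\<lambda>z. f (z + 1) - f z) r
      \<le> D - (\<Sum>z | z \<in> ball 0 r \<and> is_pole f z. - zorder f z) - int (card {z \<in> ball 0 r. \<not> is_pole f z \<and> is_pole f (z + 1)})"
proof -
  let ?g = "\<lambda>z. f (z + 1) - f z"
  define X where "X = mero_zeros ?g \<union> mero_zeros (\<lambda>z. ?g z / f z)"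
  have finX: "finite X" using fin by (simp add: X_def)
  have G: "nontriv_mero (\<lambda>z. ?g z / f z)" by (rule nontriv_mero_divide[OF g f])
  have f1: "nontriv_mero (\<lambda>z. f (z + 1))" by (rule nontriv_mero_shift[OF f])
  have zo1: "zorder (\<lambda>z. f (z + 1)) z = zorder f (z + 1)" for z
    using zorder_shift[of "\<lambda>z. f (z + 1)" z] zorder_shift[of f "z + 1"] by (simp add: add_ac)
  have ip: "is_pole f z \<longleftrightarrow> zorder f z < 0" for z using nontriv_zorder_neg_iff[OF f] by blast
  \<comment> \<open>\<open>p\<close> is the pole multiplicity of \<open>f\<close>, and
    \<open>e\<close> marks the point just before the start of a run, where the difference gains an
    extra pole.\<close>
  define p where "p = (\<lambda>z. max 0 (- zorder f z))"
  define e where "e = (\<lambda>z. if \<not> is_pole f z \<and> is_pole f (z + 1) then 1 else 0 :: int)"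
  have key: "zorder ?g z \<le> - p z - e z" if z: "z \<notin> X" for z
  proof -
    define a b where "a = zorder f z" and "b = zorder f (z + 1)"
    have "\<not> zorder ?g z > 0"
      using nontriv_zorder_pos_iff[OF g, of z] z by (auto simp: X_def mero_zeros_def)
    then have g0: "zorder ?g z \<le> 0" by simp
    have "\<not> zorder (\<lambda>z. ?g z / f z) z > 0"
      using nontriv_zorder_pos_iff[OF G, of z] z by (auto simp: X_def mero_zeros_def)
    then have ga: "zorder ?g z \<le> a"
      using nontriv_zorder_divide[OF g f, of z] by (simp add: a_def)
    have less: "zorder ?g z = b" if "b < a"
    proof -
      have "zorder ?g z = zorder (\<lambda>z. f (z + 1)) z"
        by (rule zorder_diff1) (use that in \<open>auto simp: zo1 a_def b_def intro: nontriv_mero_meromorphic nontriv_mero_freq f f1\<close>)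
      then show ?thesis by (simp add: zo1 b_def)
    qed
    have "p z = max 0 (- a)" "e z = (if a \<ge> 0 \<and> b < 0 then 1 else 0)"
      by (auto simp: p_def e_def a_def b_def ip)
    then show ?thesis using g0 ga less by (auto simp: max_def)
  qed
  \<comment> \<open>Pays for the finitely many points of \<open>X\<close>, where the bound may fail;
    the summand 1 covers \<open>e\<close>.\<close>
  define D where "D = (\<Sum>z\<in>X. \<bar>zorder ?g z\<bar> + p z + 1)"
  have "zcount ?g r \<le> D - (\<Sum>z | z \<in> ball 0 r \<and> is_pole f z. - zorder f z) - int (card {z \<in> ball 0 r. \<not> is_pole f z \<and> is_pole f (z + 1)})" for r
  proof -
    define S where "S = {z \<in> ball 0 r. \<not> is_pole f z \<and> is_pole f (z + 1)}"
    define A where "A = {z \<in> ball 0 r. zorder ?g z \<noteq> 0} \<union> {z \<in> ball 0 r. zorder f z \<noteq> 0} \<union> S"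
    have "(\<lambda>z. z + 1) ` S \<subseteq> divisor_in f (r + 1)"
    proof (rule image_subsetI)
      fix z assume "z \<in> S"
      then show "z + 1 \<in> divisor_in f (r + 1)"
        using norm_triangle_ineq[of z 1] by (auto simp: S_def ip)
    qed
    then have "finite ((\<lambda>z. z + 1) ` S)" using finite_zorder_cball[OF f] finite_subset by blast
    then have finS: "finite S" by (rule finite_imageD) (auto simp: inj_on_def)
    have finA: "finite A" unfolding A_def using finS finite_zorder_ball[OF g] finite_zorder_ball[OF f] by blast
    have "zcount ?g r = (\<Sum>z\<in>A. zorder ?g z)"
      by (rule zcount_eq_sum[OF g finA]) (auto simp: A_def S_def)
    also have "\<dots> \<le> (\<Sum>z\<in>A. (- p z - e z) + (if z \<in> X then \<bar>zorder ?g z\<bar> + p z + 1 else 0))"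
    proof (rule sum_mono)
      fix z
      have "e z \<le> 1" by (simp add: e_def)
      then show "zorder ?g z \<le> (- p z - e z) + (if z \<in> X then \<bar>zorder ?g z\<bar> + p z + 1 else 0)"
        using key[of z] by auto
    qed
    also have "\<dots> = - (\<Sum>z\<in>A. p z) - (\<Sum>z\<in>A. e z) + (\<Sum>z\<in>A \<inter> X. \<bar>zorder ?g z\<bar> + p z + 1)"
      using finA by (simp add: sum.distrib sum_subtractf sum_negf sum.If_cases)
    also have "(\<Sum>z\<in>A \<inter> X. \<bar>zorder ?g z\<bar> + p z + 1) \<le> D"
      unfolding D_def by (rule sum_mono2[OF finX]) (auto simp: p_def)
    also have "(\<Sum>z\<in>A. e z) = int (card S)"
    proof -
      have "(\<Sum>z\<in>A. e z) = (\<Sum>z\<in>S. 1)"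
        by (rule sum.mono_neutral_cong_right[OF finA]) (auto simp: A_def S_def e_def)
      then show ?thesis by simp
    qed
    also have "(\<Sum>z\<in>A. p z) = (\<Sum>z | z \<in> ball 0 r \<and> is_pole f z. - zorder f z)"
      by (rule sum.mono_neutral_cong_right[OF finA]) (auto simp: A_def S_def p_def ip)
    finally show ?thesis by (simp add: S_def)
  qed
  then show ?thesis using that by blast
qed

text \<open>Subtracting a constant leaves every pole and its order unchanged, and zeros only raise
  the count.\<close>

lemma zcount_minus_const_ge:
  assumes f: "nontriv_mero f" and nice: "f nicely_meromorphic_on UNIV"
    and fa: "nontriv_mero (\<lambda>z. f z - \<alpha>)"
  shows "zcount (\<lambda>z. f z - \<alpha>) r \<ge> - (\<Sum>z | z \<in> ball 0 r \<and> is_pole f z. - zorder f z)"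
proof -
  define B where "B = {z. z \<in> ball 0 r \<and> is_pole f z}"
  define A where "A = {z \<in> ball 0 r. zorder (\<lambda>z. f z - \<alpha>) z \<noteq> 0} \<union> {z \<in> ball 0 r. zorder f z \<noteq> 0}"
  have ip: "is_pole f z \<longleftrightarrow> zorder f z < 0" for z using nontriv_zorder_neg_iff[OF f] by blast
  have finA: "finite A" unfolding A_def using finite_zorder_ball[OF fa] finite_zorder_ball[OF f] by blast
  have key: "zorder (\<lambda>z. f z - \<alpha>) z \<ge> (if is_pole f z then zorder f z else 0)" for z
  proof (cases "is_pole f z")
    case True
    then have neg: "zorder f z < 0" using ip by simp
    show ?thesis
    proof (cases "\<alpha> = 0")
      case False
      have "zorder (\<lambda>z. f z - (\<lambda>_. \<alpha>) z) z = zorder f z"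
        by (rule zorder_diff1) (use neg False in \<open>auto intro: nontriv_mero_meromorphic nontriv_mero_freq f\<close>)
      then show ?thesis using True by simp
    qed (use True in simp)
  next
    case False
    then have "f analytic_on {z}" using nicely_meromorphic_on_imp_analytic_at[OF nice] by auto
    then have "(\<lambda>z. f z - \<alpha>) analytic_on {z}" by (intro analytic_intros)
    from zorder_ge_0[OF this nontriv_mero_freq[OF fa]] show ?thesis using False by simp
  qed
  have "- (\<Sum>z\<in>B. - zorder f z) = (\<Sum>z\<in>B. zorder f z)" by (simp add: sum_negf)
  also have "\<dots> = (\<Sum>z\<in>A. if is_pole f z then zorder f z else 0)"
    by (rule sum.mono_neutral_cong_left[OF finA]) (auto simp: A_def B_def ip)
  also have "\<dots> \<le> (\<Sum>z\<in>A. zorder (\<lambda>z. f z - \<alpha>) z)" by (intro sum_mono key)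
  also have "\<dots> = zcount (\<lambda>z. f z - \<alpha>) r"
    by (rule zcount_eq_sum[OF fa finA, symmetric]) (auto simp: A_def)
  finally show ?thesis by (simp add: B_def)
qed

lemma infinite_subset_in_ball:
  fixes S :: "complex set"
  assumes "infinite S"
  obtains r0 where "\<And>r. r \<ge> r0 \<Longrightarrow> \<exists>Y. Y \<subseteq> S \<inter> ball 0 r \<and> finite Y \<and> card Y = n"
proof -
  obtain Y where Y: "Y \<subseteq> S" "finite Y" "card Y = n"
    using infinite_arbitrarily_large[OF assms, of n] by blast
  obtain b where b: "\<And>y. y \<in> Y \<Longrightarrow> norm y \<le> b"
    using finite_imp_bounded[OF Y(2)] by (auto simp: bounded_iff)
  show ?thesis
  proof (rule that[of "b + 1"])
    fix r assume r: "r \<ge> b + 1"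
    have "Y \<subseteq> ball 0 r"
    proof
      fix y assume "y \<in> Y"
      then show "y \<in> ball 0 r" using b[of y] r by simp
    qed
    then show "\<exists>Y. Y \<subseteq> S \<inter> ball 0 r \<and> finite Y \<and> card Y = n" using Y by blast
  qed
qed

lemma difference_zeros_nice:
  fixes f :: "complex \<Rightarrow> complex"
  assumes nice: "f nicely_meromorphic_on UNIV" and f: "nontriv_mero f" and slow: "slow_growth f"
    and fa: "\<And>\<alpha>. nontriv_mero (\<lambda>z. f z - \<alpha>)" and F: "nontriv_mero (deriv f)"
    and trans: "\<not> (\<exists>p q :: complex poly. q \<noteq> 0 \<and> (\<forall>\<^sub>\<approx>z\<in>UNIV. f z = poly p z / poly q z))"
    and g: "nontriv_mero (\<lambda>z. f (z + 1) - f z)"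
    and fin: "finite (mero_zeros (\<lambda>z. f (z + 1) - f z))" "finite (mero_zeros (\<lambda>z. (f (z + 1) - f z) / f z))"
  shows False
proof -
  let ?g = "\<lambda>z. f (z + 1) - f z" and ?F = "deriv f"
  let ?pc = "\<lambda>r. \<Sum>z | z \<in> ball 0 r \<and> is_pole f z. - zorder f z"
  let ?S = "{z. \<not> is_pole f z \<and> is_pole f (z + 1)}"
  let ?\<sigma> = "\<lambda>r. int (card {z \<in> ball 0 r. \<not> is_pole f z \<and> is_pole f (z + 1)})"
  obtain C R0 where C: "C \<ge> 0"
    and cnt: "\<And>R. R \<ge> R0 \<Longrightarrow> divisor_mass ?F R \<le> C * ln R"
    and ld: "\<And>R z. R \<ge> R0 \<Longrightarrow> norm z \<le> R / 2 \<Longrightarrow> ?F analytic_on {z} \<Longrightarrow> ?F z \<noteq> 0 \<Longrightarrow>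
       log_deriv_error ?F R z \<le> C * (ln R)^2 / R"
    using slow_growth_zeros_poles[OF F slow_growth_deriv[OF f nice slow]] by blast
  obtain K \<eta> where K: "K > 0" and \<eta>: "0 < \<eta>" "\<eta> \<le> 1" and reg: "\<And>\<rho>. \<exists>r\<ge>\<rho>. regular_annulus ?F K \<eta> r"
    using regular_annuli_exist[OF F C cnt ld] by blast
  obtain D where D: "\<And>r. zcount ?g r \<le> D - ?pc r - ?\<sigma> r"
    using zcount_difference_le[OF f g fin] by blast
  have ipF: "is_pole f z \<longleftrightarrow> zorder ?F z < 0" for z
    using nontriv_zorder_neg_iff[OF F, of z] is_pole_deriv_iff[OF nontriv_mero_meromorphic[OF f, of "{z}"]] by simp
  have ip: "is_pole f z \<longleftrightarrow> zorder f z < 0" for z using nontriv_zorder_neg_iff[OF f] by blast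
  have pc0: "?pc r \<ge> 0" for r by (rule sum_nonneg) (auto simp: ip)
  \<comment> \<open>Apart from \<open>\<rho>\<close>, all lower bounds imposed on \<open>r\<close>
    depend only on \<open>K\<close> and \<open>\<eta>\<close>, so some regular radius meets
    them.\<close>
  have ex: "\<exists>r\<ge>\<rho>. r > 0 \<and> regular_annulus ?F K \<eta> r \<and> zcount ?g r = zcount ?F r" for \<rho>
  proof -
    have e: "exp (- \<eta>) < 1" "exp \<eta> > 1" using \<eta> by auto
    have "\<forall>\<^sub>F r in at_top. ((4 * K) * ln r + 4 * K) / r < exp (- \<eta>)"
      by (rule order_tendstoD(2)[OF eventually_log_bounds(2)]) (use K in auto)
    then obtain r1 where r1: "\<And>r. r \<ge> r1 \<Longrightarrow> ((4 * K) * ln r + 4 * K) / r < exp (- \<eta>)"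
      unfolding eventually_at_top_linorder by blast
    obtain r where r: "r \<ge> Max {\<rho>, r1, 1, 2 / (1 - exp (- \<eta>)), 2 / (exp \<eta> - 1)}" and rg: "regular_annulus ?F K \<eta> r"
      using reg by blast
    have r': "r \<ge> \<rho>" "r \<ge> r1" "r \<ge> 1" "r \<ge> 2 / (1 - exp (- \<eta>))" "r \<ge> 2 / (exp \<eta> - 1)" using r by auto
    have "zcount ?g r = zcount ?F r"
    proof (rule zcount_difference_eq[OF nice F g rg _ K])
      show "2 \<le> r * (1 - exp (- \<eta>))" "2 \<le> r * (exp \<eta> - 1)"
        using r'(4,5) e by (simp_all only: pos_divide_le_eq diff_gt_0_iff_gt)
      show "4 * (K * ln r + K) \<le> r * exp (- \<eta>)"
        using r1[OF r'(2)] r'(3) by (simp add: pos_divide_less_eq mult.commute algebra_simps less_imp_le)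
    qed (use r' in auto)
    then show ?thesis using r' rg by (intro exI[of _ r]) auto
  qed
  show False
  proof (cases "finite {z. is_pole f z}")
    case True
    have finzo: "finite {z. zorder ?F z \<noteq> 0}"
    proof (rule ccontr)
      assume "infinite {z. zorder ?F z \<noteq> 0}"
      moreover have "{z. zorder ?F z \<noteq> 0} = {z. is_pole f z} \<union> {z. zorder ?F z > 0}" by (auto simp: ipF)
      ultimately have inf: "infinite {z. zorder ?F z > 0}" using True by auto
      \<comment> \<open>The total multiplicity of the poles of \<open>f'\<close>. More than
        \<open>D + E\<close> zeros in a disc would push the count of \<open>f'\<close> above its
        upper bound \<open>D\<close>.\<close>
      define E where "E = (\<Sum>z\<in>{z. is_pole f z}. - zorder ?F z)"
      obtain r0 where r0: "\<And>r. r \<ge> r0 \<Longrightarrow> \<exists>Y. Y \<subseteq> {z. zorder ?F z > 0} \<inter> ball 0 r \<and> finite Y \<and> card Y = nat (D + E) + 1"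
        using infinite_subset_in_ball[OF inf, of "nat (D + E) + 1"] by blast
      obtain r where r: "r \<ge> r0" "zcount ?g r = zcount ?F r" using ex by blast
      obtain Y where Y: "Y \<subseteq> {z. zorder ?F z > 0} \<inter> ball 0 r" "finite Y" "card Y = nat (D + E) + 1"
        using r0[OF r(1)] by blast
      let ?A = "{z. z \<in> ball 0 r \<and> zorder ?F z \<noteq> 0}"
      have finA: "finite ?A" by (rule finite_zorder_ball[OF F])
      have "int (card Y) = (\<Sum>z\<in>Y. 1)" by simp
      also have "\<dots> \<le> (\<Sum>z\<in>Y. zorder ?F z)" by (rule sum_mono) (use Y in force)
      also have "\<dots> \<le> (\<Sum>z\<in>{z\<in>?A. zorder ?F z > 0}. zorder ?F z)"
        by (rule sum_mono2[OF finite_subset[OF _ finA]]) (use Y in auto)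
      finally have 1: "int (card Y) \<le> (\<Sum>z\<in>{z\<in>?A. zorder ?F z > 0}. zorder ?F z)" .
      have 2: "(\<Sum>z\<in>{z\<in>?A. zorder ?F z < 0}. - zorder ?F z) \<le> E"
        unfolding E_def by (rule sum_mono2[OF True]) (auto simp: ipF)
      have "zcount ?F r = (\<Sum>z\<in>{z\<in>?A. zorder ?F z > 0} \<union> {z\<in>?A. zorder ?F z < 0}. zorder ?F z)"
        unfolding zcount_def by (rule sum.cong) auto
      also have "\<dots> = (\<Sum>z\<in>{z\<in>?A. zorder ?F z > 0}. zorder ?F z) + (\<Sum>z\<in>{z\<in>?A. zorder ?F z < 0}. zorder ?F z)"
        by (rule sum.union_disjoint[OF finite_subset[OF _ finA] finite_subset[OF _ finA]]) auto
      also have "(\<Sum>z\<in>{z\<in>?A. zorder ?F z < 0}. zorder ?F z) = - (\<Sum>z\<in>{z\<in>?A. zorder ?F z < 0}. - zorder ?F z)"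
        by (simp add: sum_negf)
      finally have "zcount ?F r \<ge> int (card Y) - E" using 1 2 by linarith
      moreover have "zcount ?F r \<le> D" using D[of r] pc0[of r] r by linarith
      ultimately show False using Y(3) by linarith
    qed
    obtain \<kappa> where \<kappa>: "\<And>z. zorder ?F z = 0 \<Longrightarrow> ?F analytic_on {z} \<Longrightarrow>
      ?F z = \<kappa> * (\<Prod>c | zorder ?F c \<noteq> 0. (z - c) powi zorder ?F c)"
      using eq_prod_if_finite_zeros_poles[OF F finzo C ld] by blast
    define Z where "Z = {c. zorder ?F c \<noteq> 0}"
    define k where "k = (\<Sum>c\<in>Z. nat \<bar>zorder ?F c\<bar>)"
    obtain b where b: "\<And>c. c \<in> Z \<Longrightarrow> norm c \<le> b"
      using finite_imp_bounded[OF finzo] by (auto simp: bounded_iff Z_def)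
    have "norm (?F z) \<le> (norm \<kappa> * 2 ^ k) * norm z ^ k" if z: "norm z \<ge> b + 1" for z
    proof -
      have zZ: "z \<notin> Z" using b[of z] z by auto
      then have "\<not> is_pole f z" by (simp add: ipF Z_def)
      then have "f analytic_on {z}" using nicely_meromorphic_on_imp_analytic_at[OF nice] by auto
      then have "?F z = \<kappa> * (\<Prod>c\<in>Z. (z - c) powi zorder ?F c)"
        using \<kappa>[of z] zZ analytic_deriv by (simp add: Z_def)
      moreover have "norm (\<Prod>c\<in>Z. (z - c) powi zorder ?F c) \<le> (2 * norm z) ^ k"
        unfolding k_def
      proof (rule norm_prod_powi_le)
        show "finite Z" using finzo by (simp add: Z_def)
        fix c assume "c \<in> Z"
        then show "norm c + 1 \<le> norm z" using b[of c] z by linarith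
      qed
      ultimately have "norm (?F z) \<le> norm \<kappa> * (2 * norm z) ^ k"
        by (simp add: norm_mult mult_left_mono del: power_mult_distrib)
      then show ?thesis by (simp add: power_mult_distrib)
    qed
    from rational_if_deriv_poly_growth[OF f nice True this] trans show False by blast
  next
    case inf: False
    have fincb: "finite {z \<in> cball 0 R. is_pole f z}" for R by (rule finite_poles_cball[OF f])
    \<comment> \<open>Every pole of \<open>f\<close> is a pole of \<open>f'\<close>, so the count
      for \<open>f'\<close> also makes the poles of \<open>f\<close> sparse.\<close>
    have cntp: "real (card {z \<in> cball 0 R. is_pole f z}) \<le> C * ln R" if "R \<ge> R0" for R
    proof -
      have "real (card {z \<in> cball 0 R. is_pole f z}) = (\<Sum>z\<in>{z \<in> cball 0 R. is_pole f z}. 1)" by simp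
      also have "\<dots> \<le> (\<Sum>z\<in>{z \<in> cball 0 R. is_pole f z}. \<bar>real_of_int (zorder ?F z)\<bar>)"
        by (rule sum_mono) (auto simp: ipF)
      also have "\<dots> \<le> (\<Sum>z\<in>divisor_in ?F R. \<bar>real_of_int (zorder ?F z)\<bar>)"
        by (rule sum_mono2) (use finite_zorder_cball[OF F] in \<open>auto simp: ipF\<close>)
      also have "\<dots> \<le> C * ln R" by (rule cnt[OF that])
      finally show ?thesis .
    qed
    have infS: "infinite ?S" by (rule infinite_chain_starts[OF fincb C cntp inf])
    \<comment> \<open>\<open>\<eta> / 2\<close> keeps the shifted circle inside the annulus, and
      \<open>1 / (4 * K)\<close> limits the cost of the outward move.\<close>
    define \<delta> where "\<delta> = min (\<eta> / 2) (1 / (4 * K))"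
    have \<delta>: "0 < \<delta>" "\<delta> < \<eta>" "\<delta> * K \<le> 1 / 4"
    proof -
      have "\<delta> * K \<le> 1 / (4 * K) * K" using K by (intro mult_right_mono) (auto simp: \<delta>_def)
      then show "\<delta> * K \<le> 1 / 4" using K by simp
    qed (use \<eta> K in \<open>auto simp: \<delta>_def\<close>)
    define W where "W = (K * pi + ln (4 * pi * K + 1)) / \<delta>"
    \<comment> \<open>So many runs that \<open>M \<le> D - n0\<close> satisfies the steepness
      condition and that \<open>n0 > D + 1\<close> yields the final contradiction.\<close>
    define n0 where "n0 = nat (\<lceil>real_of_int D + 2 + K + \<bar>W\<bar>\<rceil> + \<bar>D\<bar>)"
    have n0: "real n0 \<ge> real_of_int D + 1 + K + W" "int n0 > D + 1"
    proof -
      have "real_of_int D + 2 + K + \<bar>W\<bar> \<le> of_int \<lceil>real_of_int D + 2 + K + \<bar>W\<bar>\<rceil>" by (rule le_of_int_ceiling)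
      moreover have "of_int (\<lceil>real_of_int D + 2 + K + \<bar>W\<bar>\<rceil> + \<bar>D\<bar>) \<le> real n0" by (simp add: n0_def)
      moreover have "\<bar>real_of_int D\<bar> \<ge> 0" by simp
      ultimately have *: "real_of_int D + 2 + K + \<bar>W\<bar> \<le> real n0"
        unfolding of_int_add of_int_abs by linarith
      then show "real n0 \<ge> real_of_int D + 1 + K + W" by linarith
      have "real_of_int D + 1 < real n0" using * K by linarith
      then show "int n0 > D + 1" by linarith
    qed
    obtain r0 where r0: "\<And>r. r \<ge> r0 \<Longrightarrow> \<exists>Y. Y \<subseteq> ?S \<inter> ball 0 r \<and> finite Y \<and> card Y = n0"
      using infinite_subset_in_ball[OF infS, of n0] by blast
    obtain r where r: "r \<ge> r0" "r > 0" and rg: "regular_annulus ?F K \<eta> r" and gF: "zcount ?g r = zcount ?F r"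
      using ex by blast
    define M where "M = zcount ?F r"
    have \<sigma>: "?\<sigma> r \<ge> int n0"
    proof -
      obtain Y where Y: "Y \<subseteq> ?S \<inter> ball 0 r" "card Y = n0" using r0[OF r(1)] by blast
      let ?T = "{z \<in> ball 0 r. \<not> is_pole f z \<and> is_pole f (z + 1)}"
      have "(\<lambda>z. z + 1) ` ?T \<subseteq> {z \<in> cball 0 (r + 1). is_pole f z}"
      proof (rule image_subsetI)
        fix z assume "z \<in> ?T"
        then show "z + 1 \<in> {z \<in> cball 0 (r + 1). is_pole f z}" using norm_triangle_ineq[of z 1] by auto
      qed
      then have "finite ((\<lambda>z. z + 1) ` ?T)" using fincb finite_subset by blast
      then have "finite ?T" by (rule finite_imageD) (auto simp: inj_on_def)
      then have "card Y \<le> card ?T" by (rule card_mono) (use Y in auto)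
      then show ?thesis using Y by simp
    qed
    have Mle: "M \<le> D - ?pc r - ?\<sigma> r" using D[of r] gF by (simp add: M_def)
    have steep: "real_of_int M + 1 + K \<le> - (K * pi + ln (4 * pi * K + 1)) / \<delta>"
    proof -
      have "M \<le> D - int n0" using Mle \<sigma> pc0[of r] by linarith
      then have "real_of_int M \<le> real_of_int D - real n0" by linarith
      then have "real_of_int M + 1 + K \<le> - W" using n0 by linarith
      then show ?thesis by (simp only: W_def minus_divide_left)
    qed
    note an = regular_annulus_derivD[OF nice F rg]
    obtain \<alpha> where \<alpha>: "\<And>z. norm z = r \<Longrightarrow> norm (of_int (M + 1) * ((f z - \<alpha>) / (z * ?F z)) - 1) < 1"
      using near_constant_if_steep[OF r(2) \<eta>(1) K an(1) an(2) an(3)[folded M_def] \<delta> steep] by blast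
    have id: "nontriv_mero (\<lambda>z. z)" using nontriv_mero_linear[of 0] by simp
    have zF: "nontriv_mero (\<lambda>z. z * ?F z)" by (rule nontriv_mero_mult[OF id F])
    have "zcount (\<lambda>z. (f z - \<alpha>) / (z * ?F z)) r = 0"
    proof (rule zcount_eq_0_if_near_const[OF nontriv_mero_divide[OF fa zF] r(2) _ \<alpha>])
      fix z :: complex assume z: "norm z = r"
      have i: "r * exp (- \<eta>) \<le> norm z" "norm z \<le> r * exp \<eta>" using z r \<eta> by simp_all
      have "z \<noteq> 0" using z r by auto
      then show "(\<lambda>z. (f z - \<alpha>) / (z * ?F z)) analytic_on {z}"
        using an(1,2)[OF i] by (intro analytic_intros analytic_deriv) auto
    qed
    \<comment> \<open>The factor \<open>z\<close> of \<open>z f'\<close> is the source of the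
      summand 1 in \<open>M + 1\<close>.\<close>
    moreover have "zcount (\<lambda>z. z) r = 1"
    proof -
      have zid: "zorder (\<lambda>z::complex. z) z = (if z = 0 then 1 else 0)" for z
        using zorder_linear_powi[of 0 1 z] by simp
      have "zcount (\<lambda>z. z) r = (\<Sum>z\<in>{0}. zorder (\<lambda>z::complex. z) z)"
        by (rule zcount_eq_sum[OF id]) (use r in \<open>auto simp: zid split: if_splits\<close>)
      then show ?thesis by (simp add: zid)
    qed
    ultimately have "zcount (\<lambda>z. f z - \<alpha>) r = M + 1"
      using zcount_divide[OF fa zF, of \<alpha> r] zcount_mult[OF id F, of r] by (simp add: M_def)
    then have "M + 1 \<ge> - ?pc r" using zcount_minus_const_ge[OF f nice fa, of r \<alpha>] by simp
    \<comment> \<open>The pole count cancels between \<open>M + 1 \<ge> - ?pc r\<close> and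
      \<open>M \<le> D - ?pc r - n0\<close>, leaving \<open>n0 \<le> D + 1\<close>.\<close>
    then show False using Mle \<sigma> n0(2) by linarith
  qed
qed

section \<open>Reduction to nicely meromorphic functions\<close>

text \<open>If \<open>f'\<close> vanished off a sparse set, \<open>f\<close> could have no pole, as
  \<open>f'\<close> would have one there too; then \<open>f\<close> would be entire with derivative
  0.\<close>

lemma nontriv_deriv_if_nonconstant:
  assumes nice: "f nicely_meromorphic_on UNIV" and nc: "\<And>c. \<exists>z. f z \<noteq> c"
  shows "nontriv_mero (deriv f)"
proof (rule nontriv_meroI)
  have mero: "f meromorphic_on UNIV" using nice by (simp add: nicely_meromorphic_on_def)
  then show "deriv f meromorphic_on UNIV" by (rule meromorphic_on_deriv)
  show "\<not> (\<forall>\<^sub>\<approx>z\<in>UNIV. deriv f z = 0)"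
  proof
    assume "\<forall>\<^sub>\<approx>z\<in>UNIV. deriv f z = 0"
    then have ev: "\<forall>\<^sub>F w in at z. deriv f w = 0" for z by (simp add: eventually_cosparse_open_eq)
    have np: "\<not> is_pole f z" for z
    proof
      assume "is_pole f z"
      then have "is_pole (deriv f) z"
        using is_pole_deriv_iff[OF meromorphic_on_subset[OF mero]] by blast
      then have "is_pole (\<lambda>_. 0 :: complex) z"
        using is_pole_cong[OF ev refl] by blast
      then show False using analytic_at_imp_no_pole[of "\<lambda>_. 0" z] by auto
    qed
    then have an: "f analytic_on {z}" for z using nicely_meromorphic_on_imp_analytic_at[OF nice] by auto
    have d0: "deriv f z = 0" for z
    proof (rule eq_at_if_eventually_eq[where h = "deriv f" and k = "\<lambda>_. 0"])
      show "isCont (deriv f) z" using analytic_deriv[OF an] analytic_at_imp_isCont by blast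
    qed (use ev in auto)
    have "f constant_on UNIV"
    proof (rule has_field_derivative_0_imp_constant_on)
      fix z show "(f has_field_derivative 0) (at z)"
        using an[of z] d0[of z] field_differentiable_derivI[of f z] by (simp add: analytic_on_imp_differentiable_at)
    qed auto
    then show False using nc by (auto simp: constant_on_def)
  qed
qed

lemma mero_zeros_cong:
  assumes "\<And>z. \<forall>\<^sub>F w in at z. h w = k w"
  shows "mero_zeros h = mero_zeros k"
  using tendsto_cong[OF assms] by (auto simp: mero_zeros_def)

theorem theorem1p6:
  fixes f :: "complex \<Rightarrow> complex"
  assumes "f meromorphic_on UNIV"
    and "transcendental_mero f"
    and "(\<lambda>r. nevanlinna_T f r) \<in> O[at_top](\<lambda>r. (ln r) ^ 2)"
  defines "g \<equiv> (\<lambda>z. f (z + 1) - f z)"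
    and "G \<equiv> (\<lambda>z. (f (z + 1) - f z) / f z)"
  shows "infinite (mero_zeros g) \<or> infinite (mero_zeros G)"
proof (rule ccontr)
  assume "\<not> (infinite (mero_zeros g) \<or> infinite (mero_zeros G))"
  then have fin: "finite (mero_zeros g)" "finite (mero_zeros G)" by auto
  \<comment> \<open>The values of \<open>f\<close> at singular points are arbitrary;
    \<open>h\<close> is analytic off its poles and has the same characteristic and the same zero
    sets of the two differences.\<close>
  define h where "h = remove_sings f"
  have nice: "h nicely_meromorphic_on UNIV"
    unfolding h_def by (rule remove_sings_nicely_meromorphic[OF assms(1)])
  have hf: "\<forall>\<^sub>\<approx>z\<in>UNIV. h z = f z"
    unfolding h_def by (rule eventually_remove_sings_eq[OF assms(1)])
  have nrat: "\<not> (\<forall>\<^sub>\<approx>z\<in>UNIV. f z = poly p z / poly q z)" if "q \<noteq> 0" for p q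
    using assms(2) that by (auto simp: transcendental_mero_def)
  have nrath: "\<not> (\<forall>\<^sub>\<approx>z\<in>UNIV. h z = poly p z / poly q z)" if "q \<noteq> 0" for p q
  proof
    assume "\<forall>\<^sub>\<approx>z\<in>UNIV. h z = poly p z / poly q z"
    with hf have "\<forall>\<^sub>\<approx>z\<in>UNIV. f z = poly p z / poly q z" by eventually_elim simp
    then show False using nrat that by blast
  qed
  have f: "nontriv_mero f"
    using nontriv_meroI[OF assms(1)] nrat[of 1 0] by simp
  have h: "nontriv_mero h" unfolding h_def by (rule nontriv_mero_remove_sings[OF f])
  have ha: "nontriv_mero (\<lambda>z. h z - \<alpha>)" for \<alpha>
  proof (rule nontriv_meroI)
    show "(\<lambda>z. h z - \<alpha>) meromorphic_on UNIV" by (intro meromorphic_intros nontriv_mero_meromorphic h)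
    show "\<not> (\<forall>\<^sub>\<approx>z\<in>UNIV. h z - \<alpha> = 0)"
      using nrath[of 1 "[:\<alpha>:]"] by simp
  qed
  have "\<exists>z. h z \<noteq> c" for c
  proof (rule ccontr)
    assume "\<not> ?thesis"
    then have "\<forall>\<^sub>\<approx>z\<in>UNIV. h z = poly [:c:] z / poly 1 z" by simp
    then show False using nrath[of 1 "[:c:]"] by simp
  qed
  then have F: "nontriv_mero (deriv h)" by (rule nontriv_deriv_if_nonconstant[OF nice])
  have slow: "slow_growth h"
  proof (rule slow_growth_if_nevanlinna[OF h nice])
    have "\<forall>\<^sub>F r in at_top. nevanlinna_T h r = nevanlinna_T f r"
      using eventually_gt_at_top[of 0] unfolding h_def
      by eventually_elim (rule nevanlinna_T_remove_sings[OF f])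
    then show "(\<lambda>r. nevanlinna_T h r) \<in> O[at_top](\<lambda>r. (ln r)^2)"
      using assms(3) by (subst landau_o.big.in_cong)
  qed
  have ev: "\<forall>\<^sub>F w in at z. h w = f w" for z using hf by (simp add: eventually_cosparse_open_eq)
  have ev1: "\<forall>\<^sub>F w in at z. h (w + 1) = f (w + 1)" for z
    using ev[of "1 + z"] by (simp add: at_to_0'[of z] at_to_0'[of "1 + z"] eventually_filtermap add_ac)
  have "mero_zeros (\<lambda>z. h (z + 1) - h z) = mero_zeros g"
  proof (rule mero_zeros_cong)
    fix z show "\<forall>\<^sub>F w in at z. h (w + 1) - h w = g w"
      using ev[of z] ev1[of z] by eventually_elim (simp add: g_def)
  qed
  then have fing: "finite (mero_zeros (\<lambda>z. h (z + 1) - h z))" using fin by simp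
  have "mero_zeros (\<lambda>z. (h (z + 1) - h z) / h z) = mero_zeros G"
  proof (rule mero_zeros_cong)
    fix z show "\<forall>\<^sub>F w in at z. (h (w + 1) - h w) / h w = G w"
      using ev[of z] ev1[of z] by eventually_elim (simp add: G_def)
  qed
  then have finG: "finite (mero_zeros (\<lambda>z. (h (z + 1) - h z) / h z))" using fin by simp
  have "nontriv_mero (\<lambda>z. h (z + 1) - h z)"
  proof (rule nontriv_meroI)
    show "(\<lambda>z. h (z + 1) - h z) meromorphic_on UNIV"
      by (intro meromorphic_intros nontriv_mero_meromorphic h nontriv_mero_shift)
    \<comment> \<open>If the difference vanished identically, its limit would be 0 at every point
      and \<open>mero_zeros\<close> would be the whole plane, against the assumed
      finiteness.\<close>
    show "\<not> (\<forall>\<^sub>\<approx>z\<in>UNIV. h (z + 1) - h z = 0)"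
    proof
      assume "\<forall>\<^sub>\<approx>z\<in>UNIV. h (z + 1) - h z = 0"
      then have "((\<lambda>z. h (z + 1) - h z) \<longlongrightarrow> 0) (at z)" for z
        by (intro tendsto_eventually) (simp add: eventually_cosparse_open_eq)
      then have "mero_zeros (\<lambda>z. h (z + 1) - h z) = UNIV" by (auto simp: mero_zeros_def)
      then show False using fing infinite_UNIV_char_0[where 'a = complex] by simp
    qed
  qed
  then show False
    using difference_zeros_nice[OF nice h slow ha F _ _ fing finG] nrath by blast
qed

end
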